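(* Let $G=(V,E)$ be a uniformly random $\Delta$-regular graph. There is a function $\gamma(\Delta)\to0$ as $\Delta\to\infty$ such that, with $\alpha=\frac{\log\Delta}{(2+\gamma(\Delta))\Delta}$, with high probability over the randomness of $G$ the following holds: for every $k\le\alpha|V|$, the independent set slice $(\mathcal X,\mu^{(k)})$ is connected and is a $\frac{1}{2k}$-top-link spectral expander, and as a result the down-up walk on it mixes in polynomial time.
   Context: A random $\Delta$-regular graph is uniform over simple $\Delta$-regular graphs on $n$ vertices; "with high probability" means probability $\to1$ as $n\to\infty$. Independent set slice: $\mathcal I_k(G)$ is the set of independent sets of $G$ of size $k$, $\mu^{(k)}$ the uniform distribution on it, and $\mathcal X$ the complex on ground set $V$ with facets $\mathcal I_k(G)$ (faces: their subsets), of dimension $d=k$. Complex notions: $\mathrm{codim}(\tau)=d-|\tau|$; the link of face $\tau$ has vertex set $\mathcal X_\tau(1)=\{v\notin\tau:\tau\cup\{v\}\text{ a face}\}$, its 1-skeleton is the weighted graph with edges $\{u,v\}$ such that $\tau\cup\{u,v\}$ is a face, weight $\Pr_{S\sim\mu}[u,v\in S\mid\tau\subseteq S]$; $P_\tau$ is the random walk on it (for codimension 2, $P_\tau(u,v)=\Pr_{S\sim\mu}[v\in S\mid\tau\cup\{u\}\subseteq S]$). Connected: each such 1-skeleton with $\mathrm{codim}(\tau)\ge2$ is connected. $\eta$-top-link spectral expander: $\lambda_2(P_\tau)\le\eta$ for every face $\tau$ of codimension 2. Down-up walk: from facet $F$ remove a uniformly random $v\in F$, then move to facet $F'\supseteq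 F\setminus\{v\}$ with probability $\propto\mu(F')$. "Mixes in polynomial time": $\varepsilon$-mixing time polynomial in $|V|$ and $\log(1/\varepsilon)$. *)

theory Defs
  imports
    "HOL-Probability.Probability"
    "HOL-Computational_Algebra.Polynomial"
    "Jordan_Normal_Form.Char_Poly"
begin

section \<open>Regular graphs and independent sets\<close>

text \<open>Graphs have vertex set \<open>{..<n}\<close> and are given by their set of two-element edges.\<close>

definition regular_graphs :: "nat \<Rightarrow> nat \<Rightarrow> nat set set set" where
  "regular_graphs n \<Delta> =
     {E. (\<forall>e\<in>E. e \<subseteq> {..<n} \<and> card e = 2) \<and> (\<forall>v<n. card {e\<in>E. v \<in> e} = \<Delta>)}"

text \<open>
  The filter below restricts \<open>n \<rightarrow> \<infinity>\<close> to those \<open>n\<close> for which some \<open>\<Delta>\<close>-regular graph exists, i.e.\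
  \<open>\<Delta> < n\<close> and \<open>n * \<Delta>\<close> even; for other \<open>n\<close> there is no uniform distribution.
\<close>

definition whp_regular :: "nat \<Rightarrow> (nat \<Rightarrow> nat set set \<Rightarrow> bool) \<Rightarrow> bool" where
  "whp_regular \<Delta> Q \<longleftrightarrow>
     ((\<lambda>n. measure_pmf.prob (pmf_of_set (regular_graphs n \<Delta>)) {E. Q n E}) \<longlongrightarrow> 1)
       (inf sequentially (principal {n. regular_graphs n \<Delta> \<noteq> {}}))"

definition indep_sets_of_size :: "nat \<Rightarrow> nat set set \<Rightarrow> nat \<Rightarrow> nat set set" where
  "indep_sets_of_size n E k =
     {S. S \<subseteq> {..<n} \<and> card S = k \<and> (\<forall>u\<in>S. \<forall>v\<in>S. {u, v} \<notin> E)}"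

text \<open>Only meaningful if there is an independent set of size \<open>k\<close>.\<close>

definition slice :: "nat \<Rightarrow> nat set set \<Rightarrow> nat \<Rightarrow> nat set pmf" where
  "slice n E k = pmf_of_set (indep_sets_of_size n E k)"


section \<open>Weighted simplicial complexes\<close>

text \<open>
  A pure weighted complex is represented by its distribution \<open>\<mu>\<close> on facets: the facets are
  \<open>set_pmf \<mu>\<close>. The dimension \<open>d\<close> is the common cardinality of the facets.
\<close>

definition faces :: "'a set pmf \<Rightarrow> 'a set set" where
  "faces \<mu> = {\<tau>. \<exists>F\<in>set_pmf \<mu>. \<tau> \<subseteq> F}"

definition codim :: "nat \<Rightarrow> 'a set \<Rightarrow> nat" where
  "codim d \<tau> = d - card \<tau>"

definition link_vertices :: "'a set pmf \<Rightarrow> 'a set \<Rightarrow> 'a set" where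
  "link_vertices \<mu> \<tau> = {v. v \<notin> \<tau> \<and> insert v \<tau> \<in> faces \<mu>}"

definition skeleton_edges :: "'a set pmf \<Rightarrow> 'a set \<Rightarrow> ('a \<times> 'a) set" where
  "skeleton_edges \<mu> \<tau> =
     {(u, v). u \<in> link_vertices \<mu> \<tau> \<and> v \<in> link_vertices \<mu> \<tau> \<and> u \<noteq> v \<and> \<tau> \<union> {u, v} \<in> faces \<mu>}"

definition connected_complex :: "nat \<Rightarrow> 'a set pmf \<Rightarrow> bool" where
  "connected_complex d \<mu> \<longleftrightarrow>
     (\<forall>\<tau>\<in>faces \<mu>. codim d \<tau> \<ge> 2 \<longrightarrow>
        (\<forall>u\<in>link_vertices \<mu> \<tau>. \<forall>v\<in>link_vertices \<mu> \<tau>. (u, v) \<in> (skeleton_edges \<mu> \<tau>)\<^sup>*))"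

definition skeleton_weight :: "'a set pmf \<Rightarrow> 'a set \<Rightarrow> 'a \<Rightarrow> 'a \<Rightarrow> real" where
  "skeleton_weight \<mu> \<tau> u v =
     (if (u, v) \<in> skeleton_edges \<mu> \<tau>
      then measure_pmf.prob (cond_pmf \<mu> {S. \<tau> \<subseteq> S}) {S. u \<in> S \<and> v \<in> S} else 0)"

text \<open>
  If \<open>\<tau>\<close> has codimension 2, a facet containing \<open>insert u \<tau>\<close> has exactly one further vertex, so the
  denominator is \<open>Pr[u \<in> S | \<tau> \<subseteq> S]\<close> and, for \<open>u \<noteq> v\<close> in the link,
  \<open>link_walk \<mu> \<tau> u v = Pr[v \<in> S | insert u \<tau> \<subseteq> S]\<close>.
\<close>

definition link_walk :: "'a set pmf \<Rightarrow> 'a set \<Rightarrow> 'a \<Rightarrow> 'a \<Rightarrow> real" where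
  "link_walk \<mu> \<tau> u v =
     skeleton_weight \<mu> \<tau> u v / (\<Sum>w\<in>link_vertices \<mu> \<tau>. skeleton_weight \<mu> \<tau> u w)"

text \<open>The linear order on vertices only serves to index rows and columns.\<close>

definition link_walk_mat :: "('a :: linorder) set pmf \<Rightarrow> 'a set \<Rightarrow> real mat" where
  "link_walk_mat \<mu> \<tau> =
     (let vs = sorted_list_of_set (link_vertices \<mu> \<tau>)
      in mat (length vs) (length vs) (\<lambda>(i, j). link_walk \<mu> \<tau> (vs ! i) (vs ! j)))"

text \<open>
  The second entry of the decreasing list of real eigenvalues, with algebraic multiplicity. It is
  applied to walk matrices of weighted undirected graphs; these are similar to symmetric
  matrices, so all their eigenvalues are real. The link of a face of codimension 2 has at least
  two vertices, so the second entry exists.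
\<close>

definition second_eigenvalue :: "real mat \<Rightarrow> real" where
  "second_eigenvalue A = rev (sorted_list_of_multiset (proots (char_poly A))) ! 1"

definition top_link_expander :: "nat \<Rightarrow> ('a :: linorder) set pmf \<Rightarrow> real \<Rightarrow> bool" where
  "top_link_expander d \<mu> \<eta> \<longleftrightarrow>
     (\<forall>\<tau>\<in>faces \<mu>. codim d \<tau> = 2 \<longrightarrow> second_eigenvalue (link_walk_mat \<mu> \<tau>) \<le> \<eta>)"


section \<open>The down-up walk and its mixing time\<close>

definition down_up :: "'a set pmf \<Rightarrow> 'a set \<Rightarrow> 'a set pmf" where
  "down_up \<mu> F = bind_pmf (pmf_of_set F) (\<lambda>v. cond_pmf \<mu> {F'. F - {v} \<subseteq> F'})"

definition down_up_steps :: "'a set pmf \<Rightarrow> nat \<Rightarrow> 'a set \<Rightarrow> 'a set pmf" where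
  "down_up_steps \<mu> t F = ((\<lambda>p. bind_pmf p (down_up \<mu>)) ^^ t) (return_pmf F)"

definition tv_dist :: "'a pmf \<Rightarrow> 'a pmf \<Rightarrow> real" where
  "tv_dist p q = (SUP A. \<bar>measure_pmf.prob p A - measure_pmf.prob q A\<bar>)"

text \<open>Worst case over the initial facet; it is \<open>\<infinity>\<close> if the walk never gets \<open>\<epsilon>\<close>-close to \<open>\<mu>\<close>.\<close>

definition mixing_time :: "'a set pmf \<Rightarrow> real \<Rightarrow> enat" where
  "mixing_time \<mu> \<epsilon> =
     Inf {enat t | t. \<forall>F\<in>set_pmf \<mu>. tv_dist (down_up_steps \<mu> t F) \<mu> \<le> \<epsilon>}"

text \<open>
  For \<open>x \<ge> 1\<close> and \<open>y \<ge> 0\<close> every polynomial in \<open>x\<close> and \<open>y\<close> is bounded by some \<open>C * (x + y) ^ c\<close>, so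
  the constants \<open>C\<close>, \<open>c\<close> represent an arbitrary polynomial bound in \<open>n\<close> and \<open>ln (1 / \<epsilon>)\<close>.
\<close>

definition mixes_within :: "real \<Rightarrow> nat \<Rightarrow> nat \<Rightarrow> 'a set pmf \<Rightarrow> bool" where
  "mixes_within C c n \<mu> \<longleftrightarrow>
     (\<forall>\<epsilon>. 0 < \<epsilon> \<and> \<epsilon> < 1 \<longrightarrow>
        ereal_of_enat (mixing_time \<mu> \<epsilon>) \<le> ereal (C * (real n + ln (1 / \<epsilon>)) ^ c))"

end

theory Submission
  imports Defs "Jordan_Normal_Form.Schur_Decomposition" "HOL-Real_Asymp.Real_Asymp"
begin

text \<open>
  The link of a codimension 2 face \<open>\<tau>\<close> is the complement of the graph induced on the vertices left
  free by \<open>\<tau>\<close>. Its walk has second eigenvalue at most \<open>(\<Lambda> - 1) / (h - 1 - \<Delta>)\<close> if \<open>h\<close> vertices are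
  free and the adjacency matrix of \<open>G\<close> has no eigenvalue below \<open>-\<Lambda>\<close>. With high probability
  \<open>\<Lambda> = O(\<surd>\<Delta> (ln \<Delta>)\<^sup>2)\<close> works, whereas every set of at most \<open>\<alpha> n\<close> vertices leaves
  \<open>\<Delta>\<^sup>-\<^sup>1\<^sup>/\<^sup>2 (ln \<Delta>)\<^sup>1\<^sup>0 n\<close> vertices free, up to a constant, when \<open>\<gamma> = 60 ln ln \<Delta> / ln \<Delta>\<close>; this beats
  \<open>2 k \<Lambda>\<close>. Both events follow from union bounds over vertex sets. The exponential moments of the edge
  counts and of the number of uncovered vertices are estimated directly in the uniform model: switching
  two edges changes these statistics by at most 4, and counting switchings in both directions turns
  into a differential inequality for the moment generating function. Discrepancy of edge counts
  yields the bound on \<open>\<Lambda>\<close> by expanding vectors in binary digits, as in the converse expander mixing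
  lemma of Bilu and Linial. For small \<open>\<Delta>\<close> the function \<open>\<gamma>\<close> is taken so large that the trivial bounds
  \<open>\<Lambda> = \<Delta>\<close> and \<open>h \<ge> n - k (\<Delta> + 1)\<close> suffice. Mixing follows from Oppenheim's trickling-down theorem and
  the local-to-global argument of Alev and Lau: the down-up walk has spectral gap at least \<open>1 / (2 k)\<close>.
\<close>

section \<open>The second eigenvalue of a reversible matrix\<close>

unbundle no vec_syntax

text \<open>Where the constant 2 comes from: a set of \<open>\<alpha> n\<close> vertices misses
  about \<open>exp (- \<alpha> \<Delta>) n\<close> vertices, which is n over the square root of
  \<open>\<Delta>\<close> when \<open>\<alpha>\<close> is close to
  \<open>ln \<Delta> / (2 \<Delta>)\<close>, and \<open>2 k \<Lambda>\<close> has the same order up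
  to powers of \<open>ln \<Delta>\<close>. Lowering \<open>\<alpha>\<close> through
  \<open>\<gamma>\<close> multiplies the first quantity by at least \<open>(ln \<Delta>)^10\<close>,
  so polylogarithmic losses, in \<open>\<Lambda>\<close> as well as in the union bound, are absorbed
  by \<open>\<gamma>\<close>. Free vertices are counted for all small sets, independent or not; the
  union bound affords this because the failure exponent \<open>\<theta> p n / 2\<close>, with p
  above \<open>\<Delta>\<close> to the power -1/2, dwarfs the entropy
  \<open>\<alpha> n ln (1 / \<alpha>)\<close>, of order n / \<open>\<Delta>\<close> up to
  logarithms. The bound \<open>1 / (2 k)\<close> is what trickling down needs: in codimension j it
  becomes \<open>1 / (2 k - j + 2)\<close>, still below \<open>1 / k\<close>, and the resulting
  variance losses telescope to \<open>(k + 1) / (2 k)\<close>, more than one half. All of this is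
  phrased with unnormalised quadratic forms of functions; matrices enter only through the definition
  of the second eigenvalue.\<close>

lemma real_eigenvalue_of_reversible:
  fixes A :: "real mat" and \<pi> :: "nat \<Rightarrow> real" and z :: complex
  assumes A: "A \<in> carrier_mat m m"
    and pos: "\<And>i. i < m \<Longrightarrow> \<pi> i > 0"
    and sym: "\<And>i j. i < m \<Longrightarrow> j < m \<Longrightarrow> \<pi> i * A $$ (i, j) = \<pi> j * A $$ (j, i)"
    and ev: "eigenvalue (map_mat complex_of_real A) z"
  shows "z \<in> \<real>"
proof -
  let ?A = "map_mat complex_of_real A"
  obtain v where v: "v \<in> carrier_vec m" "v \<noteq> 0\<^sub>v m" "?A *\<^sub>v v = z \<cdot>\<^sub>v v"
    using ev A unfolding eigenvalue_def eigenvector_def by auto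
  have Av: "(\<Sum>j<m. complex_of_real (A $$ (i, j)) * v $ j) = z * v $ i" if "i < m" for i
  proof -
    have "(?A *\<^sub>v v) $ i = z * v $ i"
      using v that by auto
    thus ?thesis
      using that A v(1) by (auto simp: scalar_prod_def lessThan_atLeast0)
  qed
  define S where "S = (\<Sum>i<m. \<Sum>j<m. complex_of_real (\<pi> i * A $$ (i, j)) * (cnj (v $ i) * v $ j))"
  define R where "R = (\<Sum>i<m. \<pi> i * (cmod (v $ i))\<^sup>2)"
  have "S = (\<Sum>i<m. complex_of_real (\<pi> i) * cnj (v $ i) * (\<Sum>j<m. complex_of_real (A $$ (i, j)) * v $ j))"
    unfolding S_def by (intro sum.cong refl) (simp add: sum_distrib_left algebra_simps)
  also have "\<dots> = (\<Sum>i<m. z * complex_of_real (\<pi> i * (cmod (v $ i))\<^sup>2))"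
  proof (intro sum.cong refl)
    fix i assume "i \<in> {..<m}"
    hence "complex_of_real (\<pi> i) * cnj (v $ i) * (\<Sum>j<m. complex_of_real (A $$ (i, j)) * v $ j)
      = complex_of_real (\<pi> i) * cnj (v $ i) * (z * v $ i)" by (simp add: Av)
    also have "\<dots> = z * complex_of_real (\<pi> i) * (v $ i * cnj (v $ i))" by (simp add: algebra_simps)
    finally show "complex_of_real (\<pi> i) * cnj (v $ i) * (\<Sum>j<m. complex_of_real (A $$ (i, j)) * v $ j)
      = z * complex_of_real (\<pi> i * (cmod (v $ i))\<^sup>2)"
      by (simp add: complex_norm_square[symmetric] mult.assoc)
  qed
  finally have S1: "S = z * complex_of_real R" by (simp add: R_def sum_distrib_left)
  have "cnj S = (\<Sum>i<m. \<Sum>j<m. complex_of_real (\<pi> i * A $$ (i, j)) * (v $ i * cnj (v $ j)))"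
    unfolding S_def by simp
  also have "\<dots> = (\<Sum>j<m. \<Sum>i<m. complex_of_real (\<pi> i * A $$ (i, j)) * (v $ i * cnj (v $ j)))"
    by (rule sum.swap)
  also have "\<dots> = S"
    unfolding S_def by (intro sum.cong refl) (simp add: sym mult.commute)
  finally have SR: "S \<in> \<real>" using Reals_cnj_iff by blast
  obtain i where i: "i < m" "v $ i \<noteq> 0" using v(1,2) by (metis eq_vecI index_zero_vec(1,2) carrier_vecD)
  have "R > 0"
    unfolding R_def
    by (rule sum_pos2[of _ i]) (use i pos in \<open>auto intro!: mult_nonneg_nonneg simp: less_imp_le\<close>)
  hence "z = S / complex_of_real R" using S1 by auto
  thus ?thesis using SR by auto
qed

lemma char_poly_splits_of_reversible:
  fixes A :: "real mat" and \<pi> :: "nat \<Rightarrow> real"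
  assumes A: "A \<in> carrier_mat m m"
    and pos: "\<And>i. i < m \<Longrightarrow> \<pi> i > 0"
    and sym: "\<And>i j. i < m \<Longrightarrow> j < m \<Longrightarrow> \<pi> i * A $$ (i, j) = \<pi> j * A $$ (j, i)"
  obtains es where "char_poly A = (\<Prod>e\<leftarrow>es. [:- e, 1:])" "length es = m"
proof -
  let ?A = "map_mat complex_of_real A"
  have cA: "?A \<in> carrier_mat m m" using A by auto
  obtain as where as: "char_poly ?A = (\<Prod>a\<leftarrow>as. [:- a, 1:])" "length as = m"
    using char_poly_factorized[OF cA] by blast
  have real: "a \<in> \<real>" if "a \<in> set as" for a
  proof -
    have "poly (char_poly ?A) a = 0"
      unfolding as(1) using that by (auto simp: poly_prod_list prod_list_zero_iff)
    hence "eigenvalue ?A a" using eigenvalue_root_char_poly[OF cA] by simp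
    thus ?thesis using real_eigenvalue_of_reversible[OF A pos sym] by blast
  qed
  define es where "es = map Re as"
  have as_es: "as = map complex_of_real es"
    unfolding es_def using real by (simp add: map_idI of_real_Re)
  have "map_poly complex_of_real (char_poly A) = char_poly ?A"
    by (simp add: of_real_hom.char_poly_hom[OF A])
  also have "\<dots> = (\<Prod>a\<leftarrow>es. [:- complex_of_real a, 1:])" unfolding as as_es by (simp add: o_def)
  also have "\<dots> = map_poly complex_of_real (\<Prod>e\<leftarrow>es. [:- e, 1:])"
  proof -
    interpret ph: map_poly_comm_ring_hom complex_of_real ..
    show ?thesis by (simp add: ph.hom_prod_list o_def)
  qed
  finally have *: "map_poly complex_of_real (char_poly A) = map_poly complex_of_real (\<Prod>e\<leftarrow>es. [:- e, 1:])" .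
  have "char_poly A = (\<Prod>e\<leftarrow>es. [:- e, 1:])"
  proof (rule poly_eqI)
    fix n
    have "complex_of_real (coeff (char_poly A) n) = complex_of_real (coeff (\<Prod>e\<leftarrow>es. [:- e, 1:]) n)"
      using arg_cong[OF *, of "\<lambda>p. coeff p n"] by (simp only: coeff_map_poly of_real_0)
    thus "coeff (char_poly A) n = coeff (\<Prod>e\<leftarrow>es. [:- e, 1:]) n" by (simp only: of_real_eq_iff)
  qed
  moreover have "length es = m" using as(2) by (simp add: es_def)
  ultimately show ?thesis using that by blast
qed

text \<open>Courant-Fischer: the two top eigenvectors span a plane, which meets every hyperplane in
  a nonzero vector, so a bound on the Rayleigh quotient on any one hyperplane bounds the second
  eigenvalue. The unweighted hyperplane is used because the all-ones part of the complement graph's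
  form vanishes on it.\<close>

lemma second_eigenvalue_le:
  fixes A :: "real mat" and \<pi> :: "nat \<Rightarrow> real"
  assumes A: "A \<in> carrier_mat m m" and m: "m \<ge> 2"
    and pos: "\<And>i. i < m \<Longrightarrow> \<pi> i > 0"
    and sym: "\<And>i j. i < m \<Longrightarrow> j < m \<Longrightarrow> \<pi> i * A $$ (i, j) = \<pi> j * A $$ (j, i)"
    and quad: "\<And>w. (\<Sum>i<m. w i) = 0 \<Longrightarrow>
      (\<Sum>i<m. \<Sum>j<m. \<pi> i * A $$ (i, j) * w i * w j) \<le> \<eta> * (\<Sum>i<m. \<pi> i * (w i)\<^sup>2)"
  shows "second_eigenvalue A \<le> \<eta>"
proof -
  obtain es0 where es0: "char_poly A = (\<Prod>e\<leftarrow>es0. [:- e, 1:])" "length es0 = m"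
    using char_poly_splits_of_reversible[OF A pos sym] by blast
  have proots: "proots (char_poly A) = mset es0"
  proof -
    have "proots (\<Prod>e\<leftarrow>xs. [:- e, 1:]) = mset xs" for xs :: "real list"
    proof (induction xs)
      case (Cons x xs)
      have "(\<Prod>e\<leftarrow>xs. [:- e, 1:]) \<noteq> 0" by (auto simp: prod_list_zero_iff)
      thus ?case using Cons by (simp add: proots_mult del: mult_pCons_left)
    qed simp
    thus ?thesis by (simp add: es0)
  qed
  \<comment> \<open>The Schur decomposition puts the eigenvalues on the diagonal in the order of the
    given list; the decreasing order makes the first two columns of \<open>P\<close> belong to the
    two largest.\<close>
  define es where "es = rev (sorted_list_of_multiset (mset es0))"
  have mset_es: "mset es = mset es0" by (simp add: es_def)
  have len: "length es = m" using mset_es es0(2) by (metis size_mset)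
  have es: "char_poly A = (\<Prod>e\<leftarrow>es. [:- e, 1:])"
    unfolding es0 using mset_es by (metis mset_map prod_mset_prod_list)
  have second: "second_eigenvalue A = es ! 1"
    unfolding second_eigenvalue_def proots es_def by simp
  have "sorted (rev es)" unfolding es_def by simp
  hence e01: "es ! 1 \<le> es ! 0"
    using len m sorted_rev_nth_mono[of es 0 1] by simp
  obtain B P Q where sd: "schur_decomposition A es = (B, P, Q)"
    by (cases "schur_decomposition A es") auto
  note sc = schur_decomposition[OF A es sd]
  hence ut: "upper_triangular B" and dB: "diag_mat B = es" by auto
  note wit = similar_mat_witD2[OF A conjunct1[OF sc]]
  define e0 e1 b where "e0 = B $$ (0,0)" and "e1 = B $$ (1,1)" and "b = B $$ (0,1)"
  have ee: "e0 = es ! 0" "e1 = es ! 1"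
    using m wit(5) unfolding dB[symmetric] e0_def e1_def diag_mat_def by auto
  define p0 p1 where "p0 i = P $$ (i, 0)" and "p1 i = P $$ (i, 1)" for i
  have AP: "A * P = P * B"
  proof -
    have "A * P = P * B * Q * P" using wit(3) by simp
    also have "\<dots> = P * B * (Q * P)"
      using wit by (intro assoc_mult_mat[of _ m m _ m _ m] mult_carrier_mat[of _ m m]) auto
    also have "\<dots> = P * B" unfolding wit(2)
      using wit by (intro right_mult_one_mat[of _ m m] mult_carrier_mat[of _ m m]) auto
    finally show ?thesis .
  qed
  have mul: "(\<Sum>j<m. A $$ (i, j) * P $$ (j, c)) = (\<Sum>l<m. P $$ (i, l) * B $$ (l, c))"
    if "i < m" "c < m" for i c
  proof -
    have "(A * P) $$ (i, c) = (P * B) $$ (i, c)" using AP by simp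
    thus ?thesis using that wit by (auto simp: scalar_prod_def lessThan_atLeast0)
  qed
  have Ap0: "(\<Sum>j<m. A $$ (i, j) * p0 j) = e0 * p0 i" if "i < m" for i
  proof -
    have "(\<Sum>l<m. P $$ (i, l) * B $$ (l, 0)) = (\<Sum>l\<in>{0}. P $$ (i, l) * B $$ (l, 0))"
      using m ut wit(5) by (intro sum.mono_neutral_right) (auto simp: upper_triangular_def)
    thus ?thesis using mul[of i 0] that m by (simp add: p0_def e0_def mult.commute)
  qed
  have Ap1: "(\<Sum>j<m. A $$ (i, j) * p1 j) = b * p0 i + e1 * p1 i" if "i < m" for i
  proof -
    have "(\<Sum>l<m. P $$ (i, l) * B $$ (l, 1)) = (\<Sum>l\<in>{0,1}. P $$ (i, l) * B $$ (l, 1))"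
      using m ut wit(5) by (intro sum.mono_neutral_right) (auto simp: upper_triangular_def)
    thus ?thesis using mul[of i 1] that m by (simp add: p0_def p1_def e1_def b_def mult.commute)
  qed
  have QP: "(\<Sum>j<m. Q $$ (i, j) * P $$ (j, c)) = (if i = c then 1 else 0)" if "i < m" "c < m" for i c
  proof -
    have "(Q * P) $$ (i, c) = (\<Sum>j<m. Q $$ (i, j) * P $$ (j, c))"
      using that wit(6,7) by (auto simp: scalar_prod_def lessThan_atLeast0)
    thus ?thesis using that by (simp add: wit(2))
  qed
  have indep: "\<alpha> = 0 \<and> \<beta> = 0" if z: "\<And>i. i < m \<Longrightarrow> \<alpha> * p0 i + \<beta> * p1 i = 0" for \<alpha> \<beta>
  proof -
    have "(\<Sum>j<m. Q $$ (r, j) * (\<alpha> * p0 j + \<beta> * p1 j)) = 0" for r using z by simp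
    hence "\<alpha> * (\<Sum>j<m. Q $$ (r, j) * p0 j) + \<beta> * (\<Sum>j<m. Q $$ (r, j) * p1 j) = 0" for r
      by (simp add: sum_distrib_left sum.distrib algebra_simps)
    from this[of 0] this[of 1] show ?thesis using m QP[of 0 0] QP[of 0 1] QP[of 1 0] QP[of 1 1]
      by (simp add: p0_def p1_def)
  qed
  define ip where "ip f g = (\<Sum>i<m. \<pi> i * f i * g i)" for f g :: "nat \<Rightarrow> real"
  define ap where "ap f i = (\<Sum>j<m. A $$ (i, j) * f j)" for f i
  have ip_add: "ip f (\<lambda>i. x * g i + y * h i) = x * ip f g + y * ip f h"
    and ip_add': "ip (\<lambda>i. x * g i + y * h i) f = x * ip g f + y * ip h f" for f g h x y
    unfolding ip_def by (simp_all add: sum_distrib_left sum.distrib algebra_simps)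
  have ap_add: "ap (\<lambda>i. x * g i + y * h i) i = x * ap g i + y * ap h i" for x y g h i
    unfolding ap_def by (simp add: sum_distrib_left sum.distrib algebra_simps)
  have ip_cong: "ip f g = ip f' g'" if "\<And>i. i < m \<Longrightarrow> f i = f' i" "\<And>i. i < m \<Longrightarrow> g i = g' i" for f g f' g'
    unfolding ip_def using that by simp
  have selfadj: "ip f (ap g) = ip (ap f) g" for f g
  proof -
    have "ip f (ap g) = (\<Sum>i<m. \<Sum>j<m. (\<pi> i * A $$ (i, j)) * f i * g j)"
      unfolding ip_def ap_def by (simp add: sum_distrib_left algebra_simps)
    also have "\<dots> = (\<Sum>i<m. \<Sum>j<m. (\<pi> j * A $$ (j, i)) * f i * g j)"
      by (intro sum.cong refl) (simp add: sym)
    also have "\<dots> = (\<Sum>j<m. \<Sum>i<m. (\<pi> j * A $$ (j, i)) * f i * g j)" by (rule sum.swap)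
    also have "\<dots> = ip (ap f) g"
      unfolding ip_def ap_def by (simp add: sum_distrib_left sum_distrib_right algebra_simps)
    finally show ?thesis .
  qed
  have ip_pos: "ip f f > 0" if "i < m" "f i \<noteq> 0" for f i
    unfolding ip_def using that pos
    by (intro sum_pos2[of _ i]) (auto simp: mult.assoc zero_less_mult_iff less_imp_le intro!: mult_nonneg_nonneg)
  obtain i0 where i0: "i0 < m" "p0 i0 \<noteq> 0" using indep[of 1 0] by fastforce
  have n0: "ip p0 p0 > 0" using ip_pos i0 by blast
  \<comment> \<open>Gram-Schmidt in the \<open>\<pi>\<close>-weighted inner product.
    Self-adjointness then kills the superdiagonal entry \<open>b'\<close>, so \<open>q\<close> is an
    eigenvector for \<open>e1\<close>, also if \<open>e0 = e1\<close>.\<close>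
  define c where "c = ip p0 p1 / ip p0 p0"
  define q where "q i = 1 * p1 i + (- c) * p0 i" for i
  have orth: "ip p0 q = 0"
    unfolding q_def ip_add using n0 by (simp add: c_def)
  have orth': "ip q p0 = 0" using orth by (simp add: ip_def mult.commute mult.left_commute)
  define b' where "b' = b + c * e1 - c * e0"
  have apq: "ap q i = b' * p0 i + e1 * q i" if "i < m" for i
    unfolding q_def ap_add using Ap0[OF that] Ap1[OF that]
    by (simp add: ap_def b'_def algebra_simps)
  have ap0: "ap p0 i = e0 * p0 i" if "i < m" for i using Ap0[OF that] by (simp add: ap_def)
  have "ip p0 (ap q) = b' * ip p0 p0"
    using ip_cong[of p0 p0 "ap q" "\<lambda>i. b' * p0 i + e1 * q i"] apq orth by (simp add: ip_add)
  moreover have "ip (ap p0) q = e0 * ip p0 q"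
    using ip_cong[of "ap p0" "\<lambda>i. e0 * p0 i + 0 * p0 i" q q] ap0 ip_add'[of e0 p0 0 p0 q] by simp
  ultimately have "b' = 0" using selfadj[of p0 q] orth n0 by simp
  hence apq: "ap q i = e1 * q i" if "i < m" for i using apq[OF that] by simp
  \<comment> \<open>One linear condition on two unknowns leaves a nonzero combination of
    \<open>p0\<close> and \<open>q\<close> in the hyperplane.\<close>
  obtain \<alpha> \<beta> where ab: "\<alpha> \<noteq> 0 \<or> \<beta> \<noteq> 0" "\<alpha> * (\<Sum>i<m. p0 i) + \<beta> * (\<Sum>i<m. q i) = 0"
  proof (cases "(\<Sum>i<m. q i) = 0 \<and> (\<Sum>i<m. p0 i) = 0")
    case True thus ?thesis using that[of 0 1] by simp
  next
    case False thus ?thesis using that[of "\<Sum>i<m. q i" "- (\<Sum>i<m. p0 i)"] by auto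
  qed
  define w where "w i = \<alpha> * p0 i + \<beta> * q i" for i
  have w0: "(\<Sum>i<m. w i) = 0" using ab(2) by (simp add: w_def sum.distrib sum_distrib_left)
  have "\<exists>i<m. w i \<noteq> 0"
  proof (rule ccontr)
    assume "\<not> ?thesis"
    hence "(\<alpha> - \<beta> * c) * p0 i + \<beta> * p1 i = 0" if "i < m" for i
      using that by (simp add: w_def q_def algebra_simps)
    from indep[OF this] ab(1) show False by auto
  qed
  hence wpos: "ip w w > 0" using ip_pos by blast
  have apw: "ap w i = \<alpha> * e0 * p0 i + \<beta> * e1 * q i" if "i < m" for i
    unfolding w_def ap_add using ap0[OF that] apq[OF that] by simp
  have ww: "ip w w = \<alpha>\<^sup>2 * ip p0 p0 + \<beta>\<^sup>2 * ip q q"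
    unfolding w_def ip_add ip_add' by (simp add: orth orth' power2_eq_square)
  have "ip w (ap w) = ip w (\<lambda>i. (\<alpha> * e0) * p0 i + (\<beta> * e1) * q i)"
    by (rule ip_cong) (use apw in auto)
  also have "\<dots> = e0 * (\<alpha>\<^sup>2 * ip p0 p0) + e1 * (\<beta>\<^sup>2 * ip q q)"
    unfolding w_def ip_add ip_add' by (simp add: orth orth' power2_eq_square algebra_simps)
  also have "\<dots> \<ge> e1 * (\<alpha>\<^sup>2 * ip p0 p0) + e1 * (\<beta>\<^sup>2 * ip q q)"
    using e01 n0 by (intro add_right_mono mult_right_mono) (auto simp: ee)
  finally have "e1 * ip w w \<le> ip w (ap w)" unfolding ww by (simp add: algebra_simps)
  also have "ip w (ap w) = (\<Sum>i<m. \<Sum>j<m. \<pi> i * A $$ (i, j) * w i * w j)"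
    unfolding ip_def ap_def by (simp add: sum_distrib_left algebra_simps)
  also have "\<dots> \<le> \<eta> * (\<Sum>i<m. \<pi> i * (w i)\<^sup>2)" by (rule quad[OF w0])
  also have "\<dots> = \<eta> * ip w w" by (simp add: ip_def power2_eq_square mult.assoc)
  finally have "e1 \<le> \<eta>" using wpos by simp
  thus ?thesis by (simp add: second ee)
qed

section \<open>Uniform complexes: trickling down and the spectral gap\<close>

locale facet_family =
  fixes F :: "'a set set" and V :: "'a set" and k :: nat
begin

definition Up :: "'a set \<Rightarrow> 'a set set" where "Up \<tau> = {S\<in>F. \<tau> \<subseteq> S}"

definition deg :: "'a set \<Rightarrow> real" where "deg \<tau> = real (card (Up \<tau>))"

text \<open>The weighted adjacency form of the link:
  \<open>deg (\<tau> \<union> {u, v}) * h u * h v\<close> summed over ordered pairs of distinct link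
  vertices.\<close>

definition Bf :: "'a set \<Rightarrow> ('a \<Rightarrow> real) \<Rightarrow> real" where
  "Bf \<tau> h = (\<Sum>S\<in>Up \<tau>. (\<Sum>u\<in>S - \<tau>. h u)\<^sup>2 - (\<Sum>u\<in>S - \<tau>. (h u)\<^sup>2))"

definition Df :: "'a set \<Rightarrow> ('a \<Rightarrow> real) \<Rightarrow> real" where
  "Df \<tau> h = (\<Sum>S\<in>Up \<tau>. \<Sum>u\<in>S - \<tau>. (h u)\<^sup>2)"

definition Mf :: "'a set \<Rightarrow> ('a \<Rightarrow> real) \<Rightarrow> real" where
  "Mf \<tau> h = (\<Sum>S\<in>Up \<tau>. \<Sum>u\<in>S - \<tau>. h u)"

text \<open>In codimension \<open>j\<close> the link walk has entries \<open>deg (\<tau> \<union>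
  {u, v}) / ((j - 1) * deg (insert u \<tau>))\<close>, so \<open>c\<close> is \<open>j - 1\<close>
  times a bound on its second eigenvalue.\<close>

definition local_gap :: "'a set \<Rightarrow> real \<Rightarrow> bool" where
  "local_gap \<tau> c \<longleftrightarrow> (\<forall>h. Mf \<tau> h = 0 \<longrightarrow> Bf \<tau> h \<le> c * Df \<tau> h)"

text \<open>The polarisation of \<open>Bf\<close>, written through the links of the vertices; the
  symmetric form is \<open>Bp_eq\<close>.\<close>

definition Bp :: "'a set \<Rightarrow> ('a \<Rightarrow> real) \<Rightarrow> ('a \<Rightarrow> real) \<Rightarrow> real" where
  "Bp \<tau> f g = (\<Sum>v\<in>V - \<tau>. Mf (insert v \<tau>) f * g v)"

definition link_edges :: "'a set \<Rightarrow> ('a \<times> 'a) set" where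
  "link_edges \<tau> = {(u, v). u \<notin> \<tau> \<and> v \<notin> \<tau> \<and> (\<exists>S\<in>F. \<tau> \<union> {u, v} \<subseteq> S)}"

definition link_connected :: "'a set \<Rightarrow> bool" where
  "link_connected \<tau> \<longleftrightarrow> (\<forall>u v. u \<notin> \<tau> \<longrightarrow> v \<notin> \<tau> \<longrightarrow> Up (insert u \<tau>) \<noteq> {} \<longrightarrow> Up (insert v \<tau>) \<noteq> {} \<longrightarrow>
     (u, v) \<in> (link_edges \<tau>)\<^sup>*)"

text \<open>This is \<open>deg \<tau>\<close> times the variance of \<open>g\<close> at a uniform
  facet containing \<open>\<tau>\<close>; division by zero makes it 0 if there is no such
  facet.\<close>

definition Vf :: "'a set \<Rightarrow> ('a set \<Rightarrow> real) \<Rightarrow> real" where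
  "Vf \<tau> g = (\<Sum>S\<in>Up \<tau>. (g S)\<^sup>2) - (\<Sum>S\<in>Up \<tau>. g S)\<^sup>2 / deg \<tau>"

text \<open>Sets lying in no facet are included; their \<open>Up\<close> is empty, so they
  contribute nothing to the sums below.\<close>

definition ridges :: "'a set \<Rightarrow> 'a set set" where
  "ridges \<tau> = {\<rho>. \<tau> \<subseteq> \<rho> \<and> \<rho> \<subseteq> V \<and> card \<rho> + 1 = k}"

text \<open>The transition probability of the down-up walk between facets (see
  \<open>pmf_down_up\<close>), in a form that shows its symmetry.\<close>

definition kernel :: "'a set \<Rightarrow> 'a set \<Rightarrow> real" where
  "kernel S S' = (\<Sum>\<rho>\<in>ridges {}. of_bool (\<rho> \<subseteq> S) * of_bool (\<rho> \<subseteq> S') / deg \<rho>) / k"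

definition walk_op :: "('a set \<Rightarrow> real) \<Rightarrow> 'a set \<Rightarrow> real" where
  "walk_op g S = (\<Sum>S'\<in>F. kernel S S' * g S')"

definition walk_form :: "('a set \<Rightarrow> real) \<Rightarrow> ('a set \<Rightarrow> real) \<Rightarrow> real" where
  "walk_form f g = (\<Sum>\<rho>\<in>ridges {}. (\<Sum>S\<in>Up \<rho>. f S) * (\<Sum>S\<in>Up \<rho>. g S) / deg \<rho>) / k"

end

locale pure_complex = facet_family +
  assumes finV: "finite V" and FV: "\<And>S. S \<in> F \<Longrightarrow> S \<subseteq> V" and cardF: "\<And>S. S \<in> F \<Longrightarrow> card S = k"
begin

lemma finF: "finite F"
  by (rule finite_subset[of _ "Pow V"]) (use FV finV in auto)

lemma fin_Up [simp]: "finite (Up \<tau>)"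
  using finF by (simp add: Up_def)

lemma fin_facet [simp]: "S \<in> Up \<tau> \<Longrightarrow> finite S"
  using finite_subset[OF FV finV] by (simp add: Up_def)

lemma card_facet_diff:
  assumes "S \<in> Up \<tau>" "card \<tau> + j = k"
  shows "card (S - \<tau>) = j"
  using assms cardF fin_facet[OF assms(1)] finite_subset[of \<tau> S]
  by (subst card_Diff_subset) (auto simp: Up_def)

lemma deg_nonneg [simp]: "deg \<tau> \<ge> 0" by (simp add: deg_def)

text \<open>Double counting of pairs of a facet above \<open>\<tau>\<close> and a vertex of it
  outside \<open>\<tau>\<close>. The localisation identities below all rest on this
  exchange.\<close>

lemma Up_swap:
  fixes \<phi> :: "'a \<Rightarrow> 'a set \<Rightarrow> real"
  shows "(\<Sum>S\<in>Up \<tau>. \<Sum>u\<in>S - \<tau>. \<phi> u S) = (\<Sum>u\<in>V - \<tau>. \<Sum>S\<in>Up (insert u \<tau>). \<phi> u S)"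
proof -
  have "(\<Sum>S\<in>Up \<tau>. \<Sum>u\<in>S - \<tau>. \<phi> u S) = (\<Sum>S\<in>Up \<tau>. \<Sum>u\<in>{u\<in>V - \<tau>. u \<in> S}. \<phi> u S)"
    using FV by (intro sum.cong) (auto simp: Up_def)
  also have "\<dots> = (\<Sum>u\<in>V - \<tau>. \<Sum>S\<in>{S\<in>Up \<tau>. u \<in> S}. \<phi> u S)"
    using finV by (intro sum.swap_restrict) auto
  also have "\<dots> = (\<Sum>u\<in>V - \<tau>. \<Sum>S\<in>Up (insert u \<tau>). \<phi> u S)"
    by (intro sum.cong) (auto simp: Up_def)
  finally show ?thesis .
qed

lemma Df_eq: "Df \<tau> h = (\<Sum>u\<in>V - \<tau>. deg (insert u \<tau>) * (h u)\<^sup>2)"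
  unfolding Df_def Up_swap by (simp add: deg_def)

lemma Mf_eq: "Mf \<tau> h = (\<Sum>u\<in>V - \<tau>. deg (insert u \<tau>) * h u)"
  unfolding Mf_def Up_swap by (simp add: deg_def)

lemma Df_nonneg: "Df \<tau> h \<ge> 0" unfolding Df_def by (intro sum_nonneg) auto

lemma sum_deg:
  assumes "card \<tau> + j = k"
  shows "(\<Sum>u\<in>V - \<tau>. deg (insert u \<tau>)) = j * deg \<tau>"
proof -
  have "(\<Sum>u\<in>V - \<tau>. deg (insert u \<tau>)) = Mf \<tau> (\<lambda>_. 1)" by (simp add: Mf_eq)
  also have "\<dots> = j * deg \<tau>" unfolding Mf_def using card_facet_diff[OF _ assms] by (simp add: deg_def)
  finally show ?thesis .
qed

lemma deg_zeroD: "deg \<tau> = 0 \<Longrightarrow> Up \<tau> = {}"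
  by (simp add: deg_def)

lemma Up_insert_subset: "Up (insert v \<tau>) \<subseteq> Up \<tau>" by (auto simp: Up_def)

lemma shift_forms:
  assumes "card \<tau> + j = k"
  shows "Bf \<tau> (\<lambda>u. f u - c) = Bf \<tau> f - 2 * (real j - 1) * c * Mf \<tau> f + j * (real j - 1) * c\<^sup>2 * deg \<tau>"
    and "Df \<tau> (\<lambda>u. f u - c) = Df \<tau> f - 2 * c * Mf \<tau> f + j * c\<^sup>2 * deg \<tau>"
    and "Mf \<tau> (\<lambda>u. f u - c) = Mf \<tau> f - j * c * deg \<tau>"
proof -
  have s1: "(\<Sum>u\<in>S - \<tau>. f u - c) = (\<Sum>u\<in>S - \<tau>. f u) - j * c"
    and s2: "(\<Sum>u\<in>S - \<tau>. (f u - c)\<^sup>2) = (\<Sum>u\<in>S - \<tau>. (f u)\<^sup>2) - 2 * c * (\<Sum>u\<in>S - \<tau>. f u) + j * c\<^sup>2"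
    if "S \<in> Up \<tau>" for S
    using card_facet_diff[OF that assms]
    by (simp_all add: sum_subtractf power2_diff sum.distrib sum_distrib_left mult_ac)
  show "Mf \<tau> (\<lambda>u. f u - c) = Mf \<tau> f - j * c * deg \<tau>"
  proof -
    have "Mf \<tau> (\<lambda>u. f u - c) = (\<Sum>S\<in>Up \<tau>. (\<Sum>u\<in>S - \<tau>. f u) - j * c)"
      unfolding Mf_def by (intro sum.cong refl s1)
    thus ?thesis unfolding Mf_def deg_def sum_subtractf by simp
  qed
  show "Df \<tau> (\<lambda>u. f u - c) = Df \<tau> f - 2 * c * Mf \<tau> f + j * c\<^sup>2 * deg \<tau>"
  proof -
    have "Df \<tau> (\<lambda>u. f u - c) = (\<Sum>S\<in>Up \<tau>. (\<Sum>u\<in>S - \<tau>. (f u)\<^sup>2) - 2 * c * (\<Sum>u\<in>S - \<tau>. f u) + j * c\<^sup>2)"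
      unfolding Df_def by (intro sum.cong refl s2)
    thus ?thesis unfolding Mf_def Df_def deg_def sum_subtractf sum.distrib sum_distrib_left[symmetric] by simp
  qed
  have "(\<Sum>u\<in>S - \<tau>. f u - c)\<^sup>2 - (\<Sum>u\<in>S - \<tau>. (f u - c)\<^sup>2) =
     ((\<Sum>u\<in>S - \<tau>. f u)\<^sup>2 - (\<Sum>u\<in>S - \<tau>. (f u)\<^sup>2)) - 2 * (real j - 1) * c * (\<Sum>u\<in>S - \<tau>. f u) + j * (real j - 1) * c\<^sup>2"
    if "S \<in> Up \<tau>" for S
    unfolding s1[OF that] s2[OF that] by (simp add: power2_eq_square algebra_simps)
  hence "Bf \<tau> (\<lambda>u. f u - c) = (\<Sum>S\<in>Up \<tau>. ((\<Sum>u\<in>S - \<tau>. f u)\<^sup>2 - (\<Sum>u\<in>S - \<tau>. (f u)\<^sup>2))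
     - 2 * (real j - 1) * c * (\<Sum>u\<in>S - \<tau>. f u) + j * (real j - 1) * c\<^sup>2)"
    unfolding Bf_def by (intro sum.cong refl)
  also have "\<dots> = Bf \<tau> f - (\<Sum>S\<in>Up \<tau>. 2 * (real j - 1) * c * (\<Sum>u\<in>S - \<tau>. f u)) + (\<Sum>S\<in>Up \<tau>. j * (real j - 1) * c\<^sup>2)"
    unfolding Bf_def by (simp only: sum.distrib sum_subtractf)
  also have "\<dots> = Bf \<tau> f - 2 * (real j - 1) * c * Mf \<tau> f + j * (real j - 1) * c\<^sup>2 * deg \<tau>"
    unfolding Mf_def deg_def sum_distrib_left by (simp add: mult_ac)
  finally show "Bf \<tau> (\<lambda>u. f u - c) = Bf \<tau> f - 2 * (real j - 1) * c * Mf \<tau> f + j * (real j - 1) * c\<^sup>2 * deg \<tau>" .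
qed

text \<open>Subtracting the weighted mean \<open>c\<close> leaves a function to which the gap
  applies; on constants \<open>Bf\<close> is exactly \<open>(j - 1) * Df\<close>, which accounts for
  the term with \<open>1 - \<kappa>\<close>.\<close>

lemma local_gap_general:
  assumes gap: "local_gap \<tau> ((real j - 1) * \<kappa>)" and j: "card \<tau> + j = k" "j \<ge> 1"
  shows "Bf \<tau> f \<le> (real j - 1) * (\<kappa> * Df \<tau> f + (1 - \<kappa>) * (Mf \<tau> f)\<^sup>2 / (j * deg \<tau>))"
proof (cases "deg \<tau> = 0")
  case True
  thus ?thesis using deg_zeroD[OF True] by (simp add: Bf_def Df_def Mf_def)
next
  case False
  define c where "c = Mf \<tau> f / (j * deg \<tau>)"
  have c: "c * (j * deg \<tau>) = Mf \<tau> f" using False j by (simp add: c_def)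
  note sh = shift_forms[OF j(1), of f c]
  have "Mf \<tau> (\<lambda>u. f u - c) = 0" unfolding sh using c by (simp add: mult_ac)
  hence "Bf \<tau> (\<lambda>u. f u - c) \<le> (real j - 1) * \<kappa> * Df \<tau> (\<lambda>u. f u - c)"
    using gap by (simp add: local_gap_def)
  also have "Df \<tau> (\<lambda>u. f u - c) = Df \<tau> f - c * Mf \<tau> f"
    unfolding sh using c by (simp add: power2_eq_square mult_ac algebra_simps)
  finally have *: "Bf \<tau> (\<lambda>u. f u - c) \<le> (real j - 1) * \<kappa> * (Df \<tau> f - c * Mf \<tau> f)" .
  have "Bf \<tau> (\<lambda>u. f u - c) = Bf \<tau> f - 2 * (real j - 1) * c * Mf \<tau> f + (real j - 1) * c * (c * (j * deg \<tau>))"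
    unfolding sh by (simp add: power2_eq_square)
  hence "Bf \<tau> (\<lambda>u. f u - c) = Bf \<tau> f - (real j - 1) * c * Mf \<tau> f" unfolding c by simp
  with * have "Bf \<tau> f \<le> (real j - 1) * (\<kappa> * Df \<tau> f + (1 - \<kappa>) * (c * Mf \<tau> f))" by (simp add: algebra_simps)
  thus ?thesis by (simp add: c_def power2_eq_square)
qed

text \<open>Garland's localisation: inside a facet, a pair of vertices outside \<open>\<tau>\<close>
  is seen from the links of the other \<open>j - 2\<close> vertices, a single vertex from those of
  the other \<open>j - 1\<close>.\<close>

lemma sum_link_forms:
  assumes "card \<tau> + j = k"
  shows "(\<Sum>v\<in>V - \<tau>. Bf (insert v \<tau>) f) = (real j - 2) * Bf \<tau> f"
    and "(\<Sum>v\<in>V - \<tau>. Df (insert v \<tau>) f) = (real j - 1) * Df \<tau> f"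
proof -
  have rem: "(\<Sum>u\<in>S - insert v \<tau>. \<phi> u) = (\<Sum>u\<in>S - \<tau>. \<phi> u) - \<phi> v"
    if "S \<in> Up \<tau>" "v \<in> S - \<tau>" for S v and \<phi> :: "'a \<Rightarrow> real"
  proof -
    have "S - insert v \<tau> = (S - \<tau>) - {v}" by auto
    thus ?thesis using that by (simp add: sum_diff1)
  qed
  have "(\<Sum>v\<in>V - \<tau>. Df (insert v \<tau>) f) = (\<Sum>S\<in>Up \<tau>. \<Sum>v\<in>S - \<tau>. \<Sum>u\<in>S - insert v \<tau>. (f u)\<^sup>2)"
    unfolding Df_def Up_swap ..
  also have "\<dots> = (\<Sum>S\<in>Up \<tau>. \<Sum>v\<in>S - \<tau>. (\<Sum>u\<in>S - \<tau>. (f u)\<^sup>2) - (f v)\<^sup>2)"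
    using rem by (intro sum.cong refl) auto
  also have "\<dots> = (\<Sum>S\<in>Up \<tau>. (real j - 1) * (\<Sum>u\<in>S - \<tau>. (f u)\<^sup>2))"
    using card_facet_diff[OF _ assms] by (intro sum.cong refl) (simp add: sum_subtractf algebra_simps)
  finally show "(\<Sum>v\<in>V - \<tau>. Df (insert v \<tau>) f) = (real j - 1) * Df \<tau> f"
    by (simp add: Df_def sum_distrib_left)
  have "(\<Sum>v\<in>V - \<tau>. Bf (insert v \<tau>) f) =
      (\<Sum>S\<in>Up \<tau>. \<Sum>v\<in>S - \<tau>. (\<Sum>u\<in>S - insert v \<tau>. f u)\<^sup>2 - (\<Sum>u\<in>S - insert v \<tau>. (f u)\<^sup>2))"
    unfolding Bf_def Up_swap ..
  also have "\<dots> = (\<Sum>S\<in>Up \<tau>. (real j - 2) * ((\<Sum>u\<in>S - \<tau>. f u)\<^sup>2 - (\<Sum>u\<in>S - \<tau>. (f u)\<^sup>2)))"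
  proof (rule sum.cong[OF refl])
    fix S assume S: "S \<in> Up \<tau>"
    define s q where "s = (\<Sum>u\<in>S - \<tau>. f u)" and "q = (\<Sum>u\<in>S - \<tau>. (f u)\<^sup>2)"
    have "(\<Sum>v\<in>S - \<tau>. (\<Sum>u\<in>S - insert v \<tau>. f u)\<^sup>2 - (\<Sum>u\<in>S - insert v \<tau>. (f u)\<^sup>2))
      = (\<Sum>v\<in>S - \<tau>. (s - f v)\<^sup>2 - (q - (f v)\<^sup>2))"
      using S rem by (intro sum.cong refl) (auto simp: s_def q_def)
    also have "\<dots> = (\<Sum>v\<in>S - \<tau>. (s\<^sup>2 - q) - 2 * s * f v + 2 * (f v)\<^sup>2)"
      by (intro sum.cong refl) (simp add: power2_eq_square algebra_simps)
    also have "\<dots> = j * (s\<^sup>2 - q) - 2 * s * s + 2 * q"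
      using card_facet_diff[OF S assms]
      by (simp add: sum.distrib sum_subtractf sum_distrib_left[symmetric] s_def q_def)
    also have "\<dots> = (real j - 2) * (s\<^sup>2 - q)" by (simp add: power2_eq_square algebra_simps)
    finally show "(\<Sum>v\<in>S - \<tau>. (\<Sum>u\<in>S - insert v \<tau>. f u)\<^sup>2 - (\<Sum>u\<in>S - insert v \<tau>. (f u)\<^sup>2))
      = (real j - 2) * ((\<Sum>u\<in>S - \<tau>. f u)\<^sup>2 - (\<Sum>u\<in>S - \<tau>. (f u)\<^sup>2))"
      unfolding s_def q_def .
  qed
  finally show "(\<Sum>v\<in>V - \<tau>. Bf (insert v \<tau>) f) = (real j - 2) * Bf \<tau> f"
    by (simp add: Bf_def sum_distrib_left)
qed

lemma Bp_eq: "Bp \<tau> f g = (\<Sum>S\<in>Up \<tau>. (\<Sum>u\<in>S - \<tau>. f u) * (\<Sum>u\<in>S - \<tau>. g u) - (\<Sum>u\<in>S - \<tau>. f u * g u))"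
proof -
  have "Bp \<tau> f g = (\<Sum>v\<in>V - \<tau>. \<Sum>S\<in>Up (insert v \<tau>). (\<Sum>u\<in>S - insert v \<tau>. f u) * g v)"
    unfolding Bp_def Mf_def by (simp add: sum_distrib_right)
  also have "\<dots> = (\<Sum>S\<in>Up \<tau>. \<Sum>v\<in>S - \<tau>. (\<Sum>u\<in>S - insert v \<tau>. f u) * g v)"
    unfolding Up_swap ..
  also have "\<dots> = (\<Sum>S\<in>Up \<tau>. \<Sum>v\<in>S - \<tau>. ((\<Sum>u\<in>S - \<tau>. f u) - f v) * g v)"
  proof (intro sum.cong refl)
    fix S v assume S: "S \<in> Up \<tau>" "v \<in> S - \<tau>"
    have "S - insert v \<tau> = (S - \<tau>) - {v}" by auto
    thus "(\<Sum>u\<in>S - insert v \<tau>. f u) * g v = ((\<Sum>u\<in>S - \<tau>. f u) - f v) * g v"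
      using S by (simp add: sum_diff1)
  qed
  finally show ?thesis by (simp add: left_diff_distrib sum_subtractf sum_distrib_left)
qed

lemma Bf_add: "Bf \<tau> (\<lambda>u. f u + t * g u) = Bf \<tau> f + 2 * t * Bp \<tau> f g + t\<^sup>2 * Bf \<tau> g"
proof -
  have "Bf \<tau> (\<lambda>u. f u + t * g u) = (\<Sum>S\<in>Up \<tau>.
      ((\<Sum>u\<in>S - \<tau>. f u)\<^sup>2 - (\<Sum>u\<in>S - \<tau>. (f u)\<^sup>2)) +
      (2 * t * ((\<Sum>u\<in>S - \<tau>. f u) * (\<Sum>u\<in>S - \<tau>. g u) - (\<Sum>u\<in>S - \<tau>. f u * g u)) +
      t\<^sup>2 * ((\<Sum>u\<in>S - \<tau>. g u)\<^sup>2 - (\<Sum>u\<in>S - \<tau>. (g u)\<^sup>2))))"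
    unfolding Bf_def
  proof (intro sum.cong refl)
    fix S
    have 1: "(\<Sum>u\<in>S - \<tau>. f u + t * g u) = (\<Sum>u\<in>S - \<tau>. f u) + t * (\<Sum>u\<in>S - \<tau>. g u)"
      by (simp add: sum.distrib sum_distrib_left)
    have 2: "(\<Sum>u\<in>S - \<tau>. (f u + t * g u)\<^sup>2) =
        (\<Sum>u\<in>S - \<tau>. (f u)\<^sup>2) + 2 * t * (\<Sum>u\<in>S - \<tau>. f u * g u) + t\<^sup>2 * (\<Sum>u\<in>S - \<tau>. (g u)\<^sup>2)"
      unfolding sum_distrib_left sum.distrib[symmetric]
      by (intro sum.cong refl) (simp add: power2_eq_square algebra_simps)
    show "(\<Sum>u\<in>S - \<tau>. f u + t * g u)\<^sup>2 - (\<Sum>u\<in>S - \<tau>. (f u + t * g u)\<^sup>2) =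
      ((\<Sum>u\<in>S - \<tau>. f u)\<^sup>2 - (\<Sum>u\<in>S - \<tau>. (f u)\<^sup>2)) +
      (2 * t * ((\<Sum>u\<in>S - \<tau>. f u) * (\<Sum>u\<in>S - \<tau>. g u) - (\<Sum>u\<in>S - \<tau>. f u * g u)) +
      t\<^sup>2 * ((\<Sum>u\<in>S - \<tau>. g u)\<^sup>2 - (\<Sum>u\<in>S - \<tau>. (g u)\<^sup>2)))"
      unfolding 1 2 by (simp add: power2_eq_square algebra_simps)
  qed
  thus ?thesis unfolding Bf_def Bp_eq by (simp only: sum.distrib sum_distrib_left)
qed

lemma Df_add: "Df \<tau> (\<lambda>u. f u + t * g u) =
    Df \<tau> f + 2 * t * (\<Sum>v\<in>V - \<tau>. deg (insert v \<tau>) * f v * g v) + t\<^sup>2 * Df \<tau> g"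
  unfolding Df_eq sum_distrib_left sum.distrib[symmetric]
  by (intro sum.cong refl) (simp add: power2_eq_square algebra_simps)

lemma Mf_add: "Mf \<tau> (\<lambda>u. f u + t * g u) = Mf \<tau> f + t * Mf \<tau> g"
  unfolding Mf_eq sum_distrib_left sum.distrib[symmetric]
  by (intro sum.cong refl) (simp add: algebra_simps)

text \<open>Compactness of the unit sphere of \<open>Df\<close>. This form sees only vertices of
  positive degree, so functions are cut off to those; their degrees are at least 1, so
  \<open>Df = 1\<close> forces values in [-1, 1], and the sphere lies in a compact product of
  intervals.\<close>

lemma rayleigh_maximizer:
  assumes ex: "\<exists>h. Mf \<tau> h = 0 \<and> Df \<tau> h > 0"
  obtains f where "Mf \<tau> f = 0" "Df \<tau> f = 1" "\<And>h. Mf \<tau> h = 0 \<Longrightarrow> Bf \<tau> h \<le> Bf \<tau> f * Df \<tau> h"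
proof -
  define L where "L = {v\<in>V - \<tau>. deg (insert v \<tau>) > 0}"
  define T where "T i = (if i \<in> L then {-1..1} else {0 :: real})" for i :: 'a
  define K where "K = PiE UNIV T \<inter> {f. Df \<tau> f = 1 \<and> Mf \<tau> f = 0}"
  define res where "res h u = (if u \<in> L then h u else 0)" for h :: "'a \<Rightarrow> real" and u
  have inL: "u \<in> L" if "S \<in> Up \<tau>" "u \<in> S - \<tau>" for u S
  proof -
    have "S \<in> Up (insert u \<tau>)" using that by (auto simp: Up_def)
    hence "deg (insert u \<tau>) > 0" by (auto simp: deg_def card_gt_0_iff)
    thus ?thesis using that FV by (auto simp: L_def Up_def)
  qed
  have res: "Bf \<tau> (res h) = Bf \<tau> h" "Df \<tau> (res h) = Df \<tau> h" "Mf \<tau> (res h) = Mf \<tau> h" for h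
    unfolding Bf_def Df_def Mf_def using inL by (simp_all add: res_def)
  have scale: "Bf \<tau> (\<lambda>u. c * h u) = c\<^sup>2 * Bf \<tau> h" "Df \<tau> (\<lambda>u. c * h u) = c\<^sup>2 * Df \<tau> h"
    "Mf \<tau> (\<lambda>u. c * h u) = c * Mf \<tau> h" for c h
    unfolding Bf_def Df_def Mf_def
    by (simp_all add: power_mult_distrib sum_distrib_left[symmetric] sum_subtractf right_diff_distrib)
  have cont [continuous_intros]: "continuous_on UNIV (\<lambda>f :: 'a \<Rightarrow> real. f i)" for i by simp
  have cB: "continuous_on UNIV (Bf \<tau>)" and cD: "continuous_on UNIV (Df \<tau>)" and cM: "continuous_on UNIV (Mf \<tau>)"
    unfolding Bf_def Df_def Mf_def by (intro continuous_intros)+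
  have "compact (PiE UNIV T)"
  proof -
    have "compactin (product_topology (\<lambda>i. euclidean) UNIV) (PiE UNIV T)"
      unfolding compactin_PiE by (auto simp: T_def)
    thus ?thesis by (simp add: euclidean_product_topology)
  qed
  moreover have "closed {f. Df \<tau> f = 1 \<and> Mf \<tau> f = 0}"
    by (intro closed_Collect_conj closed_Collect_eq cD cM continuous_on_const)
  ultimately have "compact K" unfolding K_def by (rule compact_Int_closed)
  have mem: "res (\<lambda>u. h u / sqrt (Df \<tau> h)) \<in> K" if h: "Mf \<tau> h = 0" "Df \<tau> h > 0" for h
  proof -
    let ?h = "\<lambda>u. inverse (sqrt (Df \<tau> h)) * h u"
    have 1: "Df \<tau> ?h = 1" "Mf \<tau> ?h = 0" unfolding scale using h by (simp_all add: power_inverse)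
    have "\<bar>?h v\<bar> \<le> 1" if "v \<in> L" for v
    proof -
      have fin: "finite (V - \<tau>)" using finV by simp
      have "deg (insert v \<tau>) \<ge> 1" using that by (simp add: L_def deg_def)
      hence "1 * (?h v)\<^sup>2 \<le> deg (insert v \<tau>) * (?h v)\<^sup>2" by (intro mult_right_mono) auto
      also have "\<dots> \<le> Df \<tau> ?h"
        unfolding Df_eq using that fin by (intro member_le_sum) (auto simp: L_def)
      finally show ?thesis using 1 by (simp add: abs_square_le_1)
    qed
    hence "res ?h \<in> PiE UNIV T" by (auto simp: T_def res_def abs_le_iff)
    moreover have "?h = (\<lambda>u. h u / sqrt (Df \<tau> h))" by (simp add: divide_inverse mult.commute)
    ultimately show ?thesis using res[of ?h] 1 by (simp add: K_def)
  qed
  hence "K \<noteq> {}" using ex by blast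
  then obtain f where f: "f \<in> K" "\<And>y. y \<in> K \<Longrightarrow> Bf \<tau> y \<le> Bf \<tau> f"
    using continuous_attains_sup[OF \<open>compact K\<close>, of "Bf \<tau>"] continuous_on_subset[OF cB] by blast
  show ?thesis
  proof (rule that[of f])
    show "Mf \<tau> f = 0" "Df \<tau> f = 1" using f(1) by (auto simp: K_def)
    fix h assume h: "Mf \<tau> h = 0"
    show "Bf \<tau> h \<le> Bf \<tau> f * Df \<tau> h"
    proof (cases "Df \<tau> h > 0")
      case True
      have "Bf \<tau> (res (\<lambda>u. h u / sqrt (Df \<tau> h))) = Bf \<tau> (\<lambda>u. inverse (sqrt (Df \<tau> h)) * h u)"
        by (simp add: res divide_inverse mult.commute)
      also have "\<dots> = Bf \<tau> h / Df \<tau> h" unfolding scale using True by (simp add: power_inverse divide_inverse mult.commute)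
      finally have "Bf \<tau> h / Df \<tau> h \<le> Bf \<tau> f" using f(2)[OF mem[OF h True]] by simp
      thus ?thesis using True by (simp add: pos_divide_le_eq)
    next
      case False
      hence D0: "Df \<tau> h = 0" using Df_nonneg[of \<tau> h] by simp
      have "h u = 0" if "S \<in> Up \<tau>" "u \<in> S - \<tau>" for S u
      proof -
        have "(\<Sum>u\<in>S - \<tau>. (h u)\<^sup>2) = 0"
          using D0 that(1) unfolding Df_def by (subst (asm) sum_nonneg_eq_0_iff) (auto intro: sum_nonneg)
        thus ?thesis using that by (subst (asm) sum_nonneg_eq_0_iff) auto
      qed
      hence "Bf \<tau> h = 0" unfolding Bf_def by simp
      thus ?thesis using D0 by simp
    qed
  qed
qed

text \<open>The first-order condition at a maximiser: if \<open>a\<close> were nonzero,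
  \<open>t = - a / c\<close> with \<open>c\<close> above the absolute value of \<open>b\<close>
  would make the expression negative.\<close>

lemma linear_coeff_zero:
  fixes a b :: real
  assumes "\<And>t. 0 \<le> 2 * t * a + t\<^sup>2 * b"
  shows "a = 0"
proof (rule ccontr)
  assume "a \<noteq> 0"
  define c where "c = \<bar>b\<bar> + 1"
  have c: "c > 0" "b \<le> c" by (auto simp: c_def)
  have "0 \<le> 2 * (- a / c) * a + (- a / c)\<^sup>2 * b" by (rule assms)
  also have "\<dots> \<le> 2 * (- a / c) * a + (- a / c)\<^sup>2 * c" using c by (intro add_left_mono mult_left_mono) auto
  also have "\<dots> = - (a\<^sup>2 / c)" using c by (simp add: power2_eq_square field_simps)
  finally have "a\<^sup>2 / c \<le> 0" by simp
  moreover have "a\<^sup>2 / c > 0" using \<open>a \<noteq> 0\<close> c by (intro divide_pos_pos) auto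
  ultimately show False by simp
qed

text \<open>A maximiser \<open>f\<close> of the Rayleigh quotient has, in the link of each
  \<open>v\<close>, a weighted sum proportional to \<open>f v\<close>. Bounding \<open>Bf\<close> in
  every vertex link by \<open>local_gap_general\<close> and adding up with
  \<open>sum_link_forms\<close> gives
  \<open>\<rho> \<le> \<kappa> + (1 - \<kappa>) * \<rho>^2\<close> for the normalised maximum
  \<open>\<rho>\<close>. This factors as
  \<open>0 \<le> (1 - \<rho>) * (\<kappa> - (1 - \<kappa>) * \<rho>)\<close>, and connectivity
  supplies \<open>\<rho> < 1\<close>.\<close>

lemma trickle_down:
  assumes j: "card \<tau> + j = k" "j \<ge> 3" and conn: "link_connected \<tau>" and \<kappa>: "\<kappa> < 1"
    and gap: "\<And>v. v \<in> V - \<tau> \<Longrightarrow> local_gap (insert v \<tau>) ((real j - 2) * \<kappa>)"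
  shows "local_gap \<tau> ((real j - 1) * (\<kappa> / (1 - \<kappa>)))"
proof (cases "\<exists>h. Mf \<tau> h = 0 \<and> Df \<tau> h > 0")
  case False
  have "Bf \<tau> h \<le> (real j - 1) * (\<kappa> / (1 - \<kappa>)) * Df \<tau> h" if M: "Mf \<tau> h = 0" for h
  proof -
    have D0: "Df \<tau> h = 0" using False M Df_nonneg[of \<tau> h] by force
    have "h u = 0" if "S \<in> Up \<tau>" "u \<in> S - \<tau>" for S u
    proof -
      have "(\<Sum>u\<in>S - \<tau>. (h u)\<^sup>2) = 0"
        using D0 that(1) unfolding Df_def by (subst (asm) sum_nonneg_eq_0_iff) (auto intro: sum_nonneg)
      thus ?thesis using that by (subst (asm) sum_nonneg_eq_0_iff) auto
    qed
    hence "Bf \<tau> h = 0" unfolding Bf_def by simp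
    thus ?thesis using D0 by simp
  qed
  thus ?thesis by (simp add: local_gap_def)
next
  case True
  then obtain f where f: "Mf \<tau> f = 0" "Df \<tau> f = 1" and max: "\<And>h. Mf \<tau> h = 0 \<Longrightarrow> Bf \<tau> h \<le> Bf \<tau> f * Df \<tau> h"
    using rayleigh_maximizer by blast
  define r where "r = Bf \<tau> f"
  define ip where "ip g = (\<Sum>v\<in>V - \<tau>. deg (insert v \<tau>) * f v * g v)" for g
  have orth: "Bp \<tau> f g = r * ip g" if g: "Mf \<tau> g = 0" for g
  proof -
    have "0 \<le> 2 * t * (r * ip g - Bp \<tau> f g) + t\<^sup>2 * (r * Df \<tau> g - Bf \<tau> g)" for t
    proof -
      have "Mf \<tau> (\<lambda>u. f u + t * g u) = 0" by (simp add: Mf_add f g)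
      from max[OF this] have "Bf \<tau> f + 2 * t * Bp \<tau> f g + t\<^sup>2 * Bf \<tau> g \<le> r * (1 + 2 * t * ip g + t\<^sup>2 * Df \<tau> g)"
        unfolding Bf_add Df_add f(2) ip_def r_def .
      thus ?thesis by (simp add: r_def algebra_simps)
    qed
    from linear_coeff_zero[OF this] show ?thesis by simp
  qed
  have dtau: "deg \<tau> > 0"
  proof (rule ccontr)
    assume "\<not> deg \<tau> > 0"
    hence "Up \<tau> = {}" using deg_nonneg[of \<tau>] deg_zeroD by force
    thus False using f(2) by (simp add: Df_def)
  qed
  have Mlink: "Mf (insert v \<tau>) f = r * (deg (insert v \<tau>) * f v)" if v: "v \<in> V - \<tau>" for v
  proof -
    define \<delta> where "\<delta> u = (if u = v then 1 else 0 :: real)" for u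
    have \<delta>_sum: "(\<Sum>u\<in>V - \<tau>. \<phi> u * \<delta> u) = \<phi> v" for \<phi> :: "'a \<Rightarrow> real"
    proof -
      have "(\<Sum>u\<in>V - \<tau>. \<phi> u * \<delta> u) = (\<Sum>u\<in>V - \<tau>. if u = v then \<phi> u else 0)"
        by (intro sum.cong refl) (simp add: \<delta>_def)
      thus ?thesis using v finV by (simp add: sum.delta)
    qed
    \<comment> \<open>\<open>\<delta>\<close> is centred so that \<open>orth\<close> applies. The
      subtracted constant costs nothing: paired with a constant, both forms give a multiple of
      \<open>Mf \<tau> f\<close>, which is zero.\<close>
    define c where "c = Mf \<tau> \<delta> / (j * deg \<tau>)"
    have c: "j * c * deg \<tau> = Mf \<tau> \<delta>" using dtau j by (simp add: c_def)
    have "Mf \<tau> (\<lambda>u. \<delta> u - c) = 0" unfolding shift_forms(3)[OF j(1)] c by simp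
    hence "Bp \<tau> f (\<lambda>u. \<delta> u - c) = r * ip (\<lambda>u. \<delta> u - c)" by (rule orth)
    moreover have "Bp \<tau> f (\<lambda>u. \<delta> u - c) = Mf (insert v \<tau>) f"
    proof -
      have "Bp \<tau> f (\<lambda>u. \<delta> u - c) = (\<Sum>u\<in>V - \<tau>. Mf (insert u \<tau>) f * \<delta> u) - c * Bp \<tau> f (\<lambda>_. 1)"
        unfolding Bp_def by (simp add: sum_subtractf sum_distrib_left algebra_simps)
      also have "Bp \<tau> f (\<lambda>_. 1) = (\<Sum>S\<in>Up \<tau>. (real j - 1) * (\<Sum>u\<in>S - \<tau>. f u))"
        unfolding Bp_eq using card_facet_diff[OF _ j(1)]
        by (intro sum.cong refl) (simp add: algebra_simps)
      also have "\<dots> = (real j - 1) * Mf \<tau> f" unfolding Mf_def sum_distrib_left ..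
      finally show ?thesis using f(1) by (simp add: \<delta>_sum)
    qed
    moreover have "ip (\<lambda>u. \<delta> u - c) = deg (insert v \<tau>) * f v"
    proof -
      have "ip (\<lambda>u. \<delta> u - c) = (\<Sum>u\<in>V - \<tau>. deg (insert u \<tau>) * f u * \<delta> u) - c * Mf \<tau> f"
        unfolding ip_def Mf_eq by (simp add: sum_subtractf sum_distrib_left algebra_simps)
      thus ?thesis using f(1) by (simp add: \<delta>_sum)
    qed
    ultimately show ?thesis by simp
  qed
  define \<rho> where "\<rho> = r / (real j - 1)"
  have r: "r = (real j - 1) * \<rho>" using j by (simp add: \<rho>_def)
  have j3: "real j \<ge> 3" using j by simp
  have quad: "\<rho> \<le> \<kappa> + (1 - \<kappa>) * \<rho>\<^sup>2"
  proof -
    have "Bf (insert v \<tau>) f \<le> (real j - 2) * (\<kappa> * Df (insert v \<tau>) f + (1 - \<kappa>) * (r\<^sup>2 / (real j - 1)) * (deg (insert v \<tau>) * (f v)\<^sup>2))"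
      if v: "v \<in> V - \<tau>" for v
    proof -
      have "finite \<tau>" using j dtau fin_facet finite_subset by (metis Up_def card_gt_0_iff deg_def ex_in_conv mem_Collect_eq of_nat_0_less_iff)
      hence cv: "card (insert v \<tau>) + (j - 1) = k" using v j by simp
      have "local_gap (insert v \<tau>) ((real (j - 1) - 1) * \<kappa>)"
        using gap[OF v] j by (simp add: of_nat_diff)
      from local_gap_general[OF this cv] have
        "Bf (insert v \<tau>) f \<le> (real (j - 1) - 1) * (\<kappa> * Df (insert v \<tau>) f + (1 - \<kappa>) * (Mf (insert v \<tau>) f)\<^sup>2 / (real (j - 1) * deg (insert v \<tau>)))"
        using j by simp
      also have "(1 - \<kappa>) * (Mf (insert v \<tau>) f)\<^sup>2 / (real (j - 1) * deg (insert v \<tau>)) =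
          (1 - \<kappa>) * (r\<^sup>2 / (real j - 1)) * (deg (insert v \<tau>) * (f v)\<^sup>2)"
        unfolding Mlink[OF v] using j
        by (cases "deg (insert v \<tau>) = 0") (simp_all add: of_nat_diff power2_eq_square)
      finally show ?thesis using j by (simp add: of_nat_diff)
    qed
    hence "(\<Sum>v\<in>V - \<tau>. Bf (insert v \<tau>) f) \<le> (\<Sum>v\<in>V - \<tau>. (real j - 2) * (\<kappa> * Df (insert v \<tau>) f + (1 - \<kappa>) * (r\<^sup>2 / (real j - 1)) * (deg (insert v \<tau>) * (f v)\<^sup>2)))"
      by (rule sum_mono)
    also have "\<dots> = (real j - 2) * (\<kappa> * (\<Sum>v\<in>V - \<tau>. Df (insert v \<tau>) f) + (1 - \<kappa>) * (r\<^sup>2 / (real j - 1)) * Df \<tau> f)"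
      unfolding Df_eq[of \<tau>] by (simp only: sum.distrib sum_distrib_left[symmetric])
    finally have "(real j - 2) * r \<le> (real j - 2) * (\<kappa> * (real j - 1) + (1 - \<kappa>) * (r\<^sup>2 / (real j - 1)))"
      unfolding sum_link_forms[OF j(1)] f(2) r_def by simp
    hence "r \<le> \<kappa> * (real j - 1) + (1 - \<kappa>) * (r\<^sup>2 / (real j - 1))"
      using j3 by (subst (asm) mult_le_cancel_left) auto
    also have "r\<^sup>2 / (real j - 1) = (real j - 1) * \<rho>\<^sup>2" unfolding r using j3 by (simp add: power2_eq_square)
    finally have "(real j - 1) * \<rho> \<le> (real j - 1) * (\<kappa> + (1 - \<kappa>) * \<rho>\<^sup>2)" unfolding r by (simp add: algebra_simps)
    thus ?thesis using j3 by (subst (asm) mult_le_cancel_left) auto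
  qed
  \<comment> \<open>If \<open>\<rho> \<ge> 1\<close>, the total variance of \<open>f\<close> inside
    the facets is at most 0, so \<open>f\<close> is constant on each facet, hence by connectivity on
    the whole link, hence zero since its mean is zero; this contradicts
    \<open>Df \<tau> f = 1\<close>.\<close>
  have "\<rho> < 1"
  proof (rule ccontr)
    assume "\<not> \<rho> < 1"
    hence rge: "r \<ge> real j - 1" unfolding r using j3 by simp
    define avg where "avg S = (\<Sum>u\<in>S - \<tau>. f u) / j" for S
    have var: "(\<Sum>u\<in>S - \<tau>. (f u - avg S)\<^sup>2) = (\<Sum>u\<in>S - \<tau>. (f u)\<^sup>2) - (\<Sum>u\<in>S - \<tau>. f u)\<^sup>2 / j" if S: "S \<in> Up \<tau>" for S
    proof -
      have "(\<Sum>u\<in>S - \<tau>. (f u - avg S)\<^sup>2) = (\<Sum>u\<in>S - \<tau>. (f u)\<^sup>2) - 2 * avg S * (\<Sum>u\<in>S - \<tau>. f u) + j * (avg S)\<^sup>2"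
        using card_facet_diff[OF S j(1)]
        by (simp add: power2_diff sum.distrib sum_subtractf sum_distrib_left mult_ac)
      thus ?thesis using j by (simp add: avg_def power2_eq_square field_simps)
    qed
    have "(\<Sum>S\<in>Up \<tau>. \<Sum>u\<in>S - \<tau>. (f u - avg S)\<^sup>2) = (\<Sum>S\<in>Up \<tau>. (\<Sum>u\<in>S - \<tau>. (f u)\<^sup>2) - (\<Sum>u\<in>S - \<tau>. f u)\<^sup>2 / j)"
      using var by simp
    also have "\<dots> = Df \<tau> f - (Bf \<tau> f + Df \<tau> f) / j"
      unfolding Df_def Bf_def by (simp add: sum_subtractf sum_divide_distrib)
    also have "\<dots> \<le> 0" using rge j3 unfolding f(2) r_def by (simp add: field_simps)
    finally have le: "(\<Sum>S\<in>Up \<tau>. \<Sum>u\<in>S - \<tau>. (f u - avg S)\<^sup>2) \<le> 0" .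
    have "0 \<le> (\<Sum>S\<in>Up \<tau>. \<Sum>u\<in>S - \<tau>. (f u - avg S)\<^sup>2)" by (intro sum_nonneg) auto
    with le have "(\<Sum>S\<in>Up \<tau>. \<Sum>u\<in>S - \<tau>. (f u - avg S)\<^sup>2) = 0" by linarith
    hence z: "(\<Sum>u\<in>S - \<tau>. (f u - avg S)\<^sup>2) = 0" if "S \<in> Up \<tau>" for S
      using that by (subst (asm) sum_nonneg_eq_0_iff) (auto intro: sum_nonneg)
    have const: "f u = avg S" if S: "S \<in> Up \<tau>" "u \<in> S - \<tau>" for S u
    proof -
      have "finite (S - \<tau>)" using S by simp
      hence "\<forall>u\<in>S - \<tau>. (f u - avg S)\<^sup>2 = 0"
        using z[OF S(1)] by (subst (asm) sum_nonneg_eq_0_iff) auto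
      thus ?thesis using S by simp
    qed
    have path: "f u = f v" if "(u, v) \<in> (link_edges \<tau>)\<^sup>*" for u v
      using that
    proof (induction rule: rtrancl_induct)
      case (step y z)
      then obtain S where "S \<in> F" "\<tau> \<union> {y, z} \<subseteq> S" "y \<notin> \<tau>" "z \<notin> \<tau>" by (auto simp: link_edges_def)
      hence "f y = avg S" "f z = avg S" using const[of S] by (auto simp: Up_def)
      thus ?case using step by simp
    qed simp
    obtain S0 where S0: "S0 \<in> Up \<tau>" using dtau by (auto simp: deg_def card_gt_0_iff)
    have "card (S0 - \<tau>) = j" using card_facet_diff[OF S0 j(1)] .
    then obtain u0 where u0: "u0 \<in> S0 - \<tau>" using j by (metis card.empty ex_in_conv not_numeral_le_zero)
    have all: "f u = f u0" if "S \<in> Up \<tau>" "u \<in> S - \<tau>" for S u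
    proof -
      have "S \<in> Up (insert u \<tau>)" "S0 \<in> Up (insert u0 \<tau>)" using that u0 S0 by (auto simp: Up_def)
      hence "(u, u0) \<in> (link_edges \<tau>)\<^sup>*" using conn that u0 unfolding link_connected_def by blast
      thus ?thesis by (rule path)
    qed
    have "Mf \<tau> f = (\<Sum>S\<in>Up \<tau>. \<Sum>u\<in>S - \<tau>. f u0)" unfolding Mf_def using all by (intro sum.cong refl) auto
    also have "\<dots> = deg \<tau> * j * f u0" using card_facet_diff[OF _ j(1)] by (simp add: deg_def)
    finally have "f u0 = 0" using f(1) dtau j by simp
    hence "Df \<tau> f = 0" unfolding Df_def using all by simp
    thus False using f(2) by simp
  qed
  moreover have "0 \<le> (1 - \<rho>) * (\<kappa> - (1 - \<kappa>) * \<rho>)"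
    using quad by (simp add: power2_eq_square algebra_simps)
  ultimately have "(1 - \<kappa>) * \<rho> \<le> \<kappa>" by (simp add: zero_le_mult_iff)
  hence "\<rho> \<le> \<kappa> / (1 - \<kappa>)" using \<kappa> by (simp add: pos_le_divide_eq mult.commute)
  hence "r \<le> (real j - 1) * (\<kappa> / (1 - \<kappa>))" unfolding r using j3 by (intro mult_left_mono) auto
  thus ?thesis unfolding local_gap_def using max Df_nonneg
    by (metis r_def mult_right_mono order_trans)
qed

section \<open>Local to global: variance decomposition over links\<close>

lemma finite_ridges [simp]: "finite (ridges \<tau>)"
  by (rule finite_subset[of _ "Pow V"]) (use finV in \<open>auto simp: ridges_def\<close>)

text \<open>Law of total variance: conditioning on one vertex leaves
  \<open>j * Vf \<tau> g - Df \<tau> h\<close>, where \<open>h v\<close> is the conditional mean of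
  \<open>g\<close> given \<open>v\<close> minus the overall mean. The local gap limits the explained
  part \<open>Df \<tau> h\<close>.\<close>

lemma variance_step:
  assumes gap: "local_gap \<tau> c" and c: "c \<ge> 0" and j: "card \<tau> + j = k" "j \<ge> 1"
  shows "(real j - 1 - c) * Vf \<tau> g \<le> (\<Sum>v\<in>V - \<tau>. Vf (insert v \<tau>) g)"
proof (cases "deg \<tau> = 0")
  case True
  hence "Up \<tau> = {}" by (rule deg_zeroD)
  moreover from this have "Up (insert v \<tau>) = {}" for v using Up_insert_subset[of v \<tau>] by auto
  ultimately show ?thesis by (simp add: Vf_def)
next
  case False
  hence dpos: "deg \<tau> > 0" using deg_nonneg[of \<tau>] by linarith
  define G where "G \<sigma> = (\<Sum>S\<in>Up \<sigma>. g S)" for \<sigma>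
  define avg where "avg = G \<tau> / deg \<tau>"
  define h where "h v = G (insert v \<tau>) / deg (insert v \<tau>) - avg" for v
  have avgd: "avg * deg \<tau> = G \<tau>" using dpos by (simp add: avg_def)
  have dG: "deg \<sigma> * (G \<sigma> / deg \<sigma>) = G \<sigma>" for \<sigma>
    by (cases "deg \<sigma> = 0") (auto dest: deg_zeroD simp: G_def)
  have swap: "(\<Sum>v\<in>V - \<tau>. \<Sum>S\<in>Up (insert v \<tau>). \<phi> S) = j * (\<Sum>S\<in>Up \<tau>. \<phi> S)" for \<phi> :: "'a set \<Rightarrow> real"
  proof -
    have "(\<Sum>v\<in>V - \<tau>. \<Sum>S\<in>Up (insert v \<tau>). \<phi> S) = (\<Sum>S\<in>Up \<tau>. \<Sum>u\<in>S - \<tau>. \<phi> S)" unfolding Up_swap ..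
    also have "\<dots> = (\<Sum>S\<in>Up \<tau>. j * \<phi> S)" using card_facet_diff[OF _ j(1)] by (intro sum.cong refl) simp
    finally show ?thesis by (simp add: sum_distrib_left)
  qed
  have sG: "(\<Sum>v\<in>V - \<tau>. G (insert v \<tau>)) = j * G \<tau>" unfolding G_def by (rule swap)
  have Dh: "Df \<tau> h = (\<Sum>v\<in>V - \<tau>. (G (insert v \<tau>))\<^sup>2 / deg (insert v \<tau>)) - j * (G \<tau>)\<^sup>2 / deg \<tau>"
  proof -
    have "deg \<sigma> * (G \<sigma> / deg \<sigma> - avg)\<^sup>2 = (G \<sigma>)\<^sup>2 / deg \<sigma> - 2 * avg * G \<sigma> + avg\<^sup>2 * deg \<sigma>" for \<sigma>
      by (cases "deg \<sigma> = 0") (auto dest: deg_zeroD simp: G_def power2_eq_square field_simps)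
    hence "Df \<tau> h = (\<Sum>v\<in>V - \<tau>. (G (insert v \<tau>))\<^sup>2 / deg (insert v \<tau>) - 2 * avg * G (insert v \<tau>) + avg\<^sup>2 * deg (insert v \<tau>))"
      unfolding Df_eq h_def by simp
    also have "\<dots> = (\<Sum>v\<in>V - \<tau>. (G (insert v \<tau>))\<^sup>2 / deg (insert v \<tau>)) - 2 * avg * (j * G \<tau>) + avg\<^sup>2 * (j * deg \<tau>)"
      by (simp only: sum.distrib sum_subtractf sum_distrib_left[symmetric] sG sum_deg[OF j(1)])
    also have "\<dots> = (\<Sum>v\<in>V - \<tau>. (G (insert v \<tau>))\<^sup>2 / deg (insert v \<tau>)) - j * (G \<tau>)\<^sup>2 / deg \<tau>"
      using dpos by (simp add: avg_def power2_eq_square)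
    finally show ?thesis .
  qed
  have "(\<Sum>v\<in>V - \<tau>. Vf (insert v \<tau>) g) = j * (\<Sum>S\<in>Up \<tau>. (g S)\<^sup>2) - (\<Sum>v\<in>V - \<tau>. (G (insert v \<tau>))\<^sup>2 / deg (insert v \<tau>))"
    unfolding Vf_def sum_subtractf swap G_def ..
  hence total: "(\<Sum>v\<in>V - \<tau>. Vf (insert v \<tau>) g) = j * Vf \<tau> g - Df \<tau> h"
    unfolding Dh by (simp add: Vf_def G_def right_diff_distrib)
  have Mh: "Mf \<tau> h = 0"
  proof -
    have "Mf \<tau> h = (\<Sum>v\<in>V - \<tau>. deg (insert v \<tau>) * (G (insert v \<tau>) / deg (insert v \<tau>)) - avg * deg (insert v \<tau>))"
      unfolding Mf_eq h_def by (intro sum.cong refl) (simp only: right_diff_distrib mult.commute)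
    also have "\<dots> = j * G \<tau> - avg * (j * deg \<tau>)"
      by (simp only: dG sum_subtractf sum_distrib_left[symmetric] sG sum_deg[OF j(1)])
    finally show ?thesis using avgd by simp
  qed
  define s where "s S = (\<Sum>v\<in>S - \<tau>. h v)" for S
  have Dh2: "Df \<tau> h = (\<Sum>S\<in>Up \<tau>. (g S - avg) * s S)"
  proof -
    have "(\<Sum>S\<in>Up \<tau>. (g S - avg) * s S) = (\<Sum>S\<in>Up \<tau>. \<Sum>v\<in>S - \<tau>. (g S - avg) * h v)"
      by (simp add: s_def sum_distrib_left)
    also have "\<dots> = (\<Sum>v\<in>V - \<tau>. \<Sum>S\<in>Up (insert v \<tau>). (g S - avg) * h v)" by (rule Up_swap)
    also have "\<dots> = (\<Sum>v\<in>V - \<tau>. (G (insert v \<tau>) - avg * deg (insert v \<tau>)) * h v)"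
      by (intro sum.cong refl) (simp add: sum_distrib_right[symmetric] sum_subtractf G_def deg_def mult.commute[of avg])
    also have "\<dots> = (\<Sum>v\<in>V - \<tau>. deg (insert v \<tau>) * (h v)\<^sup>2)"
    proof (intro sum.cong refl)
      fix v
      have "G (insert v \<tau>) - avg * deg (insert v \<tau>) = deg (insert v \<tau>) * h v"
        unfolding h_def right_diff_distrib dG by (simp only: mult.commute)
      thus "(G (insert v \<tau>) - avg * deg (insert v \<tau>)) * h v = deg (insert v \<tau>) * (h v)\<^sup>2"
        by (simp only: power2_eq_square mult.assoc)
    qed
    finally show ?thesis by (simp add: Df_eq)
  qed
  have Vg: "(\<Sum>S\<in>Up \<tau>. (g S - avg)\<^sup>2) = Vf \<tau> g"
  proof -
    have "(\<Sum>S\<in>Up \<tau>. (g S - avg)\<^sup>2) = (\<Sum>S\<in>Up \<tau>. (g S)\<^sup>2 - 2 * avg * g S + avg\<^sup>2)"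
      by (intro sum.cong refl) (simp add: power2_diff)
    also have "\<dots> = (\<Sum>S\<in>Up \<tau>. (g S)\<^sup>2) - 2 * avg * G \<tau> + avg\<^sup>2 * deg \<tau>"
      by (simp add: sum.distrib sum_subtractf sum_distrib_left[symmetric] G_def deg_def)
    also have "\<dots> = Vf \<tau> g"
      using dpos by (simp add: Vf_def G_def[symmetric] avg_def power2_eq_square)
    finally show ?thesis .
  qed
  have V0: "Vf \<tau> g \<ge> 0" unfolding Vg[symmetric] by (intro sum_nonneg) auto
  \<comment> \<open>\<open>Df \<tau> h\<close> is the inner product of \<open>g - avg\<close> with
    the facet sums \<open>s\<close> of \<open>h\<close>. The squares of these sums add up to
    \<open>Bf + Df\<close>, at most \<open>(1 + c) * Df\<close> by the gap, so after Cauchy-Schwarz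
    one factor \<open>Df\<close> cancels.\<close>
  have "Df \<tau> h \<le> (1 + c) * Vf \<tau> g"
  proof (cases "Df \<tau> h > 0")
    case True
    have "(Df \<tau> h)\<^sup>2 \<le> (\<Sum>S\<in>Up \<tau>. (g S - avg)\<^sup>2) * (\<Sum>S\<in>Up \<tau>. (s S)\<^sup>2)"
      unfolding Dh2 by (rule Cauchy_Schwarz_ineq_sum)
    also have "(\<Sum>S\<in>Up \<tau>. (s S)\<^sup>2) = Bf \<tau> h + Df \<tau> h"
      unfolding Bf_def Df_def s_def by (simp add: sum_subtractf)
    also have "(\<Sum>S\<in>Up \<tau>. (g S - avg)\<^sup>2) * (Bf \<tau> h + Df \<tau> h) \<le> Vf \<tau> g * ((1 + c) * Df \<tau> h)"
      unfolding Vg using gap Mh V0 by (intro mult_left_mono) (auto simp: local_gap_def algebra_simps)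
    finally have "Df \<tau> h * Df \<tau> h \<le> ((1 + c) * Vf \<tau> g) * Df \<tau> h"
      by (simp only: power2_eq_square mult_ac)
    thus ?thesis using True by (subst (asm) mult_le_cancel_right) auto
  next
    case False
    thus ?thesis using V0 c by (meson add_nonneg_nonneg mult_nonneg_nonneg not_le order_trans zero_le_one)
  qed
  thus ?thesis unfolding total by (simp add: algebra_simps)
qed

context
  assumes conn: "\<And>\<tau>. Up \<tau> \<noteq> {} \<Longrightarrow> card \<tau> + 2 \<le> k \<Longrightarrow> link_connected \<tau>"
    and gap2: "\<And>\<tau>. Up \<tau> \<noteq> {} \<Longrightarrow> card \<tau> + 2 = k \<Longrightarrow> local_gap \<tau> (1 / (2 * real k))"
    and k1: "k \<ge> 1"
begin

lemma Up_empty_gap: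
  assumes "Up \<tau> = {}"
  shows "local_gap \<tau> c" "link_connected \<tau>"
proof -
  have "Up (insert u \<tau>) = {}" for u using assms Up_insert_subset[of u \<tau>] by auto
  thus "local_gap \<tau> c" "link_connected \<tau>"
    using assms by (simp_all add: local_gap_def link_connected_def Bf_def Df_def)
qed

text \<open>Trickling down sends \<open>1 / m\<close> to \<open>1 / (m - 1)\<close>: from
  \<open>1 / (2 * k)\<close> in codimension 2, each step lowers the denominator by one, and it stays
  above \<open>k\<close>.\<close>

lemma local_gap_all:
  assumes "j \<ge> 2" "card \<tau> + j = k" "finite \<tau>"
  shows "local_gap \<tau> ((real j - 1) * (1 / (2 * real k - real j + 2)))"
  using assms
proof (induction j arbitrary: \<tau> rule: nat_induct_at_least)
  case base
  thus ?case using gap2[of \<tau>] Up_empty_gap(1)[of \<tau>] by fastforce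
next
  case (Suc j)
  define \<kappa> where "\<kappa> = 1 / (2 * real k - real j + 2)"
  have jk: "real j + 1 \<le> real k" using Suc.prems by linarith
  have "local_gap \<tau> ((real (Suc j) - 1) * (\<kappa> / (1 - \<kappa>)))"
  proof (cases "Up \<tau> = {}")
    case False
    show ?thesis
    proof (rule trickle_down)
      show "card \<tau> + Suc j = k" "3 \<le> Suc j" using Suc by auto
      show "link_connected \<tau>" using conn[of \<tau>] False Suc by simp
      show "\<kappa> < 1" using jk by (simp add: \<kappa>_def)
      fix v assume "v \<in> V - \<tau>"
      hence "card (insert v \<tau>) + j = k" using Suc.prems by simp
      from Suc.IH[OF this] show "local_gap (insert v \<tau>) ((real (Suc j) - 2) * \<kappa>)"
        using Suc.prems by (simp add: \<kappa>_def)
    qed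
  qed (rule Up_empty_gap)
  moreover have "\<kappa> / (1 - \<kappa>) = 1 / (2 * real k - real (Suc j) + 2)"
    using jk by (simp add: \<kappa>_def field_simps)
  ultimately show ?case by simp
qed

text \<open>A ridge above \<open>\<tau>\<close> is reached through each of its \<open>j\<close>
  vertices outside \<open>\<tau>\<close>.\<close>

lemma ridges_swap:
  fixes \<phi> :: "'a set \<Rightarrow> real"
  assumes "card \<tau> + Suc j = k" "finite \<tau>"
  shows "(\<Sum>v\<in>V - \<tau>. \<Sum>\<rho>\<in>ridges (insert v \<tau>). \<phi> \<rho>) = j * (\<Sum>\<rho>\<in>ridges \<tau>. \<phi> \<rho>)"
proof -
  have "(\<Sum>v\<in>V - \<tau>. \<Sum>\<rho>\<in>ridges (insert v \<tau>). \<phi> \<rho>) = (\<Sum>v\<in>V - \<tau>. \<Sum>\<rho>\<in>{\<rho>\<in>ridges \<tau>. v \<in> \<rho>}. \<phi> \<rho>)"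
    by (intro sum.cong) (auto simp: ridges_def)
  also have "\<dots> = (\<Sum>\<rho>\<in>ridges \<tau>. \<Sum>v\<in>{v\<in>V - \<tau>. v \<in> \<rho>}. \<phi> \<rho>)"
    using finV by (intro sum.swap_restrict) auto
  also have "\<dots> = (\<Sum>\<rho>\<in>ridges \<tau>. j * \<phi> \<rho>)"
  proof (rule sum.cong[OF refl])
    fix \<rho> assume r: "\<rho> \<in> ridges \<tau>"
    hence "{v\<in>V - \<tau>. v \<in> \<rho>} = \<rho> - \<tau>" by (auto simp: ridges_def)
    moreover have "card (\<rho> - \<tau>) = j" using r assms by (subst card_Diff_subset) (auto simp: ridges_def)
    ultimately show "(\<Sum>v\<in>{v\<in>V - \<tau>. v \<in> \<rho>}. \<phi> \<rho>) = j * \<phi> \<rho>" by simp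
  qed
  finally show ?thesis by (simp add: sum_distrib_left)
qed

text \<open>Passing from codimension \<open>j + 1\<close> to \<open>j\<close> costs the factor
  \<open>(2 * k - j) / (2 * k - j + 1)\<close>, and these factors telescope; in codimension 1 the
  only ridge is \<open>\<tau>\<close> itself and the constant is 1.\<close>

lemma poincare:
  assumes "j \<ge> 1" "card \<tau> + j = k" "\<tau> \<subseteq> V"
  shows "(2 * real k - real j + 1) / (2 * real k) * Vf \<tau> g \<le> (\<Sum>\<rho>\<in>ridges \<tau>. Vf \<rho> g)"
  using assms
proof (induction j arbitrary: \<tau> rule: nat_induct_at_least)
  case base
  have "\<rho> = \<tau>" if "\<rho> \<in> ridges \<tau>" for \<rho>
    using that base finV finite_subset[of \<rho> V] card_subset_eq[of \<rho> \<tau>] by (auto simp: ridges_def)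
  hence "ridges \<tau> = {\<tau>}" using base by (auto simp: ridges_def)
  thus ?case using k1 by simp
next
  case (Suc j)
  have fin: "finite \<tau>" using Suc.prems finV finite_subset by blast
  have jk: "real j + 1 \<le> real k" "real k \<ge> 1" using Suc.prems k1 by linarith+
  define c where "c = real j / (2 * real k - real j + 1)"
  have "2 * real k - real (Suc j) + 2 = 2 * real k - real j + 1" by simp
  hence gap: "local_gap \<tau> c" using local_gap_all[of "Suc j" \<tau>] Suc.hyps Suc.prems fin by (simp only: c_def) simp
  have c0: "c \<ge> 0" using jk by (simp add: c_def)
  define e where "e = (2 * real k - real j + 1) / (2 * real k)"
  have e0: "e \<ge> 0" using jk by (simp add: e_def)
  have "e * ((real (Suc j) - 1 - c) * Vf \<tau> g) \<le> e * (\<Sum>v\<in>V - \<tau>. Vf (insert v \<tau>) g)"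
    using variance_step[OF gap c0, of "Suc j" g] Suc.prems e0 by (intro mult_left_mono) auto
  also have "\<dots> = (\<Sum>v\<in>V - \<tau>. e * Vf (insert v \<tau>) g)" by (simp add: sum_distrib_left)
  also have "\<dots> \<le> (\<Sum>v\<in>V - \<tau>. \<Sum>\<rho>\<in>ridges (insert v \<tau>). Vf \<rho> g)"
    unfolding e_def using Suc fin by (intro sum_mono Suc.IH) auto
  also have "\<dots> = j * (\<Sum>\<rho>\<in>ridges \<tau>. Vf \<rho> g)" using Suc.prems fin by (intro ridges_swap) auto
  finally have "j * (((2 * real k - real (Suc j) + 1) / (2 * real k)) * Vf \<tau> g) \<le> j * (\<Sum>\<rho>\<in>ridges \<tau>. Vf \<rho> g)"
  proof -
    have "e * (real (Suc j) - 1 - c) = j * ((2 * real k - real (Suc j) + 1) / (2 * real k))"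
    proof -
      define m where "m = 2 * real k - real j"
      have "m > 0" using jk by (simp add: m_def)
      have m: "m + 1 > 0" using \<open>m > 0\<close> by simp
      have eqs: "e = (m + 1) / (2 * real k)" "c = real j / (m + 1)"
        "2 * real k - real (Suc j) + 1 = m" by (simp_all add: e_def c_def m_def)
      have "real (Suc j) - 1 - c = real j * m / (m + 1)"
        unfolding eqs(2) using m by (simp add: field_simps)
      thus ?thesis unfolding eqs(1,3) using m by simp
    qed
    thus "?thesis" if "e * ((real (Suc j) - 1 - c) * Vf \<tau> g) \<le> j * (\<Sum>\<rho>\<in>ridges \<tau>. Vf \<rho> g)"
      using that by (simp only: mult.assoc[symmetric])
  qed
  thus ?case using Suc.hyps by (subst (asm) mult_le_cancel_left) auto
qed

subsection \<open>The down-up walk\<close>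

lemma kernel_commute: "kernel S S' = kernel S' S"
  by (simp add: kernel_def mult.commute)

lemma sum_Up_F: "(\<Sum>S\<in>Up \<rho>. g S) = (\<Sum>S\<in>F. of_bool (\<rho> \<subseteq> S) * (g S :: real))"
  unfolding Up_def sum.inter_filter[OF finF] by (intro sum.cong refl) simp

lemma inner_walk_op: "(\<Sum>S\<in>F. f S * walk_op g S) = walk_form f g"
proof -
  have "(\<Sum>S\<in>F. f S * walk_op g S) =
    (\<Sum>S\<in>F. \<Sum>S'\<in>F. \<Sum>\<rho>\<in>ridges {}. (of_bool (\<rho> \<subseteq> S) * f S) * (of_bool (\<rho> \<subseteq> S') * g S') / deg \<rho> / k)"
    unfolding walk_op_def kernel_def sum_distrib_left sum_distrib_right sum_divide_distrib
    by (intro sum.cong refl) simp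
  also have "\<dots> = (\<Sum>S\<in>F. \<Sum>\<rho>\<in>ridges {}. \<Sum>S'\<in>F. (of_bool (\<rho> \<subseteq> S) * f S) * (of_bool (\<rho> \<subseteq> S') * g S') / deg \<rho> / k)"
    by (intro sum.cong refl sum.swap)
  also have "\<dots> = (\<Sum>\<rho>\<in>ridges {}. \<Sum>S\<in>F. \<Sum>S'\<in>F. (of_bool (\<rho> \<subseteq> S) * f S) * (of_bool (\<rho> \<subseteq> S') * g S') / deg \<rho> / k)"
    by (rule sum.swap)
  also have "\<dots> = (\<Sum>\<rho>\<in>ridges {}. (\<Sum>S\<in>F. of_bool (\<rho> \<subseteq> S) * f S) * (\<Sum>S'\<in>F. of_bool (\<rho> \<subseteq> S') * g S') / deg \<rho> / k)"
    by (simp only: sum_product sum_divide_distrib)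
  finally show ?thesis unfolding walk_form_def sum_Up_F sum_divide_distrib .
qed

lemma card_ridges_below:
  assumes "S \<in> F"
  shows "{\<rho>\<in>ridges {}. \<rho> \<subseteq> S} = (\<lambda>v. S - {v}) ` S" and "inj_on (\<lambda>v. S - {v}) S"
proof -
  have "S \<subseteq> V" "card S = k" using assms FV cardF by auto
  moreover from this have "finite S" using finV finite_subset by blast
  ultimately have S: "S \<subseteq> V" "card S = k" "finite S" .
  show "inj_on (\<lambda>v. S - {v}) S" by (auto simp: inj_on_def)
  show "{\<rho>\<in>ridges {}. \<rho> \<subseteq> S} = (\<lambda>v. S - {v}) ` S"
  proof (rule equalityI; rule subsetI)
    fix \<rho> assume "\<rho> \<in> {\<rho>\<in>ridges {}. \<rho> \<subseteq> S}"
    hence r: "\<rho> \<subseteq> S" "card \<rho> + 1 = k" by (auto simp: ridges_def)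
    hence "card (S - \<rho>) = 1" using S finite_subset[OF r(1) S(3)] by (simp add: card_Diff_subset)
    then obtain v where "S - \<rho> = {v}" by (auto simp: card_1_singleton_iff)
    hence "v \<in> S" "\<rho> = S - {v}" using r by auto
    thus "\<rho> \<in> (\<lambda>v. S - {v}) ` S" by blast
  next
    fix \<rho> assume "\<rho> \<in> (\<lambda>v. S - {v}) ` S"
    thus "\<rho> \<in> {\<rho>\<in>ridges {}. \<rho> \<subseteq> S}" using S k1 by (auto simp: ridges_def card_Diff_singleton)
  qed
qed

lemma kernel_eq:
  assumes "S \<in> F"
  shows "kernel S S' = (\<Sum>v\<in>S. of_bool (S - {v} \<subseteq> S') / deg (S - {v})) / k"
proof -
  have "(\<Sum>\<rho>\<in>ridges {}. of_bool (\<rho> \<subseteq> S) * of_bool (\<rho> \<subseteq> S') / deg \<rho>) =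
    (\<Sum>\<rho>\<in>{\<rho>\<in>ridges {}. \<rho> \<subseteq> S}. of_bool (\<rho> \<subseteq> S') / deg \<rho>)"
    by (subst sum.inter_filter) (auto intro!: sum.cong)
  also have "\<dots> = (\<Sum>v\<in>S. of_bool (S - {v} \<subseteq> S') / deg (S - {v}))"
    unfolding card_ridges_below(1)[OF assms] by (subst sum.reindex[OF card_ridges_below(2)[OF assms]]) simp
  finally show ?thesis by (simp add: kernel_def)
qed

lemma kernel_row:
  assumes S: "S \<in> F"
  shows "(\<Sum>S'\<in>F. kernel S S') = 1"
proof -
  have "(\<Sum>S'\<in>F. kernel S S') = (\<Sum>v\<in>S. \<Sum>S'\<in>F. of_bool (S - {v} \<subseteq> S') * 1 / deg (S - {v})) / k"
  proof -
    have "(\<Sum>S'\<in>F. kernel S S') = (\<Sum>S'\<in>F. \<Sum>v\<in>S. of_bool (S - {v} \<subseteq> S') / deg (S - {v})) / k"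
      by (simp only: kernel_eq[OF S] sum_divide_distrib)
    also have "(\<Sum>S'\<in>F. \<Sum>v\<in>S. of_bool (S - {v} \<subseteq> S') / deg (S - {v})) =
        (\<Sum>v\<in>S. \<Sum>S'\<in>F. of_bool (S - {v} \<subseteq> S') * 1 / deg (S - {v}))"
      by (subst sum.swap) simp
    finally show ?thesis .
  qed
  also have "\<dots> = (\<Sum>v\<in>S. 1) / k"
  proof -
    have "(\<Sum>S'\<in>F. of_bool (S - {v} \<subseteq> S') * 1 / deg (S - {v})) = 1" for v
    proof -
      have "S \<in> Up (S - {v})" using S by (auto simp: Up_def)
      hence "deg (S - {v}) \<noteq> 0" using deg_zeroD by auto
      thus ?thesis unfolding sum_divide_distrib[symmetric] sum_Up_F[symmetric] by (simp add: deg_def)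
    qed
    thus ?thesis by simp
  qed
  finally show ?thesis using cardF[OF S] k1 by simp
qed

lemma walk_op_sum:
  "(\<Sum>S\<in>F. walk_op g S) = (\<Sum>S\<in>F. g S)"
proof -
  have "(\<Sum>S\<in>F. walk_op g S) = (\<Sum>S'\<in>F. \<Sum>S\<in>F. kernel S S' * g S')" unfolding walk_op_def by (rule sum.swap)
  also have "\<dots> = (\<Sum>S'\<in>F. (\<Sum>S\<in>F. kernel S' S) * g S')"
    unfolding sum_distrib_right by (intro sum.cong refl) (simp add: kernel_commute)
  finally show ?thesis by (simp add: kernel_row)
qed

text \<open>The Dirichlet form, the squared norm minus \<open>walk_form g g\<close>, is
  \<open>1 / k\<close> times the sum of the ridge variances, and \<open>poincare\<close> at the
  empty face bounds that sum below by \<open>(k + 1) / (2 * k)\<close> of the total, more than one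
  half.\<close>

lemma walk_form_gap:
  assumes "(\<Sum>S\<in>F. g S) = 0"
  shows "walk_form g g \<le> (1 - 1 / (2 * real k)) * (\<Sum>S\<in>F. (g S)\<^sup>2)"
proof -
  let ?N = "\<Sum>S\<in>F. (g S)\<^sup>2"
  have N0: "?N \<ge> 0" by (intro sum_nonneg) auto
  have kk: "real k \<ge> 1" using k1 by simp
  have Fup: "Up {} = F" by (auto simp: Up_def)
  have "(\<Sum>\<rho>\<in>ridges {}. \<Sum>S\<in>Up \<rho>. (g S)\<^sup>2) = k * ?N"
  proof -
    have "(\<Sum>\<rho>\<in>ridges {}. \<Sum>S\<in>Up \<rho>. (g S)\<^sup>2) = (\<Sum>S\<in>F. \<Sum>\<rho>\<in>{\<rho>\<in>ridges {}. \<rho> \<subseteq> S}. (g S)\<^sup>2)"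
      unfolding Up_def using finF by (intro sum.swap_restrict) auto
    also have "\<dots> = (\<Sum>S\<in>F. k * (g S)\<^sup>2)"
      by (intro sum.cong refl) (simp add: card_ridges_below card_image cardF)
    finally show ?thesis by (simp add: sum_distrib_left)
  qed
  hence "(\<Sum>\<rho>\<in>ridges {}. Vf \<rho> g) = k * ?N - k * walk_form g g"
    using kk unfolding Vf_def sum_subtractf walk_form_def by (simp add: power2_eq_square)
  moreover have "(2 * real k - real k + 1) / (2 * real k) * Vf {} g \<le> (\<Sum>\<rho>\<in>ridges {}. Vf \<rho> g)"
    using k1 by (intro poincare) auto
  moreover have "Vf {} g = ?N" using assms by (simp add: Vf_def Fup)
  ultimately have "(real k + 1) / (2 * real k) * ?N \<le> k * (?N - walk_form g g)"
    by (simp add: right_diff_distrib)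
  moreover have "1 / 2 * ?N \<le> (real k + 1) / (2 * real k) * ?N"
    using kk N0 by (intro mult_right_mono) (simp add: field_simps)
  ultimately have "1 / 2 * ?N \<le> k * (?N - walk_form g g)" by linarith
  hence "1 / 2 * ?N / k \<le> ?N - walk_form g g" using kk by (simp add: pos_divide_le_eq mult.commute)
  thus ?thesis by (simp add: left_diff_distrib)
qed

lemma walk_form_nonneg: "walk_form g g \<ge> 0"
  unfolding walk_form_def by (intro divide_nonneg_nonneg sum_nonneg) auto

lemma walk_form_Cauchy_Schwarz: "(walk_form f g)\<^sup>2 \<le> walk_form f f * walk_form g g"
proof -
  let ?a = "\<lambda>h \<rho>. (\<Sum>S\<in>Up \<rho>. h S) / sqrt (deg \<rho> * k)"
  have *: "walk_form f g = (\<Sum>\<rho>\<in>ridges {}. ?a f \<rho> * ?a g \<rho>)" for f g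
    unfolding walk_form_def by (subst sum_divide_distrib) (intro sum.cong refl, simp)
  show ?thesis unfolding * using Cauchy_Schwarz_ineq_sum[of "?a f" "?a g" "ridges {}"]
    by (simp only: power2_eq_square)
qed

text \<open>The squared norm of \<open>walk_op g\<close> equals
  \<open>walk_form (walk_op g) g\<close>. Cauchy-Schwarz for this positive semidefinite form, with
  the gap applied to both \<open>g\<close> and \<open>walk_op g\<close>, leaves one factor of that
  squared norm to cancel.\<close>

lemma walk_op_contract:
  assumes g: "(\<Sum>S\<in>F. g S) = 0"
  shows "(\<Sum>S\<in>F. (walk_op g S)\<^sup>2) \<le> (1 - 1 / (2 * real k))\<^sup>2 * (\<Sum>S\<in>F. (g S)\<^sup>2)"
proof -
  let ?b = "1 - 1 / (2 * real k)" and ?X = "\<Sum>S\<in>F. (walk_op g S)\<^sup>2" and ?N = "\<Sum>S\<in>F. (g S)\<^sup>2"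
  have b0: "?b \<ge> 0" using k1 by (simp add: field_simps)
  have X0: "?X \<ge> 0" and N0: "?N \<ge> 0" by (intro sum_nonneg; simp)+
  have Pg: "(\<Sum>S\<in>F. walk_op g S) = 0" using g by (simp add: walk_op_sum)
  have "?X = walk_form (walk_op g) g"
    unfolding inner_walk_op[symmetric] by (simp add: power2_eq_square)
  hence "?X * ?X \<le> walk_form (walk_op g) (walk_op g) * walk_form g g"
    using walk_form_Cauchy_Schwarz[of "walk_op g" g] by (simp add: power2_eq_square)
  also have "\<dots> \<le> (?b * ?X) * (?b * ?N)"
    using walk_form_gap[OF g] walk_form_gap[OF Pg] walk_form_nonneg b0 X0 N0
    by (intro mult_mono mult_nonneg_nonneg) auto
  finally have "?X * ?X \<le> ?X * (?b\<^sup>2 * ?N)" by (simp only: power2_eq_square mult_ac)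
  thus ?thesis
    using X0 N0 by (cases "?X = 0") (auto simp: mult_le_cancel_left)
qed

lemma pmf_down_up:
  assumes S: "S \<in> F" and S': "S' \<in> F"
  shows "pmf (down_up (pmf_of_set F) S) S' = kernel S S'"
proof -
  have fS: "finite S" "S \<noteq> {}" "card S = k" using S FV finV finite_subset cardF k1 by fastforce+
  have Fne: "F \<noteq> {}" using S by auto
  have "pmf (down_up (pmf_of_set F) S) S' = (\<Sum>v\<in>S. pmf (cond_pmf (pmf_of_set F) {F'. S - {v} \<subseteq> F'}) S') / k"
    unfolding down_up_def pmf_bind using fS by (subst integral_pmf_of_set) auto
  also have "(\<Sum>v\<in>S. pmf (cond_pmf (pmf_of_set F) {F'. S - {v} \<subseteq> F'}) S') =
      (\<Sum>v\<in>S. of_bool (S - {v} \<subseteq> S') / deg (S - {v}))"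
  proof (intro sum.cong refl)
    fix v
    have ne: "set_pmf (pmf_of_set F) \<inter> {F'. S - {v} \<subseteq> F'} \<noteq> {}"
      using finF Fne S by auto
    have "measure_pmf.prob (pmf_of_set F) {F'. S - {v} \<subseteq> F'} = deg (S - {v}) / card F"
      using finF Fne by (subst measure_pmf_of_set) (auto simp: deg_def Up_def Int_def)
    thus "pmf (cond_pmf (pmf_of_set F) {F'. S - {v} \<subseteq> F'}) S' = of_bool (S - {v} \<subseteq> S') / deg (S - {v})"
      using finF Fne S' by (simp add: pmf_cond[OF ne])
  qed
  finally show ?thesis by (simp add: kernel_eq[OF S])
qed

lemma set_down_up:
  assumes S: "S \<in> F"
  shows "set_pmf (down_up (pmf_of_set F) S) \<subseteq> F"
proof -
  have "finite S" "S \<noteq> {}" using S FV finV finite_subset cardF k1 by fastforce+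
  moreover have "set_pmf (cond_pmf (pmf_of_set F) {F'. S - {v} \<subseteq> F'}) \<subseteq> F" for v
  proof -
    have "set_pmf (pmf_of_set F) = F" using finF S by (intro set_pmf_of_set) auto
    moreover from this have "set_pmf (pmf_of_set F) \<inter> {F'. S - {v} \<subseteq> F'} \<noteq> {}" using S by auto
    ultimately show ?thesis by (subst set_cond_pmf) auto
  qed
  ultimately show ?thesis unfolding down_up_def by auto
qed

lemma down_up_steps_Suc: "down_up_steps \<mu> (Suc t) S = bind_pmf (down_up_steps \<mu> t S) (down_up \<mu>)"
  by (simp add: down_up_steps_def)

lemma set_down_up_steps:
  assumes "S \<in> F"
  shows "set_pmf (down_up_steps (pmf_of_set F) t S) \<subseteq> F"
proof (induction t)
  case 0 thus ?case using assms by (simp add: down_up_steps_def)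
next
  case (Suc t) thus ?case using set_down_up by (auto simp: down_up_steps_Suc)
qed

text \<open>The deviation from the uniform distribution evolves by \<open>walk_op\<close>, because
  the kernel is symmetric with row sums 1, and it always sums to zero, so each step contracts
  it.\<close>

lemma down_up_steps_L2:
  assumes S: "S \<in> F"
  defines "q \<equiv> \<lambda>t S'. pmf (down_up_steps (pmf_of_set F) t S) S' - 1 / card F"
  shows "(\<Sum>S'\<in>F. (q t S')\<^sup>2) \<le> ((1 - 1 / (2 * real k)) ^ t)\<^sup>2"
proof -
  let ?p = "\<lambda>t. pmf (down_up_steps (pmf_of_set F) t S)"
  have cF: "card F > 0" using S finF by (auto simp: card_gt_0_iff)
  have sum1: "(\<Sum>S'\<in>F. ?p t S') = 1" for t
    using sum_pmf_eq_1[OF finF set_down_up_steps[OF S]] .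
  have q0: "(\<Sum>S'\<in>F. q t S') = 0" for t
    using sum1 cF by (simp add: q_def sum_subtractf)
  have step: "q (Suc t) S' = walk_op (q t) S'" if S': "S' \<in> F" for t S'
  proof -
    have "?p (Suc t) S' = (\<Sum>R\<in>F. pmf (down_up (pmf_of_set F) R) S' * ?p t R)"
      unfolding down_up_steps_Suc pmf_bind
      using set_down_up_steps[OF S] finF by (intro integral_measure_pmf_real) auto
    also have "\<dots> = (\<Sum>R\<in>F. kernel S' R * ?p t R)"
      using S' by (intro sum.cong refl) (simp add: pmf_down_up kernel_commute)
    finally show ?thesis
      using kernel_row[OF S'] unfolding walk_op_def q_def
      by (simp add: right_diff_distrib sum_subtractf sum_divide_distrib[symmetric])
  qed
  show ?thesis
  proof (induction t)
    case 0
    have "(\<Sum>S'\<in>F. (q 0 S')\<^sup>2) = (\<Sum>S'\<in>F. of_bool (S' = S) * (1 - 2 / card F) + (1 / card F)\<^sup>2)"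
      unfolding q_def down_up_steps_def by (intro sum.cong refl) (auto simp: power2_eq_square algebra_simps indicator_def)
    also have "\<dots> = (1 - 2 / card F) + card F * (1 / card F)\<^sup>2"
      using S finF by (simp add: sum.distrib sum_distrib_right[symmetric] of_bool_def)
    also have "\<dots> \<le> 1" using cF by (simp add: power2_eq_square)
    finally show ?case by simp
  next
    case (Suc t)
    have "(\<Sum>S'\<in>F. (q (Suc t) S')\<^sup>2) = (\<Sum>S'\<in>F. (walk_op (q t) S')\<^sup>2)" by (simp add: step)
    also have "\<dots> \<le> (1 - 1 / (2 * real k))\<^sup>2 * (\<Sum>S'\<in>F. (q t S')\<^sup>2)" by (rule walk_op_contract[OF q0])
    also have "\<dots> \<le> (1 - 1 / (2 * real k))\<^sup>2 * ((1 - 1 / (2 * real k)) ^ t)\<^sup>2"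
      using Suc by (intro mult_left_mono) auto
    finally show ?case by (simp add: power_mult_distrib)
  qed
qed

lemma tv_down_up_steps:
  assumes S: "S \<in> F"
  shows "tv_dist (down_up_steps (pmf_of_set F) t S) (pmf_of_set F) \<le>
    sqrt (card F) * (1 - 1 / (2 * real k)) ^ t"
proof -
  let ?p = "down_up_steps (pmf_of_set F) t S" and ?u = "pmf_of_set F"
  let ?q = "\<lambda>S'. pmf ?p S' - 1 / card F"
  have Fne: "F \<noteq> {}" using S by auto
  have b0: "1 - 1 / (2 * real k) \<ge> 0" using k1 by (simp add: field_simps)
  have prob: "measure_pmf.prob p A = (\<Sum>S'\<in>A \<inter> F. pmf p S')" if "set_pmf p \<subseteq> F" for p A
  proof -
    have "measure_pmf.prob p A = measure_pmf.prob p (A \<inter> F)"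
      using that by (intro measure_prob_cong_0) (auto simp: pmf_eq_0_set_pmf)
    thus ?thesis using finF by (simp add: measure_measure_pmf_finite)
  qed
  have "\<bar>measure_pmf.prob ?p A - measure_pmf.prob ?u A\<bar> \<le> sqrt (card F) * (1 - 1 / (2 * real k)) ^ t" for A
  proof -
    have "measure_pmf.prob ?p A - measure_pmf.prob ?u A = (\<Sum>S'\<in>A \<inter> F. ?q S')"
      using prob[OF set_down_up_steps[OF S]] prob[of ?u] finF Fne by (simp add: sum_subtractf)
    hence "\<bar>measure_pmf.prob ?p A - measure_pmf.prob ?u A\<bar> \<le> (\<Sum>S'\<in>A \<inter> F. \<bar>?q S'\<bar>)" by simp
    also have "\<dots> \<le> (\<Sum>S'\<in>F. \<bar>?q S'\<bar>)" using finF by (intro sum_mono2) auto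
    also have "\<dots> = \<bar>\<Sum>S'\<in>F. 1 * \<bar>?q S'\<bar>\<bar>" by (simp add: sum_nonneg)
    also have "\<dots> \<le> sqrt ((\<Sum>S'\<in>F. 1\<^sup>2) * (\<Sum>S'\<in>F. \<bar>?q S'\<bar>\<^sup>2))"
      using Cauchy_Schwarz_ineq_sum[of "\<lambda>_. 1" "\<lambda>S'. \<bar>?q S'\<bar>" F]
      by (intro real_le_rsqrt) (simp only: power2_abs)
    also have "\<dots> \<le> sqrt (card F * ((1 - 1 / (2 * real k)) ^ t)\<^sup>2)"
      using down_up_steps_L2[OF S, of t] by (intro real_sqrt_le_mono) (auto intro!: mult_left_mono)
    also have "\<dots> = sqrt (card F) * (1 - 1 / (2 * real k)) ^ t"
      using b0 by (simp add: real_sqrt_mult)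
    finally show ?thesis .
  qed
  thus ?thesis unfolding tv_dist_def by (intro cSUP_least) auto
qed

lemma mixes_within_of_gap:
  assumes Fne: "F \<noteq> {}" and n: "card V = n"
  shows "mixes_within 3 2 n (pmf_of_set F)"
  unfolding mixes_within_def
proof (intro allI impI)
  fix \<epsilon> :: real assume \<epsilon>: "0 < \<epsilon> \<and> \<epsilon> < 1"
  define L where "L = ln (1 / \<epsilon>)"
  have L0: "L > 0" using \<epsilon> by (simp add: L_def)
  obtain S0 where S0: "S0 \<in> F" using Fne by auto
  have kn: "k \<le> n" using card_mono[OF finV FV[OF S0]] cardF[OF S0] n by simp
  hence n1: "real n \<ge> 1" using k1 by linarith
  \<comment> \<open>\<open>2 * n\<close> dominates the relaxation time \<open>2 * k\<close>. In the
    bracket, \<open>n\<close> pays for the factor \<open>sqrt (card F)\<close>, which is at most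
    \<open>exp n\<close>, and \<open>L\<close> pays for \<open>\<epsilon>\<close>.\<close>
  define t where "t = nat \<lceil>2 * real n * (real n + L)\<rceil>"
  have t1: "real t \<ge> 2 * real n * (real n + L)" unfolding t_def by linarith
  have t2: "real t \<le> 2 * real n * (real n + L) + 1"
    unfolding t_def using L0 n1 by (simp add: of_nat_ceiling)
  have cF: "real (card F) \<le> 2 ^ n"
  proof -
    have "card F \<le> card (Pow V)" using FV finV by (intro card_mono) auto
    thus ?thesis using finV n by (simp add: card_Pow numeral_power_le_of_nat_cancel_iff)
  qed
  have "tv_dist (down_up_steps (pmf_of_set F) t S) (pmf_of_set F) \<le> \<epsilon>" if S: "S \<in> set_pmf (pmf_of_set F)" for S
  proof -
    have "S \<in> F" using S finF Fne by simp
    from tv_down_up_steps[OF this]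
    have "tv_dist (down_up_steps (pmf_of_set F) t S) (pmf_of_set F) \<le> sqrt (card F) * (1 - 1 / (2 * real k)) ^ t" .
    also have "\<dots> \<le> exp n * exp (- (n + L))"
    proof (intro mult_mono)
      have "sqrt (card F) \<le> sqrt ((exp (real n))\<^sup>2)"
      proof (intro real_sqrt_le_mono)
        have "real (card F) \<le> 2 ^ n" by (rule cF)
        also have "\<dots> \<le> (exp 2 :: real) ^ n" using exp_ge_add_one_self[of "2::real"] by (intro power_mono) auto
        also have "\<dots> = (exp (real n))\<^sup>2" by (simp add: exp_of_nat_mult[symmetric] power2_eq_square exp_add[symmetric])
        finally show "real (card F) \<le> (exp (real n))\<^sup>2" .
      qed
      thus "sqrt (card F) \<le> exp n" by simp
      have "1 - 1 / (2 * real k) \<le> exp (- (1 / (2 * real k)))" using exp_ge_add_one_self[of "- (1 / (2 * real k))"] by simp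
      hence "(1 - 1 / (2 * real k)) ^ t \<le> exp (- (1 / (2 * real k))) ^ t"
        using k1 by (intro power_mono) (auto simp: field_simps)
      also have "\<dots> = exp (- (t / (2 * real k)))" by (simp add: exp_of_nat_mult[symmetric])
      also have "\<dots> \<le> exp (- (n + L))"
      proof -
        have "(n + L) * (2 * real k) \<le> (n + L) * (2 * real n)" using kn L0 by (intro mult_left_mono) auto
        also have "\<dots> \<le> t" using t1 by (simp add: mult_ac)
        finally have "n + L \<le> t / (2 * real k)" using k1 by (simp add: pos_le_divide_eq)
        thus ?thesis by simp
      qed
      finally show "(1 - 1 / (2 * real k)) ^ t \<le> exp (- (n + L))" .
    qed (use k1 in \<open>auto simp: field_simps\<close>)
    also have "\<dots> = \<epsilon>" unfolding exp_add[symmetric] L_def using \<epsilon> by (simp add: ln_div exp_minus)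
    finally show ?thesis .
  qed
  hence "mixing_time (pmf_of_set F) \<epsilon> \<le> enat t" unfolding mixing_time_def by (intro Inf_lower) auto
  hence "ereal_of_enat (mixing_time (pmf_of_set F) \<epsilon>) \<le> ereal (real t)"
    by (metis ereal_of_enat_le_iff ereal_of_enat_simps(1))
  also have "real t \<le> 3 * (real n + L) ^ 2"
  proof -
    have "1 * 1 \<le> (real n + L) * (real n + L)" using n1 L0 by (intro mult_mono) auto
    moreover have "real n * (real n + L) \<le> (real n + L) * (real n + L)"
      using n1 L0 by (intro mult_right_mono) auto
    ultimately show ?thesis using t2 unfolding power2_eq_square by linarith
  qed
  finally show "ereal_of_enat (mixing_time (pmf_of_set F) \<epsilon>) \<le> ereal (3 * (real n + ln (1 / \<epsilon>)) ^ 2)"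
    by (simp add: L_def)
qed

end

end

section \<open>Switchings of regular graphs\<close>

definition nbrs :: "nat set set \<Rightarrow> nat \<Rightarrow> nat set" where
  "nbrs E v = {u. {u, v} \<in> E}"

lemma nbrs_sym: "u \<in> nbrs E v \<longleftrightarrow> v \<in> nbrs E u"
  by (simp add: nbrs_def insert_commute)

lemma finite_regular_graphs: "finite (regular_graphs n \<Delta>)"
  by (rule finite_subset[of _ "Pow (Pow {..<n})"]) (auto simp: regular_graphs_def)

context
  fixes n \<Delta> :: nat and E :: "nat set set"
  assumes E: "E \<in> regular_graphs n \<Delta>"
begin

lemma regular_edgeD:
  assumes "{u, v} \<in> E"
  shows "u < n" "v < n" "u \<noteq> v"
proof -
  have "{u, v} \<subseteq> {..<n}" "card {u, v} = 2"
    using E assms by (auto simp: regular_graphs_def)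
  thus "u < n" "v < n" "u \<noteq> v" by auto
qed

lemma finite_regular: "finite E"
  by (rule finite_subset[of _ "Pow {..<n}"]) (use E in \<open>auto simp: regular_graphs_def\<close>)

lemma nbrs_subset: "nbrs E v \<subseteq> {..<n}"
  using regular_edgeD by (auto simp: nbrs_def)

lemma finite_nbrs: "finite (nbrs E v)"
  using nbrs_subset finite_subset by blast

lemma card_nbrs:
  assumes "v < n"
  shows "card (nbrs E v) = \<Delta>"
proof -
  have "bij_betw (\<lambda>u. {u, v}) (nbrs E v) {e\<in>E. v \<in> e}"
  proof (rule bij_betwI')
    fix x y assume "x \<in> nbrs E v" "y \<in> nbrs E v"
    thus "({x, v} = {y, v}) = (x = y)" by (auto simp: doubleton_eq_iff)
  next
    fix x assume "x \<in> nbrs E v" thus "{x, v} \<in> {e \<in> E. v \<in> e}" by (auto simp: nbrs_def)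
  next
    fix e assume e: "e \<in> {e \<in> E. v \<in> e}"
    hence "card e = 2" using E by (auto simp: regular_graphs_def)
    then obtain a b where "e = {a, b}" by (auto simp: card_2_iff)
    thus "\<exists>x\<in>nbrs E v. e = {x, v}" using e by (auto simp: nbrs_def insert_commute)
  qed
  thus ?thesis using E assms bij_betw_same_card by (fastforce simp: regular_graphs_def)
qed

lemma card_nbrs_le: "card (nbrs E v) \<le> \<Delta>"
proof (cases "v < n")
  case False
  hence "nbrs E v = {}" using regular_edgeD by (auto simp: nbrs_def)
  thus ?thesis by simp
qed (simp add: card_nbrs)

lemma card_arcs:
  assumes "X \<subseteq> {..<n}"
  shows "card (Sigma X (nbrs E)) = card X * \<Delta>"
proof -
  have "finite X" using assms finite_subset by blast
  thus ?thesis using assms finite_nbrs card_nbrs by (subst card_SigmaI) (auto simp: subset_iff)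
qed

lemma card_arcs_le:
  assumes "finite X"
  shows "card (Sigma X (nbrs E)) \<le> card X * \<Delta>"
  using assms finite_nbrs card_nbrs_le
  by (subst card_SigmaI) (auto intro: sum_bounded_above[where K = \<Delta>, simplified])

end

text \<open>The edges \<open>{u, v}\<close> and \<open>{x, y}\<close> are to be replaced by
  \<open>{u, x}\<close> and \<open>{v, y}\<close>; distinctness and the two non-edges keep the graph
  simple and the degrees unchanged.\<close>

fun valid_switch :: "nat set set \<Rightarrow> nat \<times> nat \<times> nat \<times> nat \<Rightarrow> bool" where
  "valid_switch E (u, v, x, y) \<longleftrightarrow>
     {u, v} \<in> E \<and> {x, y} \<in> E \<and> distinct [u, v, x, y] \<and> {u, x} \<notin> E \<and> {v, y} \<notin> E"

fun switch :: "nat set set \<Rightarrow> nat \<times> nat \<times> nat \<times> nat \<Rightarrow> nat set set" where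
  "switch E (u, v, x, y) = (E - {{u, v}, {x, y}}) \<union> {{u, x}, {v, y}}"

text \<open>Exchanging the two middle entries turns a switching into its inverse at the switched
  graph.\<close>

fun flip :: "nat \<times> nat \<times> nat \<times> nat \<Rightarrow> nat \<times> nat \<times> nat \<times> nat" where
  "flip (u, v, x, y) = (u, x, v, y)"

lemma flip_flip [simp]: "flip (flip q) = q"
  by (cases q) simp

lemma switch_switch:
  assumes "valid_switch E q"
  shows "valid_switch (switch E q) (flip q)" "switch (switch E q) (flip q) = E"
proof -
  obtain u v x y where q: "q = (u, v, x, y)" by (cases q) auto
  show "valid_switch (switch E q) (flip q)" "switch (switch E q) (flip q) = E"
    using assms by (auto simp: q doubleton_eq_iff)
qed

lemma switch_regular:
  assumes E: "E \<in> regular_graphs n \<Delta>" and valid: "valid_switch E q"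
  shows "switch E q \<in> regular_graphs n \<Delta>"
proof -
  obtain u v x y where q: "q = (u, v, x, y)" by (cases q) auto
  let ?E = "switch E q"
  have d: "u \<noteq> v" "u \<noteq> x" "u \<noteq> y" "v \<noteq> x" "v \<noteq> y" "x \<noteq> y"
    and inE: "{u, v} \<in> E" "{x, y} \<in> E" "{u, x} \<notin> E" "{v, y} \<notin> E" using valid by (auto simp: q)
  have "u < n" "v < n" "x < n" "y < n"
    using regular_edgeD[OF E inE(1)] regular_edgeD[OF E inE(2)] by auto
  moreover have "\<forall>e\<in>E. e \<subseteq> {..<n} \<and> card e = 2"
    using E by (simp add: regular_graphs_def)
  moreover have "?E = insert {u, x} (insert {v, y} (E - {{u, v}, {x, y}}))" unfolding q by simp
  ultimately have two: "\<forall>e\<in>?E. e \<subseteq> {..<n} \<and> card e = 2"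
    using d by simp
  have swap: "card (insert b (A - {a})) = card A" if "finite A" "a \<in> A" "b \<notin> A" for a b and A :: "nat set set"
  proof -
    have "card (insert b (A - {a})) = Suc (card (A - {a}))" using that by (intro card_insert_disjoint) auto
    also have "\<dots> = card A" using card.remove[OF that(1,2)] by simp
    finally show ?thesis .
  qed
  have "card {e\<in>?E. w \<in> e} = \<Delta>" if "w < n" for w
  proof -
    let ?A = "{e\<in>E. w \<in> e}"
    have fin: "finite ?A" using finite_regular[OF E] by simp
    have "card {e\<in>?E. w \<in> e} = card ?A"
    proof -
      have *: "{e\<in>?E. w \<in> e} = (?A - {e\<in>{{u, v}, {x, y}}. w \<in> e}) \<union> {e\<in>{{u, x}, {v, y}}. w \<in> e}"
        unfolding q by auto
      consider "w = u" | "w = v" | "w = x" | "w = y" | "w \<notin> {u, v, x, y}" by blast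
      thus ?thesis
      proof cases
        case 1
        have "{e\<in>{{u, v}, {x, y}}. w \<in> e} = {{u, v}}" "{e\<in>{{u, x}, {v, y}}. w \<in> e} = {{u, x}}"
          using d 1 by auto
        hence "{e\<in>?E. w \<in> e} = insert {u, x} (?A - {{u, v}})" using * by simp
        thus ?thesis using swap[OF fin, of "{u, v}" "{u, x}"] inE 1 by simp
      next
        case 2
        have "{e\<in>{{u, v}, {x, y}}. w \<in> e} = {{u, v}}" "{e\<in>{{u, x}, {v, y}}. w \<in> e} = {{v, y}}"
          using d 2 by auto
        hence "{e\<in>?E. w \<in> e} = insert {v, y} (?A - {{u, v}})" using * by simp
        thus ?thesis using swap[OF fin, of "{u, v}" "{v, y}"] inE 2 by simp
      next
        case 3
        have "{e\<in>{{u, v}, {x, y}}. w \<in> e} = {{x, y}}" "{e\<in>{{u, x}, {v, y}}. w \<in> e} = {{u, x}}"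
          using d 3 by auto
        hence "{e\<in>?E. w \<in> e} = insert {u, x} (?A - {{x, y}})" using * by simp
        thus ?thesis using swap[OF fin, of "{x, y}" "{u, x}"] inE 3 by simp
      next
        case 4
        have "{e\<in>{{u, v}, {x, y}}. w \<in> e} = {{x, y}}" "{e\<in>{{u, x}, {v, y}}. w \<in> e} = {{v, y}}"
          using d 4 by auto
        hence "{e\<in>?E. w \<in> e} = insert {v, y} (?A - {{x, y}})" using * by simp
        thus ?thesis using swap[OF fin, of "{x, y}" "{v, y}"] inE 4 by simp
      next
        case 5
        hence "{e\<in>{{u, v}, {x, y}}. w \<in> e} = {}" "{e\<in>{{u, x}, {v, y}}. w \<in> e} = {}" by auto
        with * have "{e\<in>?E. w \<in> e} = ?A" by (simp only: Diff_empty Un_empty_right)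
        thus ?thesis by (rule arg_cong)
      qed
    qed
    thus ?thesis using E that by (simp add: regular_graphs_def)
  qed
  with two show ?thesis by (simp add: regular_graphs_def)
qed

text \<open>Double counting of pairs of a graph and a switching: for fixed \<open>q\<close>,
  switching is a bijection from the graphs where \<open>q\<close> is valid onto those where
  \<open>flip q\<close> is.\<close>

lemma switch_sum:
  fixes h :: "nat set set \<Rightarrow> nat \<times> nat \<times> nat \<times> nat \<Rightarrow> real"
  assumes "finite I"
  shows "(\<Sum>E\<in>regular_graphs n \<Delta>. \<Sum>q\<in>{q\<in>I. valid_switch E q}. h E q) =
    (\<Sum>E\<in>regular_graphs n \<Delta>. \<Sum>q\<in>{q\<in>I. valid_switch E (flip q)}. h (switch E (flip q)) q)"
    (is "?L = ?R")
proof -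
  let ?G = "regular_graphs n \<Delta>"
  have "?L = (\<Sum>q\<in>I. \<Sum>E\<in>{E\<in>?G. valid_switch E q}. h E q)"
    using assms finite_regular_graphs by (intro sum.swap_restrict) auto
  also have "\<dots> = (\<Sum>q\<in>I. \<Sum>E\<in>{E\<in>?G. valid_switch E (flip q)}. h (switch E (flip q)) q)"
  proof (rule sum.cong[OF refl])
    fix q
    show "(\<Sum>E\<in>{E\<in>?G. valid_switch E q}. h E q) =
      (\<Sum>E\<in>{E\<in>?G. valid_switch E (flip q)}. h (switch E (flip q)) q)"
      by (rule sum.reindex_bij_witness[of _ "\<lambda>E. switch E (flip q)" "\<lambda>E. switch E q"])
         (use switch_switch switch_regular in \<open>metis (no_types, lifting) flip_flip mem_Collect_eq\<close>)+
  qed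
  also have "\<dots> = ?R"
    using assms finite_regular_graphs by (intro sum.swap_restrict[symmetric]) auto
  finally show ?thesis .
qed

subsection \<open>Counting switchings\<close>

text \<open>Among the arcs \<open>(x, y)\<close> with \<open>x\<close> in \<open>X\<close>, at most
  \<open>4 * \<Delta>\<close> touch \<open>u\<close> or \<open>v\<close>, at most
  \<open>\<Delta>^2\<close> start next to \<open>u\<close>, and at most \<open>\<Delta>^2\<close>
  end next to \<open>v\<close>; every other arc can be switched with \<open>{u, v}\<close>. Later
  \<open>X\<close> is the whole vertex set or the complement of \<open>\<tau>\<close>.\<close>

lemma card_switches_ge:
  assumes E: "E \<in> regular_graphs n \<Delta>" and uv: "{u, v} \<in> E" and X: "X \<subseteq> {..<n}" and D: "\<Delta> \<ge> 1"
  shows "card X * \<Delta> \<le> card {(x, y). x \<in> X \<and> y < n \<and> valid_switch E (u, v, x, y)} + 6 * \<Delta>\<^sup>2"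
proof -
  let ?N = "nbrs E"
  let ?V = "{(x, y). x \<in> X \<and> y < n \<and> valid_switch E (u, v, x, y)}"
  let ?B = "Sigma {u, v} ?N \<union> prod.swap ` Sigma {u, v} ?N \<union> Sigma (?N u) ?N \<union> prod.swap ` Sigma (?N v) ?N"
  have "u \<noteq> v" using regular_edgeD[OF E uv] by simp
  have fin: "finite ?V" "finite ?B"
    subgoal by (rule finite_subset[of _ "{..<n} \<times> {..<n}"]) (use X in auto)
    subgoal using finite_nbrs[OF E] by (intro finite_UnI finite_imageI finite_SigmaI) auto
    done
  have "Sigma X ?N \<subseteq> ?V \<union> ?B"
  proof (rule subsetI, rule UnCI)
    fix p assume p: "p \<in> Sigma X ?N" "p \<notin> ?B"
    obtain x y where p_eq: "p = (x, y)" by fastforce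
    have xy: "x \<in> X" "y \<in> ?N x" "(x, y) \<notin> ?B" using p by (simp_all add: p_eq)
    have e: "{x, y} \<in> E" using xy by (simp add: nbrs_def insert_commute)
    have "x \<noteq> u" "x \<noteq> v" using xy by auto
    moreover have "y \<noteq> u" "y \<noteq> v" using xy nbrs_sym[of y E x] by (auto simp: image_iff)
    moreover have "{u, x} \<notin> E" using xy by (auto simp: nbrs_def insert_commute)
    moreover have "{v, y} \<notin> E" using xy by (auto simp: nbrs_def insert_commute image_iff)
    ultimately show "p \<in> ?V" unfolding p_eq
      using e uv xy regular_edgeD[OF E e] regular_edgeD[OF E uv] by auto
  qed
  hence "card (Sigma X ?N) \<le> card (?V \<union> ?B)" using fin by (intro card_mono) auto
  also have "\<dots> \<le> card ?V + card ?B" by (rule card_Un_le)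
  also have "card ?B \<le> card (Sigma {u, v} ?N) + card (prod.swap ` Sigma {u, v} ?N)
      + card (Sigma (?N u) ?N) + card (prod.swap ` Sigma (?N v) ?N)"
    by (meson card_Un_le add_le_mono le_trans order_refl)
  also have "\<dots> \<le> 2 * \<Delta> + 2 * \<Delta> + \<Delta> * \<Delta> + \<Delta> * \<Delta>"
  proof -
    have c: "card (Sigma Z ?N) \<le> m * \<Delta>" if "finite Z" "card Z \<le> m" for Z m
      using card_arcs_le[OF E that(1)] that(2) by (meson le_trans mult_le_mono1)
    have c': "card (prod.swap ` Sigma Z ?N) \<le> m * \<Delta>" if "finite Z" "card Z \<le> m" for Z m
      using c[OF that] by (simp add: card_image)
    have "card {u, v} \<le> 2" by (simp add: card_insert_if)
    thus ?thesis using c c' finite_nbrs[OF E] card_nbrs_le[OF E] by (intro add_mono) auto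
  qed
  also have "\<dots> \<le> 6 * \<Delta>\<^sup>2" using D by (simp add: power2_eq_square)
  finally show ?thesis using card_arcs[OF E X] by simp
qed

lemma card_reverse_switches_le:
  assumes E: "E \<in> regular_graphs n \<Delta>"
  shows "card {(x, y). x < n \<and> y < n \<and> valid_switch E (u, x, v, y)} \<le> \<Delta>\<^sup>2"
proof -
  have "{(x, y). x < n \<and> y < n \<and> valid_switch E (u, x, v, y)} \<subseteq> nbrs E u \<times> nbrs E v"
    by (auto simp: nbrs_def insert_commute)
  hence "card {(x, y). x < n \<and> y < n \<and> valid_switch E (u, x, v, y)} \<le> card (nbrs E u \<times> nbrs E v)"
    using finite_nbrs[OF E] by (intro card_mono) auto
  also have "\<dots> \<le> \<Delta> * \<Delta>"
    using card_nbrs_le[OF E] by (simp add: card_cartesian_product mult_le_mono)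
  finally show ?thesis by (simp add: power2_eq_square)
qed

text \<open>A single pair \<open>(u, v)\<close> may admit no switching, so the count runs over all
  of \<open>S \<times> T\<close>. The four error sets are \<open>u = v\<close>, \<open>u\<close>
  adjacent to \<open>v\<close>, \<open>x = y\<close>, and \<open>x\<close> adjacent to
  \<open>y\<close>; each has at most \<open>n * \<Delta>^3\<close> elements.\<close>

lemma card_reverse_switches_ge:
  assumes E: "E \<in> regular_graphs n \<Delta>" and S: "S \<subseteq> {..<n}" and T: "T \<subseteq> {..<n}" and D: "\<Delta> \<ge> 1"
  shows "card S * card T * \<Delta>\<^sup>2 \<le>
    card {(u, v, x, y). u \<in> S \<and> v \<in> T \<and> x < n \<and> y < n \<and> valid_switch E (u, x, v, y)} + 4 * n * \<Delta> ^ 3"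
    (is "_ \<le> card ?V + _")
proof -
  let ?N = "nbrs E" let ?n = "{..<n}"
  let ?A = "Sigma S (\<lambda>u. Sigma T (\<lambda>v. ?N u \<times> ?N v))"
  let ?B1 = "(\<lambda>(u, x, y). (u, u, x, y)) ` (Sigma ?n (\<lambda>u. ?N u \<times> ?N u))"
  let ?B2 = "Sigma ?n (\<lambda>u. Sigma (?N u) (\<lambda>v. ?N u \<times> ?N v))"
  let ?B3 = "(\<lambda>(u, x, v). (u, v, x, x)) ` (Sigma ?n (\<lambda>u. Sigma (?N u) ?N))"
  let ?B4 = "(\<lambda>(u, x, y, v). (u, v, x, y)) ` (Sigma ?n (\<lambda>u. Sigma (?N u) (\<lambda>x. Sigma (?N x) ?N)))"
  note fN = finite_nbrs[OF E] and cN = card_nbrs_le[OF E]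
  have fST: "finite S" "finite T" using S T finite_subset by auto
  have sum_le: "sum f A \<le> card A * k" if "\<And>a. a \<in> A \<Longrightarrow> f a \<le> k" for f :: "nat \<Rightarrow> nat" and A k
    using sum_bounded_above[of A f k] that by simp
  have sum_le': "sum f (?N a) \<le> \<Delta> * k" if "\<And>a. f a \<le> k" for f :: "nat \<Rightarrow> nat" and a k
    using sum_le[of "?N a" f k] that cN[of a] by (meson le_trans mult_le_mono1)
  have cA: "card ?A = card S * card T * \<Delta>\<^sup>2"
  proof -
    have "card ?A = (\<Sum>u\<in>S. \<Sum>v\<in>T. card (?N u) * card (?N v))"
      using fST fN by (simp add: card_SigmaI card_cartesian_product)
    also have "\<dots> = (\<Sum>u\<in>S. \<Sum>v\<in>T. \<Delta> * \<Delta>)"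
      using S T by (intro sum.cong refl) (auto simp: card_nbrs[OF E] subset_iff)
    finally show ?thesis by (simp add: power2_eq_square)
  qed
  have c1: "card ?B1 \<le> n * (\<Delta> * \<Delta>)"
  proof -
    have "card ?B1 \<le> card (Sigma ?n (\<lambda>u. ?N u \<times> ?N u))" using fN by (intro card_image_le) auto
    also have "\<dots> = (\<Sum>u<n. card (?N u) * card (?N u))" using fN by (simp add: card_SigmaI card_cartesian_product)
    also have "\<dots> \<le> card ?n * (\<Delta> * \<Delta>)" using cN by (intro sum_le mult_le_mono) auto
    finally show ?thesis by simp
  qed
  have c2: "card ?B2 \<le> n * (\<Delta> * (\<Delta> * \<Delta>))"
  proof -
    have "card ?B2 = (\<Sum>u<n. \<Sum>v\<in>?N u. card (?N u) * card (?N v))"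
      using fN by (simp add: card_SigmaI card_cartesian_product)
    also have "\<dots> \<le> card ?n * (\<Delta> * (\<Delta> * \<Delta>))" using cN by (intro sum_le sum_le' mult_le_mono) auto
    finally show ?thesis by simp
  qed
  have c3: "card ?B3 \<le> n * (\<Delta> * \<Delta>)"
  proof -
    have "card ?B3 \<le> card (Sigma ?n (\<lambda>u. Sigma (?N u) ?N))" using fN by (intro card_image_le) auto
    also have "\<dots> = (\<Sum>u<n. \<Sum>x\<in>?N u. card (?N x))" using fN by (simp add: card_SigmaI)
    also have "\<dots> \<le> card ?n * (\<Delta> * \<Delta>)" using cN by (intro sum_le sum_le') auto
    finally show ?thesis by simp
  qed
  have c4: "card ?B4 \<le> n * (\<Delta> * (\<Delta> * \<Delta>))"
  proof -
    have "card ?B4 \<le> card (Sigma ?n (\<lambda>u. Sigma (?N u) (\<lambda>x. Sigma (?N x) ?N)))"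
      using fN by (intro card_image_le) auto
    also have "\<dots> = (\<Sum>u<n. \<Sum>x\<in>?N u. \<Sum>y\<in>?N x. card (?N y))" using fN by (simp add: card_SigmaI)
    also have "\<dots> \<le> card ?n * (\<Delta> * (\<Delta> * \<Delta>))" using cN by (intro sum_le sum_le') auto
    finally show ?thesis by simp
  qed
  have "finite ?V"
    by (rule finite_subset[of _ "?n \<times> ?n \<times> ?n \<times> ?n"]) (use S T in auto)
  moreover have "finite ?B1" "finite ?B2" "finite ?B3" "finite ?B4"
    using fN by (intro finite_imageI finite_SigmaI; simp)+
  ultimately have fin: "finite ?V" "finite ?B1" "finite ?B2" "finite ?B3" "finite ?B4" by blast+
  have "?A \<subseteq> ?V \<union> (?B1 \<union> ?B2 \<union> ?B3 \<union> ?B4)"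
  proof (rule subsetI, rule UnCI)
    fix p assume p: "p \<in> ?A" "p \<notin> ?B1 \<union> ?B2 \<union> ?B3 \<union> ?B4"
    obtain u v x y where p_eq: "p = (u, v, x, y)" by (cases p) auto
    have uv: "u \<in> S" "v \<in> T" "x \<in> ?N u" "y \<in> ?N v" using p(1) unfolding p_eq by simp_all
    have nb: "(u, v, x, y) \<notin> ?B1 \<union> ?B2 \<union> ?B3 \<union> ?B4" using p(2) unfolding p_eq .
    have un: "u < n" "v < n" using uv S T by auto
    have e: "{u, x} \<in> E" "{v, y} \<in> E" using uv by (auto simp: nbrs_def insert_commute)
    have 1: "u \<noteq> v" using nb uv un by (force simp: image_iff)
    have 2: "{u, v} \<notin> E" using nb uv un by (auto simp: nbrs_def insert_commute)
    have 3: "x \<noteq> y" using nb uv un nbrs_sym[of v E x] nbrs_sym[of y E v] by (force simp: image_iff)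
    have 4: "{x, y} \<notin> E"
    proof
      assume "{x, y} \<in> E"
      hence "y \<in> ?N x" by (simp add: nbrs_def insert_commute)
      moreover have "v \<in> ?N y" using uv nbrs_sym by blast
      ultimately have "(u, v, x, y) \<in> ?B4" using uv un by (force simp: image_iff)
      thus False using nb by blast
    qed
    have "u \<noteq> y" "x \<noteq> v" using 2 e by (auto simp: insert_commute)
    thus "p \<in> ?V" unfolding p_eq
      using 1 2 3 4 e uv regular_edgeD[OF E e(1)] regular_edgeD[OF E e(2)] by auto
  qed
  hence "card ?A \<le> card (?V \<union> (?B1 \<union> ?B2 \<union> ?B3 \<union> ?B4))" using fin by (intro card_mono) auto
  also have "\<dots> \<le> card ?V + (card ?B1 + card ?B2 + card ?B3 + card ?B4)"
    by (meson card_Un_le add_le_mono le_trans order_refl)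
  also have "\<dots> \<le> card ?V + (n * (\<Delta> * \<Delta>) + n * (\<Delta> * (\<Delta> * \<Delta>)) + n * (\<Delta> * \<Delta>) + n * (\<Delta> * (\<Delta> * \<Delta>)))"
    using c1 c2 c3 c4 by linarith
  also have "\<dots> \<le> card ?V + 4 * n * \<Delta> ^ 3"
  proof -
    have "n * (\<Delta> * \<Delta>) \<le> n * (\<Delta> * (\<Delta> * \<Delta>))" using D by (intro mult_le_mono2) simp
    moreover have "4 * n * \<Delta> ^ 3 = 4 * (n * (\<Delta> * (\<Delta> * \<Delta>)))" by (simp add: power3_eq_cube)
    ultimately show ?thesis by linarith
  qed
  finally show ?thesis by (simp add: cA)
qed

section \<open>Concentration via exponential moments\<close>

text \<open>Gronwall's argument: for the moment generating sum \<open>Z\<close>, the inequality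
  \<open>Z' \<le> \<phi>' * Z\<close> makes \<open>Z * exp (- \<phi>)\<close> nonincreasing, and
  \<open>Z 0 = card R\<close>.\<close>

lemma exp_moment_bound:
  fixes f :: "'a \<Rightarrow> real" and \<phi> \<phi>' :: "real \<Rightarrow> real"
  assumes deriv: "\<And>\<theta>. 0 \<le> \<theta> \<Longrightarrow> \<theta> \<le> \<theta>0 \<Longrightarrow> (\<phi> has_real_derivative \<phi>' \<theta>) (at \<theta>)"
    and le: "\<And>\<theta>. 0 \<le> \<theta> \<Longrightarrow> \<theta> \<le> \<theta>0 \<Longrightarrow>
      (\<Sum>x\<in>R. f x * exp (\<theta> * f x)) \<le> \<phi>' \<theta> * (\<Sum>x\<in>R. exp (\<theta> * f x))"
    and "\<phi> 0 = 0" and "0 \<le> \<theta>0"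
  shows "(\<Sum>x\<in>R. exp (\<theta>0 * f x)) \<le> real (card R) * exp (\<phi> \<theta>0)"
proof -
  define Z where "Z \<theta> = (\<Sum>x\<in>R. exp (\<theta> * f x))" for \<theta>
  define Z' where "Z' \<theta> = (\<Sum>x\<in>R. f x * exp (\<theta> * f x))" for \<theta>
  have dZ: "(Z has_real_derivative Z' \<theta>) (at \<theta>)" for \<theta>
    unfolding Z_def Z'_def by (auto intro!: derivative_eq_intros simp: mult.commute)
  have dG: "((\<lambda>\<theta>. Z \<theta> * exp (- \<phi> \<theta>)) has_real_derivative ((Z' \<theta> - \<phi>' \<theta> * Z \<theta>) * exp (- \<phi> \<theta>))) (at \<theta>)"
    if "0 \<le> \<theta>" "\<theta> \<le> \<theta>0" for \<theta>
    by (rule derivative_eq_intros dZ deriv that refl | simp add: algebra_simps)+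
  have "Z \<theta>0 * exp (- \<phi> \<theta>0) \<le> Z 0 * exp (- \<phi> 0)"
  proof (rule DERIV_nonpos_imp_nonincreasing[OF \<open>0 \<le> \<theta>0\<close>])
    fix \<theta> assume \<theta>: "0 \<le> \<theta>" "\<theta> \<le> \<theta>0"
    have "(Z' \<theta> - \<phi>' \<theta> * Z \<theta>) * exp (- \<phi> \<theta>) \<le> 0"
      using le[OF \<theta>] by (intro mult_nonpos_nonneg) (auto simp: Z_def Z'_def)
    thus "\<exists>y. ((\<lambda>\<theta>. Z \<theta> * exp (- \<phi> \<theta>)) has_real_derivative y) (at \<theta>) \<and> y \<le> 0"
      using dG[OF \<theta>] by blast
  qed
  hence "Z \<theta>0 * exp (- \<phi> \<theta>0) * exp (\<phi> \<theta>0) \<le> real (card R) * exp (\<phi> \<theta>0)"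
    using \<open>\<phi> 0 = 0\<close> by (simp add: Z_def)
  thus ?thesis by (simp add: Z_def mult.assoc exp_add[symmetric])
qed

lemma chernoff_card:
  fixes f :: "'a \<Rightarrow> real"
  assumes "finite R" and "0 \<le> \<theta>" and "(\<Sum>x\<in>R. exp (\<theta> * f x)) \<le> c * exp b"
  shows "real (card {x\<in>R. a \<le> f x}) \<le> c * exp (b - \<theta> * a)"
proof -
  have "real (card {x\<in>R. a \<le> f x}) * exp (\<theta> * a) = (\<Sum>x\<in>{x\<in>R. a \<le> f x}. exp (\<theta> * a))" by simp
  also have "\<dots> \<le> (\<Sum>x\<in>{x\<in>R. a \<le> f x}. exp (\<theta> * f x))"
    using assms by (intro sum_mono) (auto intro: mult_left_mono)
  also have "\<dots> \<le> (\<Sum>x\<in>R. exp (\<theta> * f x))" using assms by (intro sum_mono2) auto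
  also note assms(3)
  finally have "real (card {x\<in>R. a \<le> f x}) \<le> c * exp b / exp (\<theta> * a)" by (simp add: pos_le_divide_eq)
  thus ?thesis by (simp add: exp_diff)
qed

text \<open>Ordered pairs: an edge inside \<open>S \<inter> T\<close> counts twice, as in the
  bilinear form of the adjacency matrix.\<close>

definition arcs_between :: "nat set set \<Rightarrow> nat set \<Rightarrow> nat set \<Rightarrow> nat" where
  "arcs_between E S T = card {(u, v). u \<in> S \<and> v \<in> T \<and> {u, v} \<in> E}"

text \<open>Members of \<open>\<tau>\<close> without a neighbour in \<open>\<tau>\<close> count as
  well; \<open>uncovered_le_free\<close> corrects for them.\<close>

definition uncovered :: "nat \<Rightarrow> nat set set \<Rightarrow> nat set \<Rightarrow> nat" where
  "uncovered n E \<tau> = card {v. v < n \<and> nbrs E v \<inter> \<tau> = {}}"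

lemma card_pairs:
  assumes "finite S" "finite T"
  shows "card {(u, v). u \<in> S \<and> v \<in> T \<and> P u v} = (\<Sum>u\<in>S. \<Sum>v\<in>T. of_bool (P u v))"
proof -
  have "{(u, v). u \<in> S \<and> v \<in> T \<and> P u v} = Sigma S (\<lambda>u. {v\<in>T. P u v})" by auto
  moreover have "(\<Sum>v\<in>T. of_bool (P u v)) = card {v\<in>T. P u v}" for u
    using assms by (simp add: of_bool_def sum.If_cases Int_def)
  ultimately show ?thesis using assms by (simp add: card_SigmaI)
qed

lemma arcs_between_sum:
  assumes "finite S" "finite T"
  shows "arcs_between E S T = (\<Sum>u\<in>S. \<Sum>v\<in>T. of_bool ({u, v} \<in> E))"
  unfolding arcs_between_def by (rule card_pairs[OF assms])

lemma card_quadruples: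
  assumes "finite S" "finite T" "finite X" "finite Y"
  shows "card {q \<in> S \<times> T \<times> X \<times> Y. P q} = (\<Sum>u\<in>S. \<Sum>v\<in>T. card {(x, y). x \<in> X \<and> y \<in> Y \<and> P (u, v, x, y)})"
proof -
  have "{q \<in> S \<times> T \<times> X \<times> Y. P q} = Sigma S (\<lambda>u. Sigma T (\<lambda>v. {(x, y). x \<in> X \<and> y \<in> Y \<and> P (u, v, x, y)}))"
    by auto
  moreover have "finite {(x, y). x \<in> X \<and> y \<in> Y \<and> P (u, v, x, y)}" for u v
    by (rule finite_subset[of _ "X \<times> Y"]) (use assms in auto)
  ultimately show ?thesis using assms by (simp add: card_SigmaI)
qed

text \<open>Two new edges, each in two directions.\<close>

lemma arcs_between_switch:
  assumes "finite S" "finite T" and valid: "valid_switch E q"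
  shows "arcs_between (switch E q) S T \<le> arcs_between E S T + 4"
proof -
  obtain u v x y where q: "q = (u, v, x, y)" by (cases q) auto
  let ?A = "{(u, v). u \<in> S \<and> v \<in> T \<and> {u, v} \<in> E}"
  let ?B = "{(u, x), (x, u), (v, y), (y, v)}"
  have fin: "finite ?A" by (rule finite_subset[of _ "S \<times> T"]) (use assms in auto)
  have "arcs_between (switch E q) S T \<le> card (?A \<union> ?B)"
    unfolding arcs_between_def q using fin by (intro card_mono) (auto simp: doubleton_eq_iff)
  also have "\<dots> \<le> card ?A + card ?B" by (rule card_Un_le)
  also have "card ?B \<le> 4" using card_length[of "[(u, x), (x, u), (v, y), (y, v)]"] by simp
  finally show ?thesis by (simp add: arcs_between_def)
qed

text \<open>Only the four vertices of the switching change their neighbourhoods.\<close>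

lemma uncovered_switch:
  assumes valid: "valid_switch E q"
  shows "uncovered n (switch E q) \<tau> \<le> uncovered n E \<tau> + 4"
proof -
  obtain u v x y where q: "q = (u, v, x, y)" by (cases q) auto
  have nb: "nbrs (switch E q) w = nbrs E w" if "w \<notin> {u, v, x, y}" for w
    using that by (auto simp: nbrs_def q doubleton_eq_iff)
  let ?A = "{v. v < n \<and> nbrs E v \<inter> \<tau> = {}}"
  have "{v. v < n \<and> nbrs (switch E q) v \<inter> \<tau> = {}} \<subseteq> ?A \<union> {u, v, x, y}" using nb by auto
  hence "uncovered n (switch E q) \<tau> \<le> card (?A \<union> {u, v, x, y})"
    unfolding uncovered_def by (intro card_mono) auto
  also have "\<dots> \<le> card ?A + card {u, v, x, y}" by (rule card_Un_le)
  also have "card {u, v, x, y} \<le> 4" using card_length[of "[u, v, x, y]"] by simp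
  finally show ?thesis by (simp add: uncovered_def)
qed

lemma switch_sum_const:
  fixes g :: "nat set set \<Rightarrow> real"
  assumes "finite I"
  shows "(\<Sum>E\<in>regular_graphs n \<Delta>. g E * real (card {q\<in>I. valid_switch E q})) =
    (\<Sum>E\<in>regular_graphs n \<Delta>. \<Sum>q\<in>{q\<in>I. valid_switch E (flip q)}. g (switch E (flip q)))"
  using switch_sum[OF assms, where h = "\<lambda>E q. g E"] by (simp add: mult.commute)

text \<open>Weighted switchings counted from both ends. An arc of \<open>S \<times> T\<close> can be
  destroyed in at least \<open>n * \<Delta> - 6 * \<Delta>^2\<close> ways; one can be created in at
  most \<open>card S * card T * \<Delta>^2\<close> ways, and the creation raises \<open>e\<close> by
  at most 4, hence the factor \<open>exp (4 * \<theta>)\<close>.\<close>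

lemma arcs_moment_upper:
  fixes S T :: "nat set"
  assumes S: "S \<subseteq> {..<n}" and T: "T \<subseteq> {..<n}" and D: "\<Delta> \<ge> 1" and \<theta>: "\<theta> \<ge> 0"
  defines "e \<equiv> \<lambda>E. real (arcs_between E S T)"
  shows "(real n * \<Delta> - 6 * \<Delta>\<^sup>2) * (\<Sum>E\<in>regular_graphs n \<Delta>. e E * exp (\<theta> * e E)) \<le>
    (real (card S) * card T * \<Delta>\<^sup>2) * exp (4 * \<theta>) * (\<Sum>E\<in>regular_graphs n \<Delta>. exp (\<theta> * e E))"
proof -
  let ?G = "regular_graphs n \<Delta>" and ?I = "S \<times> T \<times> {..<n} \<times> {..<n}"
  have fin: "finite S" "finite T" using S T finite_subset by auto
  have lower: "e E * (real n * \<Delta> - 6 * \<Delta>\<^sup>2) \<le> real (card {q\<in>?I. valid_switch E q})" if E: "E \<in> ?G" for E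
  proof -
    have "e E * (real n * \<Delta> - 6 * \<Delta>\<^sup>2) = (\<Sum>u\<in>S. \<Sum>v\<in>T. of_bool ({u, v} \<in> E) * (real n * \<Delta> - 6 * \<Delta>\<^sup>2))"
      unfolding e_def arcs_between_sum[OF fin] by (simp add: sum_distrib_right)
    also have "\<dots> \<le> (\<Sum>u\<in>S. \<Sum>v\<in>T. real (card {(x, y). x \<in> {..<n} \<and> y \<in> {..<n} \<and> valid_switch E (u, v, x, y)}))"
    proof (intro sum_mono)
      fix u v
      have "real (card {..<n} * \<Delta>) \<le> real (card {(x, y). x \<in> {..<n} \<and> y < n \<and> valid_switch E (u, v, x, y)} + 6 * \<Delta>\<^sup>2)"
        if "{u, v} \<in> E" using card_switches_ge[OF E that order_refl D] by (intro of_nat_mono)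
      thus "of_bool ({u, v} \<in> E) * (real n * \<Delta> - 6 * \<Delta>\<^sup>2) \<le>
        real (card {(x, y). x \<in> {..<n} \<and> y \<in> {..<n} \<and> valid_switch E (u, v, x, y)})"
        by (cases "{u, v} \<in> E") (simp_all add: del: valid_switch.simps)
    qed
    also have "\<dots> = real (card {q\<in>?I. valid_switch E q})"
      using fin by (simp add: card_quadruples del: valid_switch.simps)
    finally show ?thesis .
  qed
  have upper: "real (card {q\<in>?I. valid_switch E (flip q)}) \<le> real (card S) * card T * \<Delta>\<^sup>2" if E: "E \<in> ?G" for E
  proof -
    have "card {q\<in>?I. valid_switch E (flip q)} =
      (\<Sum>u\<in>S. \<Sum>v\<in>T. card {(x, y). x \<in> {..<n} \<and> y \<in> {..<n} \<and> valid_switch E (flip (u, v, x, y))})"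
      using fin by (intro card_quadruples) auto
    also have "\<dots> \<le> (\<Sum>u\<in>S. \<Sum>v\<in>T. \<Delta>\<^sup>2)"
      using card_reverse_switches_le[OF E] by (intro sum_mono) (simp del: valid_switch.simps)
    also have "\<dots> = card S * card T * \<Delta>\<^sup>2" by simp
    finally have "real (card {q\<in>?I. valid_switch E (flip q)}) \<le> real (card S * card T * \<Delta>\<^sup>2)"
      by (rule of_nat_mono)
    thus ?thesis by simp
  qed
  have "(real n * \<Delta> - 6 * \<Delta>\<^sup>2) * (\<Sum>E\<in>?G. e E * exp (\<theta> * e E)) =
      (\<Sum>E\<in>?G. exp (\<theta> * e E) * (e E * (real n * \<Delta> - 6 * \<Delta>\<^sup>2)))"
    unfolding sum_distrib_left by (intro sum.cong refl) (simp only: mult_ac)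
  also have "\<dots> \<le> (\<Sum>E\<in>?G. exp (\<theta> * e E) * real (card {q\<in>?I. valid_switch E q}))"
    using lower by (intro sum_mono mult_left_mono) auto
  also have "\<dots> = (\<Sum>E\<in>?G. \<Sum>q\<in>{q\<in>?I. valid_switch E (flip q)}. exp (\<theta> * e (switch E (flip q))))"
    using fin by (intro switch_sum_const) auto
  also have "\<dots> \<le> (\<Sum>E\<in>?G. \<Sum>q\<in>{q\<in>?I. valid_switch E (flip q)}. exp (\<theta> * e E) * exp (4 * \<theta>))"
  proof (intro sum_mono)
    fix E q assume "q \<in> {q\<in>?I. valid_switch E (flip q)}"
    hence "e (switch E (flip q)) \<le> e E + 4"
      unfolding e_def using arcs_between_switch[OF fin, of E "flip q"] by simp
    hence "exp (\<theta> * e (switch E (flip q))) \<le> exp (\<theta> * (e E + 4))" using \<theta> by (simp add: mult_left_mono)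
    thus "exp (\<theta> * e (switch E (flip q))) \<le> exp (\<theta> * e E) * exp (4 * \<theta>)"
      by (simp add: exp_add[symmetric] algebra_simps)
  qed
  also have "\<dots> = (\<Sum>E\<in>?G. (exp (\<theta> * e E) * exp (4 * \<theta>)) * real (card {q\<in>?I. valid_switch E (flip q)}))"
    by (simp add: mult.commute)
  also have "\<dots> \<le> (\<Sum>E\<in>?G. (exp (\<theta> * e E) * exp (4 * \<theta>)) * (real (card S) * card T * \<Delta>\<^sup>2))"
    using upper by (intro sum_mono mult_left_mono) auto
  also have "\<dots> = (real (card S) * card T * \<Delta>\<^sup>2) * exp (4 * \<theta>) * (\<Sum>E\<in>?G. exp (\<theta> * e E))"
    unfolding sum_distrib_left by (intro sum.cong refl) (simp only: mult_ac)
  finally show ?thesis by (simp only: of_nat_power of_nat_mult of_nat_numeral)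
qed

text \<open>The same exchange with upper and lower counts interchanged: an arc can be destroyed in
  at most \<open>n * \<Delta>\<close> ways, and \<open>card_reverse_switches_ge\<close> bounds the
  creations from below.\<close>

lemma arcs_moment_lower:
  fixes S T :: "nat set"
  assumes S: "S \<subseteq> {..<n}" and T: "T \<subseteq> {..<n}" and D: "\<Delta> \<ge> 1" and \<theta>: "\<theta> \<ge> 0"
  defines "e \<equiv> \<lambda>E. real (arcs_between E S T)"
  shows "(real (card S) * card T * \<Delta>\<^sup>2 - 4 * n * \<Delta> ^ 3) * exp (- (4 * \<theta>)) *
      (\<Sum>E\<in>regular_graphs n \<Delta>. exp (- \<theta> * e E)) \<le>
    (real n * \<Delta>) * (\<Sum>E\<in>regular_graphs n \<Delta>. e E * exp (- \<theta> * e E))"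
proof -
  let ?G = "regular_graphs n \<Delta>" and ?I = "S \<times> T \<times> {..<n} \<times> {..<n}"
  have fin: "finite S" "finite T" using S T finite_subset by auto
  have upper: "real (card {q\<in>?I. valid_switch E q}) \<le> e E * (real n * \<Delta>)" if E: "E \<in> ?G" for E
  proof -
    have "card {q\<in>?I. valid_switch E q} =
      (\<Sum>u\<in>S. \<Sum>v\<in>T. card {(x, y). x \<in> {..<n} \<and> y \<in> {..<n} \<and> valid_switch E (u, v, x, y)})"
      using fin by (intro card_quadruples) auto
    also have "\<dots> \<le> (\<Sum>u\<in>S. \<Sum>v\<in>T. of_bool ({u, v} \<in> E) * (n * \<Delta>))"
    proof (intro sum_mono)
      fix u v
      let ?A = "{(x, y). x \<in> {..<n} \<and> y \<in> {..<n} \<and> valid_switch E (u, v, x, y)}"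
      have "?A \<subseteq> Sigma {..<n} (nbrs E)" by (auto simp: nbrs_def insert_commute)
      hence "card ?A \<le> card (Sigma {..<n} (nbrs E))"
        using finite_nbrs[OF E] by (intro card_mono) auto
      also have "\<dots> = n * \<Delta>" using card_arcs[OF E order_refl] by simp
      finally have "card ?A \<le> n * \<Delta>" .
      moreover have "card ?A = 0" if "{u, v} \<notin> E" using that by simp
      ultimately show "card ?A \<le> of_bool ({u, v} \<in> E) * (n * \<Delta>)"
        by (cases "{u, v} \<in> E") (simp_all del: valid_switch.simps)
    qed
    also have "\<dots> = arcs_between E S T * (n * \<Delta>)"
      unfolding arcs_between_sum[OF fin] by (simp add: sum_distrib_right)
    finally have "real (card {q\<in>?I. valid_switch E q}) \<le> real (arcs_between E S T * (n * \<Delta>))"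
      by (rule of_nat_mono)
    thus ?thesis by (simp add: e_def)
  qed
  have lower: "real (card S) * card T * \<Delta>\<^sup>2 - 4 * n * \<Delta> ^ 3 \<le> real (card {q\<in>?I. valid_switch E (flip q)})"
    if E: "E \<in> ?G" for E
  proof -
    have "{q\<in>?I. valid_switch E (flip q)} =
      {(u, v, x, y). u \<in> S \<and> v \<in> T \<and> x < n \<and> y < n \<and> valid_switch E (u, x, v, y)}" by auto
    hence "real (card S * card T * \<Delta>\<^sup>2) \<le> real (card {q\<in>?I. valid_switch E (flip q)} + 4 * n * \<Delta> ^ 3)"
      using card_reverse_switches_ge[OF E S T D] by (intro of_nat_mono) (simp only:)
    thus ?thesis by simp
  qed
  have "(real (card S) * card T * \<Delta>\<^sup>2 - 4 * n * \<Delta> ^ 3) * exp (- (4 * \<theta>)) * (\<Sum>E\<in>?G. exp (- \<theta> * e E)) =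
      (\<Sum>E\<in>?G. (exp (- \<theta> * e E) * exp (- (4 * \<theta>))) * (real (card S) * card T * \<Delta>\<^sup>2 - 4 * n * \<Delta> ^ 3))"
    unfolding sum_distrib_left by (intro sum.cong refl) (simp only: mult_ac)
  also have "\<dots> \<le> (\<Sum>E\<in>?G. (exp (- \<theta> * e E) * exp (- (4 * \<theta>))) * real (card {q\<in>?I. valid_switch E (flip q)}))"
    using lower by (intro sum_mono mult_left_mono) auto
  also have "\<dots> = (\<Sum>E\<in>?G. \<Sum>q\<in>{q\<in>?I. valid_switch E (flip q)}. exp (- \<theta> * e E) * exp (- (4 * \<theta>)))"
    by (simp add: mult.commute)
  also have "\<dots> \<le> (\<Sum>E\<in>?G. \<Sum>q\<in>{q\<in>?I. valid_switch E (flip q)}. exp (- \<theta> * e (switch E (flip q))))"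
  proof (intro sum_mono)
    fix E q assume "q \<in> {q\<in>?I. valid_switch E (flip q)}"
    hence "e (switch E (flip q)) \<le> e E + 4"
      unfolding e_def using arcs_between_switch[OF fin, of E "flip q"] by simp
    hence "\<theta> * e (switch E (flip q)) \<le> \<theta> * (e E + 4)" using \<theta> by (rule mult_left_mono)
    hence "exp (- \<theta> * (e E + 4)) \<le> exp (- \<theta> * e (switch E (flip q)))" by simp
    thus "exp (- \<theta> * e E) * exp (- (4 * \<theta>)) \<le> exp (- \<theta> * e (switch E (flip q)))"
      by (simp add: exp_add[symmetric] algebra_simps)
  qed
  also have "\<dots> = (\<Sum>E\<in>?G. exp (- \<theta> * e E) * real (card {q\<in>?I. valid_switch E q}))"
    using fin by (intro switch_sum_const[symmetric]) auto
  also have "\<dots> \<le> (\<Sum>E\<in>?G. exp (- \<theta> * e E) * (e E * (real n * \<Delta>)))"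
    using upper by (intro sum_mono mult_left_mono) auto
  also have "\<dots> = (real n * \<Delta>) * (\<Sum>E\<in>?G. e E * exp (- \<theta> * e E))"
    unfolding sum_distrib_left by (intro sum.cong refl) (simp only: mult_ac)
  finally show ?thesis by (simp only: of_nat_power of_nat_mult of_nat_numeral)
qed

text \<open>Compares the weighted masses of the graphs in which \<open>v\<close> has
  \<open>j + 1\<close> and \<open>j\<close> neighbours in \<open>\<tau>\<close>. Taking
  \<open>x\<close> outside \<open>\<tau>\<close> makes the switching trade a neighbour of
  \<open>v\<close> in \<open>\<tau>\<close> for one outside, so the number drops by exactly
  one.\<close>

lemma nbrs_count_step:
  fixes \<tau> :: "nat set" and v j :: nat
  assumes \<tau>: "\<tau> \<subseteq> {..<n}" and v: "v < n" and D: "\<Delta> \<ge> 1" and \<theta>: "\<theta> \<ge> 0"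
  defines "g \<equiv> \<lambda>E. exp (- \<theta> * real (uncovered n E \<tau>))"
    and "d \<equiv> \<lambda>E. card (nbrs E v \<inter> \<tau>)"
  defines "W \<equiv> \<lambda>j. \<Sum>E\<in>regular_graphs n \<Delta>. of_bool (d E = j) * g E"
  shows "W (Suc j) * (real (Suc j) * ((real n - card \<tau>) * \<Delta> - 6 * \<Delta>\<^sup>2)) \<le>
    exp (4 * \<theta>) * W j * ((real \<Delta> - j) * card \<tau> * \<Delta>)"
proof -
  let ?G = "regular_graphs n \<Delta>" and ?I = "{v} \<times> \<tau> \<times> ({..<n} - \<tau>) \<times> {..<n}"
  define r where "r = (real n - card \<tau>) * \<Delta> - 6 * \<Delta>\<^sup>2"
  have fin: "finite \<tau>" using \<tau> finite_subset by auto
  have cX: "real (card ({..<n} - \<tau>)) = real n - card \<tau>"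
    using \<tau> fin card_mono[OF _ \<tau>] by (simp add: card_Diff_subset of_nat_diff)
  have lower: "real (d E) * r \<le> real (card {q\<in>?I. valid_switch E q})" if E: "E \<in> ?G" for E
  proof -
    have "nbrs E v \<inter> \<tau> = {u\<in>\<tau>. {v, u} \<in> E}" by (auto simp: nbrs_def insert_commute)
    hence "real (d E) = (\<Sum>u\<in>\<tau>. of_bool ({v, u} \<in> E))"
      using fin by (simp add: d_def of_bool_def sum.If_cases Int_def)
    hence "real (d E) * r = (\<Sum>u\<in>\<tau>. of_bool ({v, u} \<in> E) * r)" by (simp add: sum_distrib_right)
    also have "\<dots> \<le> (\<Sum>u\<in>\<tau>. real (card {(x, y). x \<in> {..<n} - \<tau> \<and> y \<in> {..<n} \<and> valid_switch E (v, u, x, y)}))"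
    proof (intro sum_mono)
      fix u
      have "real (card ({..<n} - \<tau>) * \<Delta>) \<le>
          real (card {(x, y). x \<in> {..<n} - \<tau> \<and> y < n \<and> valid_switch E (v, u, x, y)} + 6 * \<Delta>\<^sup>2)"
        if "{v, u} \<in> E"
        using card_switches_ge[OF E that Diff_subset D] by (intro of_nat_mono)
      thus "of_bool ({v, u} \<in> E) * r \<le>
          real (card {(x, y). x \<in> {..<n} - \<tau> \<and> y \<in> {..<n} \<and> valid_switch E (v, u, x, y)})"
        by (cases "{v, u} \<in> E") (simp_all add: cX r_def del: valid_switch.simps)
    qed
    also have "\<dots> = real (card {q\<in>?I. valid_switch E q})"
      using fin by (simp add: card_quadruples del: valid_switch.simps)
    finally show ?thesis .
  qed
  have upper: "real (card {q\<in>?I. valid_switch E (flip q)}) \<le> (real \<Delta> - d E) * card \<tau> * \<Delta>" if E: "E \<in> ?G" for E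
  proof -
    have "{q\<in>?I. valid_switch E (flip q)} \<subseteq> Sigma {v} (\<lambda>_. Sigma \<tau> (\<lambda>u. (nbrs E v - \<tau>) \<times> nbrs E u))"
      by (auto simp: nbrs_def insert_commute)
    hence "card {q\<in>?I. valid_switch E (flip q)} \<le>
        card (Sigma {v} (\<lambda>_. Sigma \<tau> (\<lambda>u. (nbrs E v - \<tau>) \<times> nbrs E u)))"
      using fin finite_nbrs[OF E] by (intro card_mono) auto
    also have "\<dots> = (\<Sum>u\<in>\<tau>. card (nbrs E v - \<tau>) * card (nbrs E u))"
      using fin finite_nbrs[OF E] by (simp add: card_SigmaI card_cartesian_product)
    also have "\<dots> = card \<tau> * card (nbrs E v - \<tau>) * \<Delta>"
      using \<tau> card_nbrs[OF E] by (simp add: subset_iff)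
    finally have "real (card {q\<in>?I. valid_switch E (flip q)}) \<le> real (card \<tau> * card (nbrs E v - \<tau>) * \<Delta>)"
      by (rule of_nat_mono)
    moreover have "card (nbrs E v - \<tau>) + d E = \<Delta>"
      using finite_nbrs[OF E, of v] card_nbrs[OF E v] unfolding d_def
      by (metis add.commute card_Int_Diff)
    hence "real (card (nbrs E v - \<tau>)) = real \<Delta> - d E" by linarith
    ultimately show ?thesis by (simp add: mult_ac)
  qed
  have dsw: "d (switch E (flip q)) = Suc (d E)" if E: "E \<in> ?G" and q: "q \<in> ?I" "valid_switch E (flip q)" for E q
  proof -
    obtain u x y where quxy: "q = (v, u, x, y)" "u \<in> \<tau>" "x \<notin> \<tau>" using q(1) by auto
    have "nbrs (switch E (flip q)) v \<inter> \<tau> = insert u (nbrs E v \<inter> \<tau>)"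
      using q(2) quxy by (auto simp: nbrs_def insert_commute doubleton_eq_iff)
    moreover have "u \<notin> nbrs E v" using q(2) quxy by (auto simp: nbrs_def insert_commute)
    ultimately show ?thesis unfolding d_def using fin by simp
  qed
  have "W (Suc j) * (real (Suc j) * r) = (\<Sum>E\<in>?G. (of_bool (d E = Suc j) * g E) * (real (d E) * r))"
    unfolding W_def sum_distrib_right by (intro sum.cong refl) simp
  also have "\<dots> \<le> (\<Sum>E\<in>?G. (of_bool (d E = Suc j) * g E) * real (card {q\<in>?I. valid_switch E q}))"
    using lower by (intro sum_mono mult_left_mono) (auto simp: g_def)
  also have "\<dots> = (\<Sum>E\<in>?G. \<Sum>q\<in>{q\<in>?I. valid_switch E (flip q)}.
      of_bool (d (switch E (flip q)) = Suc j) * g (switch E (flip q)))"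
    using fin by (intro switch_sum_const) auto
  also have "\<dots> \<le> (\<Sum>E\<in>?G. \<Sum>q\<in>{q\<in>?I. valid_switch E (flip q)}. of_bool (d E = j) * (g E * exp (4 * \<theta>)))"
  proof (intro sum_mono mult_mono)
    fix E q assume E: "E \<in> ?G" and "q \<in> {q\<in>?I. valid_switch E (flip q)}"
    hence q: "q \<in> ?I" "valid_switch E (flip q)" by auto
    show "of_bool (d (switch E (flip q)) = Suc j) \<le> (of_bool (d E = j) :: real)"
      using dsw[OF E q] by simp
    have "uncovered n E \<tau> \<le> uncovered n (switch E (flip q)) \<tau> + 4"
      using uncovered_switch[of "switch E (flip q)" "flip (flip q)" n \<tau>] switch_switch[OF q(2)] by simp
    hence "real (uncovered n E \<tau>) - 4 \<le> uncovered n (switch E (flip q)) \<tau>" by simp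
    hence "\<theta> * (real (uncovered n E \<tau>) - 4) \<le> \<theta> * uncovered n (switch E (flip q)) \<tau>"
      using \<theta> by (rule mult_left_mono)
    thus "g (switch E (flip q)) \<le> g E * exp (4 * \<theta>)"
      unfolding g_def by (simp add: exp_add[symmetric] algebra_simps)
  qed (auto simp: g_def)
  also have "\<dots> = (\<Sum>E\<in>?G. (of_bool (d E = j) * (g E * exp (4 * \<theta>))) * real (card {q\<in>?I. valid_switch E (flip q)}))"
    by (simp add: mult.commute)
  also have "\<dots> \<le> (\<Sum>E\<in>?G. (of_bool (d E = j) * (g E * exp (4 * \<theta>))) * ((real \<Delta> - d E) * card \<tau> * \<Delta>))"
    using upper by (intro sum_mono mult_left_mono) (auto simp: g_def)
  also have "\<dots> = exp (4 * \<theta>) * W j * ((real \<Delta> - j) * card \<tau> * \<Delta>)"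
    unfolding W_def sum_distrib_right sum_distrib_left by (intro sum.cong refl) (simp add: algebra_simps)
  finally show ?thesis by (simp add: r_def)
qed

text \<open>The step inequality gives \<open>W j \<le> (\<Delta> choose j) * q^j * W 0\<close>, as
  for a binomial law with odds \<open>q\<close>. The sum over \<open>j\<close> is at most
  \<open>(1 + q)^\<Delta> * W 0\<close>, so the class \<open>W 0\<close>, where \<open>v\<close> is
  uncovered, has at least the share \<open>exp (- q * \<Delta>)\<close> of the total weight.\<close>

lemma uncovered_vertex_moment:
  fixes \<tau> :: "nat set" and v :: nat
  assumes \<tau>: "\<tau> \<subseteq> {..<n}" and v: "v < n" and D: "\<Delta> \<ge> 1" and \<theta>: "\<theta> \<ge> 0"
    and n: "real n > card \<tau> + 6 * \<Delta>"
  defines "g \<equiv> \<lambda>E. exp (- \<theta> * real (uncovered n E \<tau>))"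
    and "q \<equiv> exp (4 * \<theta>) * card \<tau> / (real n - card \<tau> - 6 * \<Delta>)"
  shows "exp (- q * \<Delta>) * (\<Sum>E\<in>regular_graphs n \<Delta>. g E) \<le>
    (\<Sum>E\<in>regular_graphs n \<Delta>. of_bool (nbrs E v \<inter> \<tau> = {}) * g E)"
proof -
  let ?G = "regular_graphs n \<Delta>"
  have fin: "finite \<tau>" using \<tau> finite_subset by auto
  define d where "d = (\<lambda>E. card (nbrs E v \<inter> \<tau>))"
  define W where "W j = (\<Sum>E\<in>?G. of_bool (d E = j) * g E)" for j
  define m where "m = real n - card \<tau> - 6 * \<Delta>"
  have m: "m > 0" using n by (simp add: m_def)
  have q0: "q \<ge> 0" unfolding q_def using m by (simp add: m_def)
  have W0: "W j \<ge> 0" for j unfolding W_def g_def by (intro sum_nonneg) simp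
  have step: "W (Suc j) * real (Suc j) \<le> q * W j * (real \<Delta> - j)" for j
  proof -
    have "W (Suc j) * (real (Suc j) * (m * \<Delta>)) \<le> exp (4 * \<theta>) * W j * ((real \<Delta> - j) * card \<tau> * \<Delta>)"
      using nbrs_count_step[OF \<tau> v D \<theta>, of j] unfolding W_def d_def g_def m_def
      by (simp add: power2_eq_square algebra_simps)
    hence "(W (Suc j) * real (Suc j) * m) * \<Delta> \<le> (exp (4 * \<theta>) * W j * ((real \<Delta> - j) * card \<tau>)) * \<Delta>"
      by (simp add: mult_ac)
    hence "W (Suc j) * real (Suc j) * m \<le> exp (4 * \<theta>) * W j * ((real \<Delta> - j) * card \<tau>)"
      using D by (subst (asm) mult_le_cancel_right) auto
    hence "W (Suc j) * real (Suc j) \<le> exp (4 * \<theta>) * W j * ((real \<Delta> - j) * card \<tau>) / m"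
      using m by (simp add: pos_le_divide_eq)
    thus ?thesis by (simp add: q_def m_def mult_ac)
  qed
  have bound: "W j \<le> real (\<Delta> choose j) * q ^ j * W 0" if "j \<le> \<Delta>" for j
    using that
  proof (induction j)
    case (Suc j)
    hence IH: "W j \<le> real (\<Delta> choose j) * q ^ j * W 0" by simp
    have "real (Suc j) * real (\<Delta> choose Suc j) = real (\<Delta> - j) * real (\<Delta> choose j)"
      using binomial_absorb_comp[of \<Delta> j] binomial_absorption[of j "\<Delta>"]
      by (metis binomial_absorption binomial_absorb_comp of_nat_mult Suc_times_binomial_eq mult.commute)
    hence ch: "real (Suc j) * real (\<Delta> choose Suc j) = (real \<Delta> - j) * real (\<Delta> choose j)"
      using Suc.prems by (simp add: of_nat_diff)
    have "W (Suc j) * real (Suc j) \<le> q * W j * (real \<Delta> - j)" by (rule step)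
    also have "\<dots> \<le> q * (real (\<Delta> choose j) * q ^ j * W 0) * (real \<Delta> - j)"
      using IH q0 Suc.prems by (intro mult_right_mono mult_left_mono) auto
    also have "\<dots> = ((real \<Delta> - j) * real (\<Delta> choose j)) * q ^ Suc j * W 0" by simp
    also have "\<dots> = (real (\<Delta> choose Suc j) * q ^ Suc j * W 0) * real (Suc j)" by (simp only: ch[symmetric]) simp
    finally show ?case by (subst (asm) mult_le_cancel_right) auto
  qed simp
  have d_le: "d E \<le> \<Delta>" if "E \<in> ?G" for E
    using card_nbrs_le[OF that, of v] card_mono[OF finite_nbrs[OF that, of v], of "nbrs E v \<inter> \<tau>"]
    unfolding d_def by simp
  have "(\<Sum>E\<in>?G. g E) = (\<Sum>E\<in>?G. \<Sum>j\<le>\<Delta>. of_bool (d E = j) * g E)"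
  proof (intro sum.cong refl)
    fix E assume "E \<in> ?G"
    thus "g E = (\<Sum>j\<le>\<Delta>. of_bool (d E = j) * g E)" using d_le by (simp add: sum_distrib_right[symmetric] of_bool_def)
  qed
  also have "\<dots> = (\<Sum>j\<le>\<Delta>. W j)" unfolding W_def by (rule sum.swap)
  also have "\<dots> \<le> (\<Sum>j\<le>\<Delta>. real (\<Delta> choose j) * q ^ j * W 0)" using bound by (intro sum_mono) auto
  also have "\<dots> = (q + 1) ^ \<Delta> * W 0"
    by (simp add: binomial_ring sum_distrib_right)
  also have "\<dots> \<le> exp q ^ \<Delta> * W 0"
    using exp_ge_add_one_self[of q] q0 W0[of 0] by (intro mult_right_mono power_mono) (auto simp: add.commute)
  also have "\<dots> = exp (q * \<Delta>) * W 0" by (simp add: exp_of_nat_mult[symmetric] mult.commute)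
  finally have "exp (- q * \<Delta>) * (\<Sum>E\<in>?G. g E) \<le> exp (- q * \<Delta>) * (exp (q * \<Delta>) * W 0)"
    by (intro mult_left_mono) auto
  also have "\<dots> = W 0" by (simp add: mult.assoc[symmetric] exp_add[symmetric])
  also have "W 0 = (\<Sum>E\<in>?G. of_bool (nbrs E v \<inter> \<tau> = {}) * g E)"
    unfolding W_def d_def using fin by (intro sum.cong refl) (simp add: card_eq_0_iff)
  finally show ?thesis .
qed

lemma uncovered_moment:
  fixes \<tau> :: "nat set"
  assumes \<tau>: "\<tau> \<subseteq> {..<n}" and D: "\<Delta> \<ge> 1" and \<theta>: "\<theta> \<ge> 0" and n: "real n > card \<tau> + 6 * \<Delta>"
  defines "U \<equiv> \<lambda>E. real (uncovered n E \<tau>)"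
    and "q \<equiv> exp (4 * \<theta>) * card \<tau> / (real n - card \<tau> - 6 * \<Delta>)"
  shows "n * exp (- q * \<Delta>) * (\<Sum>E\<in>regular_graphs n \<Delta>. exp (- \<theta> * U E)) \<le>
    (\<Sum>E\<in>regular_graphs n \<Delta>. U E * exp (- \<theta> * U E))"
proof -
  let ?G = "regular_graphs n \<Delta>"
  have U: "U E = (\<Sum>v<n. of_bool (nbrs E v \<inter> \<tau> = {}))" for E
  proof -
    have "{v. v < n \<and> nbrs E v \<inter> \<tau> = {}} = {v\<in>{..<n}. nbrs E v \<inter> \<tau> = {}}" by auto
    thus ?thesis unfolding U_def uncovered_def by (simp add: of_bool_def sum.If_cases Int_def)
  qed
  have "n * exp (- q * \<Delta>) * (\<Sum>E\<in>?G. exp (- \<theta> * U E)) = (\<Sum>v<n. exp (- q * \<Delta>) * (\<Sum>E\<in>?G. exp (- \<theta> * U E)))"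
    by simp
  also have "\<dots> \<le> (\<Sum>v<n. \<Sum>E\<in>?G. of_bool (nbrs E v \<inter> \<tau> = {}) * exp (- \<theta> * U E))"
    unfolding U_def q_def using uncovered_vertex_moment[OF \<tau> _ D \<theta> n] by (intro sum_mono) auto
  also have "\<dots> = (\<Sum>E\<in>?G. \<Sum>v<n. of_bool (nbrs E v \<inter> \<tau> = {}) * exp (- \<theta> * U E))" by (rule sum.swap)
  also have "\<dots> = (\<Sum>E\<in>?G. U E * exp (- \<theta> * U E))" by (simp only: U sum_distrib_right)
  finally show ?thesis .
qed

subsection \<open>Tail bounds\<close>

text \<open>The term \<open>(exp (4 * \<theta>) - 1) / 4\<close> is the integral of the factor
  \<open>exp (4 * \<theta>)\<close> in the differential inequality; the bound is of Poisson
  type.\<close>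

lemma arcs_upper_tail:
  assumes S: "S \<subseteq> {..<n}" and T: "T \<subseteq> {..<n}" and D: "\<Delta> \<ge> 1" and \<theta>: "\<theta> \<ge> 0" and n: "n > 6 * \<Delta>"
  shows "real (card {E\<in>regular_graphs n \<Delta>. a \<le> real (arcs_between E S T)}) \<le>
    card (regular_graphs n \<Delta>) *
    exp (real (card S) * card T * \<Delta> / (real n - 6 * \<Delta>) * (exp (4 * \<theta>) - 1) / 4 - \<theta> * a)"
proof -
  define \<mu> where "\<mu> = real (card S) * card T * \<Delta> / (real n - 6 * \<Delta>)"
  let ?f = "\<lambda>E. real (arcs_between E S T)"
  have r: "real n * \<Delta> - 6 * \<Delta>\<^sup>2 = (real n - 6 * \<Delta>) * \<Delta>" by (simp add: power2_eq_square algebra_simps)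
  have rpos: "real n * \<Delta> - 6 * \<Delta>\<^sup>2 > 0" unfolding r using n D by (intro mult_pos_pos) auto
  have "(\<Sum>E\<in>regular_graphs n \<Delta>. exp (\<theta> * ?f E)) \<le>
      card (regular_graphs n \<Delta>) * exp (\<mu> * (exp (4 * \<theta>) - 1) / 4)"
  proof (rule exp_moment_bound[where \<phi>' = "\<lambda>\<theta>. \<mu> * exp (4 * \<theta>)"])
    fix t :: real assume t: "0 \<le> t"
    show "((\<lambda>\<theta>. \<mu> * (exp (4 * \<theta>) - 1) / 4) has_real_derivative \<mu> * exp (4 * t)) (at t)"
      by (auto intro!: derivative_eq_intros)
    have "(\<Sum>E\<in>regular_graphs n \<Delta>. ?f E * exp (t * ?f E)) \<le>
      ((real (card S) * card T * \<Delta>\<^sup>2) * exp (4 * t) * (\<Sum>E\<in>regular_graphs n \<Delta>. exp (t * ?f E))) /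
      (real n * \<Delta> - 6 * \<Delta>\<^sup>2)"
      using arcs_moment_upper[OF S T D t] rpos by (simp add: pos_le_divide_eq mult.commute)
    also have "\<dots> = \<mu> * exp (4 * t) * (\<Sum>E\<in>regular_graphs n \<Delta>. exp (t * ?f E))"
      unfolding r \<mu>_def using D by (simp add: power2_eq_square)
    finally show "(\<Sum>E\<in>regular_graphs n \<Delta>. ?f E * exp (t * ?f E)) \<le>
      \<mu> * exp (4 * t) * (\<Sum>E\<in>regular_graphs n \<Delta>. exp (t * ?f E))" .
  qed (use \<theta> in auto)
  from chernoff_card[OF finite_regular_graphs \<theta> this, of a] show ?thesis by (simp add: \<mu>_def)
qed

text \<open>The correction \<open>4 * \<Delta>^2\<close> to the mean is the error
  \<open>4 * n * \<Delta>^3\<close> of the reverse count divided by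
  \<open>n * \<Delta>\<close>.\<close>

lemma arcs_lower_tail:
  assumes S: "S \<subseteq> {..<n}" and T: "T \<subseteq> {..<n}" and D: "\<Delta> \<ge> 1" and \<theta>: "\<theta> \<ge> 0" and n: "n > 0"
  shows "real (card {E\<in>regular_graphs n \<Delta>. real (arcs_between E S T) \<le> a}) \<le>
    card (regular_graphs n \<Delta>) *
    exp (\<theta> * a - (real (card S) * card T * \<Delta> / n - 4 * \<Delta>\<^sup>2) * (1 - exp (- (4 * \<theta>))) / 4)"
proof -
  define \<mu> where "\<mu> = real (card S) * card T * \<Delta> / n - 4 * \<Delta>\<^sup>2"
  let ?f = "\<lambda>E. - real (arcs_between E S T)"
  have rpos: "real n * \<Delta> > 0" using n D by simp
  have r: "real (card S) * card T * \<Delta>\<^sup>2 - 4 * n * \<Delta> ^ 3 = \<mu> * (real n * \<Delta>)"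
    using n by (simp add: \<mu>_def power2_eq_square power3_eq_cube field_simps)
  have "(\<Sum>E\<in>regular_graphs n \<Delta>. exp (\<theta> * ?f E)) \<le>
      card (regular_graphs n \<Delta>) * exp (- \<mu> * (1 - exp (- (4 * \<theta>))) / 4)"
  proof (rule exp_moment_bound[where \<phi>' = "\<lambda>\<theta>. - \<mu> * exp (- (4 * \<theta>))"])
    fix t :: real assume t: "0 \<le> t"
    show "((\<lambda>\<theta>. - \<mu> * (1 - exp (- (4 * \<theta>))) / 4) has_real_derivative - \<mu> * exp (- (4 * t))) (at t)"
      by (auto intro!: derivative_eq_intros)
    have "(real n * \<Delta>) * (\<mu> * exp (- (4 * t)) * (\<Sum>E\<in>regular_graphs n \<Delta>. exp (t * ?f E)))
      \<le> (real n * \<Delta>) * (\<Sum>E\<in>regular_graphs n \<Delta>. - ?f E * exp (t * ?f E))"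
      using arcs_moment_lower[OF S T D t]
      by (simp only: of_nat_power of_nat_mult of_nat_numeral r[simplified of_nat_power of_nat_mult of_nat_numeral])
         (simp add: mult_ac)
    hence "\<mu> * exp (- (4 * t)) * (\<Sum>E\<in>regular_graphs n \<Delta>. exp (t * ?f E))
      \<le> (\<Sum>E\<in>regular_graphs n \<Delta>. - ?f E * exp (t * ?f E))"
      using rpos by (subst (asm) mult_le_cancel_left) auto
    thus "(\<Sum>E\<in>regular_graphs n \<Delta>. ?f E * exp (t * ?f E)) \<le>
      - \<mu> * exp (- (4 * t)) * (\<Sum>E\<in>regular_graphs n \<Delta>. exp (t * ?f E))"
      by (simp add: sum_negf)
  qed (use \<theta> in auto)
  from chernoff_card[OF finite_regular_graphs \<theta> this, of "- a"]
  have "real (card {E\<in>regular_graphs n \<Delta>. - a \<le> ?f E}) \<le> card (regular_graphs n \<Delta>) *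
    exp (- \<mu> * (1 - exp (- (4 * \<theta>))) / 4 - \<theta> * - a)" .
  also have "- \<mu> * (1 - exp (- (4 * \<theta>))) / 4 - \<theta> * - a = \<theta> * a - \<mu> * (1 - exp (- (4 * \<theta>))) / 4"
    by simp
  finally show ?thesis by (simp only: \<mu>_def neg_le_iff_le of_nat_mult of_nat_numeral of_nat_power)
qed

lemma uncovered_tail:
  assumes \<tau>: "\<tau> \<subseteq> {..<n}" and D: "\<Delta> \<ge> 1" and \<theta>: "\<theta> \<ge> 0" and n: "real n > card \<tau> + 6 * \<Delta>"
  defines "q \<equiv> exp (4 * \<theta>) * card \<tau> / (real n - card \<tau> - 6 * \<Delta>)"
  shows "real (card {E\<in>regular_graphs n \<Delta>. real (uncovered n E \<tau>) \<le> a}) \<le>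
    card (regular_graphs n \<Delta>) * exp (\<theta> * a - \<theta> * (n * exp (- q * \<Delta>)))"
proof -
  let ?f = "\<lambda>E. - real (uncovered n E \<tau>)"
  have "(\<Sum>E\<in>regular_graphs n \<Delta>. exp (\<theta> * ?f E)) \<le>
      card (regular_graphs n \<Delta>) * exp (- (n * exp (- q * \<Delta>)) * \<theta>)"
  \<comment> \<open>The odds grow with the parameter, so their value \<open>q\<close> at the end
    point \<open>\<theta>\<close> is valid on the whole interval and a linear \<open>\<phi>\<close>
    suffices.\<close>
  proof (rule exp_moment_bound[where \<phi>' = "\<lambda>\<theta>. - (n * exp (- q * \<Delta>))"])
    fix t :: real assume t: "0 \<le> t" "t \<le> \<theta>"
    let ?q = "exp (4 * t) * card \<tau> / (real n - card \<tau> - 6 * \<Delta>)"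
    show "((\<lambda>\<theta>. - (n * exp (- q * \<Delta>)) * \<theta>) has_real_derivative - (n * exp (- q * \<Delta>))) (at t)"
      by (auto intro!: derivative_eq_intros)
    have "?q \<le> q" unfolding q_def of_nat_mult of_nat_numeral using t n by (intro divide_right_mono mult_right_mono) auto
    hence "?q * \<Delta> \<le> q * \<Delta>" by (rule mult_right_mono) simp
    hence "exp (- q * \<Delta>) \<le> exp (- ?q * \<Delta>)" by (simp only: exp_le_cancel_iff mult_minus_left neg_le_iff_le)
    hence "n * exp (- q * \<Delta>) \<le> n * exp (- ?q * \<Delta>)" by (rule mult_left_mono) simp
    hence "n * exp (- q * \<Delta>) * (\<Sum>E\<in>regular_graphs n \<Delta>. exp (t * ?f E)) \<le>
      n * exp (- ?q * \<Delta>) * (\<Sum>E\<in>regular_graphs n \<Delta>. exp (t * ?f E))"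
      by (rule mult_right_mono) (auto intro: sum_nonneg)
    also have "\<dots> \<le> (\<Sum>E\<in>regular_graphs n \<Delta>. - ?f E * exp (t * ?f E))"
      using uncovered_moment[OF \<tau> D t(1) n] by simp
    finally show "(\<Sum>E\<in>regular_graphs n \<Delta>. ?f E * exp (t * ?f E)) \<le>
      - (n * exp (- q * \<Delta>)) * (\<Sum>E\<in>regular_graphs n \<Delta>. exp (t * ?f E))"
      by (simp add: sum_negf)
  qed (use \<theta> in auto)
  from chernoff_card[OF finite_regular_graphs \<theta> this, of "- a"] show ?thesis
    by (simp add: algebra_simps)
qed

section \<open>From discrepancy to quadratic forms\<close>

lemma abs_sum_digits:
  fixes a :: nat
  shows "(\<Sum>j<B. 2 ^ j * ((a div 2 ^ j) mod 2)) = a mod 2 ^ B"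
proof (induction B)
  case (Suc B)
  have "a mod 2 ^ Suc B = 2 ^ B * ((a div 2 ^ B) mod 2) + a mod 2 ^ B"
    by (simp only: power_Suc2 mod_mult2_eq)
  thus ?case using Suc by simp
qed simp

text \<open>The binary digit of the absolute value, carrying the sign of the number. An integer
  vector thus becomes a combination of vectors with entries -1, 0 and 1, to which set discrepancy
  applies.\<close>

definition digit :: "int \<Rightarrow> nat \<Rightarrow> real" where
  "digit a j = sgn (real_of_int a) * real ((nat \<bar>a\<bar> div 2 ^ j) mod 2)"

lemma digit_range: "digit a j \<in> {-1, 0, 1}"
proof -
  have "(nat \<bar>a\<bar> div 2 ^ j) mod 2 = 0 \<or> (nat \<bar>a\<bar> div 2 ^ j) mod 2 = 1" by presburger
  thus ?thesis by (auto simp: digit_def sgn_if)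
qed

lemma digit_partial_sum:
  "(\<Sum>j<B. 2 ^ j * digit a j) = sgn (real_of_int a) * real (nat \<bar>a\<bar> mod 2 ^ B)"
proof -
  have "real (nat \<bar>a\<bar> mod 2 ^ B) = (\<Sum>j<B. 2 ^ j * real ((nat \<bar>a\<bar> div 2 ^ j) mod 2))"
    by (subst abs_sum_digits[symmetric]) simp
  thus ?thesis by (simp add: digit_def sum_distrib_left mult_ac)
qed

lemma digit_sum:
  assumes "\<bar>a\<bar> < 2 ^ B"
  shows "(\<Sum>j<B. 2 ^ j * digit a j) = real_of_int a"
proof -
  have "nat \<bar>a\<bar> < 2 ^ B" using assms by (simp add: nat_less_iff)
  thus ?thesis by (auto simp: digit_partial_sum sgn_if)
qed

lemma digit_partial_sum_abs: "\<bar>\<Sum>j<B. 2 ^ j * digit a j\<bar> \<le> 2 ^ B"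
proof -
  have "real (nat \<bar>a\<bar> mod 2 ^ B) \<le> real (2 ^ B)" by (intro of_nat_mono) (simp add: less_imp_le)
  thus ?thesis by (auto simp: digit_partial_sum abs_mult sgn_if)
qed

text \<open>All digits of one number share its sign, so the cross terms in the square of the digit
  expansion are nonnegative.\<close>

lemma digit_sum_squares:
  assumes "\<bar>a\<bar> < 2 ^ B"
  shows "(\<Sum>j<B. 4 ^ j * \<bar>digit a j\<bar>) \<le> (real_of_int a)\<^sup>2"
proof -
  have "(\<Sum>j<B. 4 ^ j * \<bar>digit a j\<bar>) = (\<Sum>j<B. (2 ^ j * \<bar>digit a j\<bar>)\<^sup>2)"
  proof (intro sum.cong refl)
    fix j
    show "4 ^ j * \<bar>digit a j\<bar> = (2 ^ j * \<bar>digit a j\<bar>)\<^sup>2"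
      using digit_range[of a j] by (auto simp: power_mult_distrib power_mult[symmetric] mult.commute[of j 2])
         (simp_all add: power_mult)
  qed
  also have "\<dots> \<le> (\<Sum>j<B. 2 ^ j * \<bar>digit a j\<bar>)\<^sup>2"
  proof (induction B)
    case (Suc B)
    have "0 \<le> (\<Sum>j<B. 2 ^ j * \<bar>digit a j\<bar>) * (2 ^ B * \<bar>digit a B\<bar>)" by (intro mult_nonneg_nonneg sum_nonneg) auto
    thus ?case using Suc by (simp add: power2_sum)
  qed simp
  also have "(\<Sum>j<B. 2 ^ j * \<bar>digit a j\<bar>) = \<bar>\<Sum>j<B. 2 ^ j * digit a j\<bar>"
    by (cases "a \<ge> 0")
       (auto simp: digit_def sgn_if abs_mult sum_negf sum_nonneg)
  also have "\<bar>\<Sum>j<B. 2 ^ j * digit a j\<bar>\<^sup>2 = (real_of_int a)\<^sup>2"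
    by (simp only: digit_sum[OF assms] power2_abs)
  finally show ?thesis .
qed

definition bform :: "'a set \<Rightarrow> ('a \<Rightarrow> 'a \<Rightarrow> real) \<Rightarrow> ('a \<Rightarrow> real) \<Rightarrow> ('a \<Rightarrow> real) \<Rightarrow> real" where
  "bform V M x y = (\<Sum>u\<in>V. \<Sum>v\<in>V. M u v * x u * y v)"

context
  fixes V :: "'a set" and M :: "'a \<Rightarrow> 'a \<Rightarrow> real" and A b :: real and g :: nat
  assumes fin: "finite V"
    and sym: "\<And>u v. M u v = M v u"
    and row: "\<And>u. u \<in> V \<Longrightarrow> (\<Sum>v\<in>V. \<bar>M u v\<bar>) \<le> b"
    and disc: "\<And>S T. S \<subseteq> V \<Longrightarrow> T \<subseteq> V \<Longrightarrow> \<bar>\<Sum>u\<in>S. \<Sum>v\<in>T. M u v\<bar> \<le> A * sqrt (real (card S) * card T)"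
    and A: "A \<ge> 0"
begin

lemma bform_sum_left: "bform V M (\<lambda>u. \<Sum>i\<in>I. c i * x i u) y = (\<Sum>i\<in>I. c i * bform V M (x i) y)"
proof -
  have "bform V M (\<lambda>u. \<Sum>i\<in>I. c i * x i u) y = (\<Sum>u\<in>V. \<Sum>v\<in>V. \<Sum>i\<in>I. c i * (M u v * x i u * y v))"
    unfolding bform_def by (intro sum.cong refl) (simp add: sum_distrib_left sum_distrib_right mult_ac)
  also have "\<dots> = (\<Sum>u\<in>V. \<Sum>i\<in>I. \<Sum>v\<in>V. c i * (M u v * x i u * y v))"
    by (intro sum.cong refl sum.swap)
  also have "\<dots> = (\<Sum>i\<in>I. \<Sum>u\<in>V. \<Sum>v\<in>V. c i * (M u v * x i u * y v))" by (rule sum.swap)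
  finally show ?thesis by (simp add: bform_def sum_distrib_left)
qed

lemma bform_commute: "bform V M x y = bform V M y x"
  unfolding bform_def by (subst sum.swap) (simp add: sym mult_ac)

lemma bform_sum_right: "bform V M y (\<lambda>u. \<Sum>i\<in>I. c i * x i u) = (\<Sum>i\<in>I. c i * bform V M y (x i))"
  by (simp only: bform_commute[of y] bform_sum_left)

text \<open>Four uses of the discrepancy bound, on the sets where \<open>x\<close> and
  \<open>y\<close> equal 1 or -1; the factor 2 arises from
  \<open>sqrt p + sqrt q \<le> sqrt (2 * (p + q))\<close>, once for each vector.\<close>

lemma bform_sign:
  assumes x: "\<And>u. x u \<in> {-1, 0, 1}" and y: "\<And>u. y u \<in> {-1, 0, 1}"
  shows "\<bar>bform V M x y\<bar> \<le> 2 * A * sqrt ((\<Sum>u\<in>V. \<bar>x u\<bar>) * (\<Sum>u\<in>V. \<bar>y u\<bar>))"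
proof -
  define P where "P z c = {u\<in>V. z u = c}" for z :: "'a \<Rightarrow> real" and c
  have split: "(\<Sum>u\<in>V. z u * f u) = (\<Sum>u\<in>P z 1. f u) - (\<Sum>u\<in>P z (-1). f u)"
    if z: "\<And>u. z u \<in> {-1, 0, 1}" for z f
  proof -
    have "(\<Sum>u\<in>V. z u * f u) = (\<Sum>u\<in>V. (if z u = 1 then f u else 0) - (if z u = -1 then f u else 0))"
      by (intro sum.cong refl) (use z in force)
    thus ?thesis using fin by (simp add: sum_subtractf P_def sum.inter_filter)
  qed
  have card: "(\<Sum>u\<in>V. \<bar>z u\<bar>) = real (card (P z 1)) + card (P z (-1))"
    if z: "\<And>u. z u \<in> {-1, 0, 1}" for z
  proof -
    have "(\<Sum>u\<in>V. \<bar>z u\<bar>) = (\<Sum>u\<in>V. (if z u = 1 then 1 else 0) + (if z u = -1 then 1 else 0))"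
      by (intro sum.cong refl) (use z in force)
    also have "\<dots> = (\<Sum>u\<in>P z 1. 1) + (\<Sum>u\<in>P z (-1). 1)"
      using fin unfolding sum.distrib P_def by (simp only: sum.inter_filter)
    finally show ?thesis by simp
  qed
  define m where "m S T = (\<Sum>u\<in>S. \<Sum>v\<in>T. M u v)" for S T
  have "bform V M x y = (\<Sum>u\<in>V. x u * (\<Sum>v\<in>V. y v * M u v))"
    unfolding bform_def by (simp add: sum_distrib_left mult_ac)
  also have "\<dots> = m (P x 1) (P y 1) - m (P x 1) (P y (-1)) - m (P x (-1)) (P y 1) + m (P x (-1)) (P y (-1))"
    unfolding split[OF x] split[OF y] m_def sum_subtractf by simp
  finally have eq: "bform V M x y = m (P x 1) (P y 1) - m (P x 1) (P y (-1)) - m (P x (-1)) (P y 1) + m (P x (-1)) (P y (-1))" .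
  define s where "s z c = sqrt (real (card (P z c)))" for z c
  have m_le: "\<bar>m (P x c) (P y d)\<bar> \<le> A * (s x c * s y d)" for c d
    using disc[of "P x c" "P y d"] unfolding m_def s_def by (simp add: P_def real_sqrt_mult)
  have "\<bar>bform V M x y\<bar> \<le> A * (s x 1 * s y 1) + A * (s x 1 * s y (-1)) + A * (s x (-1) * s y 1) + A * (s x (-1) * s y (-1))"
    unfolding eq using m_le[of 1 1] m_le[of 1 "-1"] m_le[of "-1" 1] m_le[of "-1" "-1"] by linarith
  also have "\<dots> = A * ((s x 1 + s x (-1)) * (s y 1 + s y (-1)))" by (simp add: algebra_simps)
  also have "\<dots> \<le> A * ((sqrt 2 * sqrt (\<Sum>u\<in>V. \<bar>x u\<bar>)) * (sqrt 2 * sqrt (\<Sum>u\<in>V. \<bar>y u\<bar>)))"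
  proof -
    have s2: "s z 1 + s z (-1) \<le> sqrt 2 * sqrt (\<Sum>u\<in>V. \<bar>z u\<bar>)" if z: "\<And>u. z u \<in> {-1, 0, 1}" for z
    proof -
      have "(s z 1 + s z (-1))\<^sup>2 \<le> 2 * ((s z 1)\<^sup>2 + (s z (-1))\<^sup>2)"
        using zero_le_power2[of "s z 1 - s z (-1)"] by (simp add: power2_eq_square algebra_simps)
      also have "\<dots> = 2 * (\<Sum>u\<in>V. \<bar>z u\<bar>)" unfolding card[OF z] s_def by simp
      finally show ?thesis unfolding real_sqrt_mult[symmetric] by (rule real_le_rsqrt)
    qed
    show ?thesis using s2[OF x] s2[OF y] A
      by (intro mult_left_mono mult_mono) (auto simp: s_def sum_nonneg)
  qed
  also have "\<dots> = 2 * A * sqrt ((\<Sum>u\<in>V. \<bar>x u\<bar>) * (\<Sum>u\<in>V. \<bar>y u\<bar>))" by (simp add: real_sqrt_mult)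
  finally show ?thesis .
qed

lemma bform_sup:
  assumes "\<And>u. \<bar>y u\<bar> \<le> c"
  shows "\<bar>bform V M x y\<bar> \<le> b * c * (\<Sum>u\<in>V. \<bar>x u\<bar>)"
proof -
  have "\<bar>bform V M x y\<bar> \<le> (\<Sum>u\<in>V. \<Sum>v\<in>V. \<bar>M u v * x u * y v\<bar>)"
    unfolding bform_def by (rule order_trans[OF sum_abs sum_mono[OF sum_abs]])
  also have "\<dots> \<le> (\<Sum>u\<in>V. \<Sum>v\<in>V. \<bar>M u v\<bar> * (\<bar>x u\<bar> * c))"
    using assms by (intro sum_mono) (simp add: abs_mult mult_left_mono mult.assoc)
  also have "\<dots> = (\<Sum>u\<in>V. (\<Sum>v\<in>V. \<bar>M u v\<bar>) * (\<bar>x u\<bar> * c))" by (simp add: sum_distrib_right)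
  also have "\<dots> \<le> (\<Sum>u\<in>V. b * (\<bar>x u\<bar> * c))"
  proof (intro sum_mono mult_right_mono row)
    fix u show "0 \<le> \<bar>x u\<bar> * c" using assms[of u] by (intro mult_nonneg_nonneg) auto
  qed
  also have "\<dots> = b * c * (\<Sum>u\<in>V. \<bar>x u\<bar>)" by (simp add: sum_distrib_left mult_ac)
  finally show ?thesis .
qed

text \<open>Two scales at distance at most \<open>g\<close> are handled by discrepancy, and each
  scale has at most \<open>2 * g + 1\<close> such partners. For distant scales the lower digits are
  summed first into one vector with entries at most \<open>2 ^ (i - g)\<close>, and row sums
  suffice. A \<open>g\<close> logarithmic in \<open>b\<close> makes the second contribution
  harmless.\<close>

lemma bform_int_bound:
  fixes m :: "'a \<Rightarrow> int"
  shows "\<bar>bform V M (\<lambda>u. real_of_int (m u)) (\<lambda>u. real_of_int (m u))\<bar> \<le>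
    (2 * A * (2 * g + 1) + 2 * b / 2 ^ g) * (\<Sum>u\<in>V. (real_of_int (m u))\<^sup>2)"
proof -
  obtain B where B: "\<And>u. u \<in> V \<Longrightarrow> \<bar>m u\<bar> < 2 ^ B"
  proof -
    define K where "K = (\<Sum>u\<in>V. \<bar>m u\<bar>)"
    have "\<bar>m u\<bar> \<le> K" if "u \<in> V" for u unfolding K_def using fin that by (intro member_le_sum) auto
    moreover have "K < 2 ^ nat K"
    proof -
      have "K \<ge> 0" unfolding K_def by (intro sum_nonneg) auto
      have "int (nat K) < int (2 ^ nat K)" by (simp only: of_nat_less_iff) (rule less_exp)
      thus ?thesis using \<open>K \<ge> 0\<close> by simp
    qed
    ultimately show ?thesis using that[of "nat K"] by force
  qed
  define s where "s j u = digit (m u) j" for j u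
  define N where "N j = (\<Sum>u\<in>V. \<bar>s j u\<bar>)" for j
  define x where "x u = real_of_int (m u)" for u
  have s01: "s j u \<in> {-1, 0, 1}" for j u unfolding s_def by (rule digit_range)
  have N0: "N j \<ge> 0" for j unfolding N_def by (intro sum_nonneg) auto
  have xs: "bform V M x x = bform V M (\<lambda>u. \<Sum>i<B. 2 ^ i * s i u) (\<lambda>u. \<Sum>i<B. 2 ^ i * s i u)"
    unfolding bform_def x_def s_def by (intro sum.cong refl) (simp add: digit_sum[OF B])
  have q: "(\<Sum>j<B. 4 ^ j * N j) \<le> (\<Sum>u\<in>V. (x u)\<^sup>2)" (is "?Q \<le> ?X")
  proof -
    have "(\<Sum>j<B. 4 ^ j * N j) = (\<Sum>u\<in>V. \<Sum>j<B. 4 ^ j * \<bar>s j u\<bar>)"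
      unfolding N_def sum_distrib_left by (rule sum.swap)
    also have "\<dots> \<le> ?X" unfolding s_def x_def by (intro sum_mono digit_sum_squares B)
    finally show ?thesis .
  qed
  define near where "near i = {j. j < B \<and> i \<le> j + g \<and> j \<le> i + g}" for i
  define F where "F i j = 2 ^ i * (2 ^ j * bform V M (s i) (s j))" for i j
  have decomp: "bform V M x x = (\<Sum>i<B. \<Sum>j\<in>near i. F i j) + 2 * (\<Sum>i<B. \<Sum>j<i - g. F i j)"
  proof -
    have far: "(\<Sum>i<B. \<Sum>j\<in>{j. j < B \<and> i + g < j}. F i j) = (\<Sum>i<B. \<Sum>j<i - g. F i j)"
    proof -
      have "(\<Sum>i<B. \<Sum>j\<in>{j. j < B \<and> i + g < j}. F i j) = (\<Sum>i\<in>{..<B}. \<Sum>j\<in>{j\<in>{..<B}. i + g < j}. F i j)"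
        by (intro sum.cong) auto
      also have "\<dots> = (\<Sum>j\<in>{..<B}. \<Sum>i\<in>{i\<in>{..<B}. i + g < j}. F i j)" by (rule sum.swap_restrict) auto
      also have "\<dots> = (\<Sum>j<B. \<Sum>i<j - g. F j i)"
      proof (intro sum.cong)
        fix j assume "j \<in> {..<B}"
        thus "{i\<in>{..<B}. i + g < j} = {..<j - g}" by auto
        fix i show "F i j = F j i" unfolding F_def by (simp add: bform_commute[of "s i"] mult_ac)
      qed simp
      finally show ?thesis .
    qed
    have "bform V M x x = (\<Sum>i<B. \<Sum>j<B. F i j)"
      unfolding xs bform_sum_left bform_sum_right F_def sum_distrib_left ..
    also have "\<dots> = (\<Sum>i<B. (\<Sum>j\<in>near i. F i j) + (\<Sum>j<i - g. F i j) + (\<Sum>j\<in>{j. j < B \<and> i + g < j}. F i j))"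
    proof (intro sum.cong refl)
      fix i assume i: "i \<in> {..<B}"
      have un: "{..<B} = (near i \<union> {..<i - g}) \<union> {j. j < B \<and> i + g < j}"
        using i by (auto simp: near_def)
      have "(\<Sum>j<B. F i j) = (\<Sum>j\<in>near i \<union> {..<i - g}. F i j) + (\<Sum>j\<in>{j. j < B \<and> i + g < j}. F i j)"
        unfolding un by (rule sum.union_disjoint) (auto simp: near_def)
      also have "(\<Sum>j\<in>near i \<union> {..<i - g}. F i j) = (\<Sum>j\<in>near i. F i j) + (\<Sum>j<i - g. F i j)"
        by (rule sum.union_disjoint) (auto simp: near_def)
      finally show "(\<Sum>j<B. F i j) = (\<Sum>j\<in>near i. F i j) + (\<Sum>j<i - g. F i j) + (\<Sum>j\<in>{j. j < B \<and> i + g < j}. F i j)" .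
    qed
    also have "\<dots> = (\<Sum>i<B. \<Sum>j\<in>near i. F i j) + (\<Sum>i<B. \<Sum>j<i - g. F i j) + (\<Sum>i<B. \<Sum>j<i - g. F i j)"
      by (simp only: sum.distrib far)
    finally show ?thesis by simp
  qed
  have fn: "finite (near i)" for i by (simp add: near_def)
  have card_near: "real (card (near i)) \<le> 2 * g + 1" for i
  proof -
    have "card (near i) \<le> card {i - g..i + g}" by (rule card_mono) (auto simp: near_def)
    thus ?thesis by simp
  qed
  \<comment> \<open>The inequality of arithmetic and geometric means splits the product between the
    two scales, so each scale is charged once per near partner.\<close>
  have F_near: "\<bar>F i j\<bar> \<le> A * (4 ^ i * N i) + A * (4 ^ j * N j)" for i j
  proof -
    define p where "p i = 2 ^ i * sqrt (N i)" for i
    have p2: "(p i)\<^sup>2 = 4 ^ i * N i" for i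
      using N0[of i] unfolding p_def by (simp add: power_mult_distrib power_mult[symmetric] mult.commute[of i 2])
        (simp add: power_mult)
    have "\<bar>F i j\<bar> = 2 ^ i * 2 ^ j * \<bar>bform V M (s i) (s j)\<bar>" by (simp add: F_def abs_mult)
    also have "\<dots> \<le> 2 ^ i * 2 ^ j * (2 * A * sqrt (N i * N j))"
      unfolding N_def using bform_sign[OF s01 s01] by (intro mult_left_mono) auto
    also have "\<dots> = A * (2 * p i * p j)" by (simp add: p_def real_sqrt_mult)
    also have "\<dots> \<le> A * ((p i)\<^sup>2 + (p j)\<^sup>2)" using sum_squares_bound[of "p i" "p j"] A by (intro mult_left_mono) auto
    finally show ?thesis by (simp add: p2 algebra_simps)
  qed
  have near_bound: "\<bar>\<Sum>i<B. \<Sum>j\<in>near i. F i j\<bar> \<le> 2 * A * (2 * g + 1) * ?Q"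
  proof -
    have "\<bar>\<Sum>i<B. \<Sum>j\<in>near i. F i j\<bar> \<le> (\<Sum>i<B. \<Sum>j\<in>near i. \<bar>F i j\<bar>)"
      by (rule order_trans[OF sum_abs sum_mono[OF sum_abs]])
    also have "\<dots> \<le> (\<Sum>i<B. \<Sum>j\<in>near i. A * (4 ^ i * N i) + A * (4 ^ j * N j))"
      by (intro sum_mono F_near)
    also have "\<dots> = (\<Sum>i<B. \<Sum>j\<in>near i. A * (4 ^ i * N i)) + (\<Sum>i<B. \<Sum>j\<in>near i. A * (4 ^ j * N j))"
      by (simp add: sum.distrib)
    also have "(\<Sum>i<B. \<Sum>j\<in>near i. A * (4 ^ j * N j)) = (\<Sum>i<B. \<Sum>j\<in>near i. A * (4 ^ i * N i))"
    proof -
      have "(\<Sum>i<B. \<Sum>j\<in>near i. A * (4 ^ j * N j)) =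
          (\<Sum>i\<in>{..<B}. \<Sum>j\<in>{j\<in>{..<B}. i \<le> j + g \<and> j \<le> i + g}. A * (4 ^ j * N j))"
        unfolding near_def by (intro sum.cong) auto
      also have "\<dots> = (\<Sum>j\<in>{..<B}. \<Sum>i\<in>{i\<in>{..<B}. i \<le> j + g \<and> j \<le> i + g}. A * (4 ^ j * N j))"
        by (rule sum.swap_restrict) auto
      also have "\<dots> = (\<Sum>i<B. \<Sum>j\<in>near i. A * (4 ^ i * N i))"
        unfolding near_def by (intro sum.cong) auto
      finally show ?thesis .
    qed
    also have "(\<Sum>i<B. \<Sum>j\<in>near i. A * (4 ^ i * N i)) + (\<Sum>i<B. \<Sum>j\<in>near i. A * (4 ^ i * N i))
        = (\<Sum>i<B. real (card (near i)) * (2 * (A * (4 ^ i * N i))))"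
      unfolding sum.distrib[symmetric] by (intro sum.cong refl) simp
    also have "\<dots> \<le> (\<Sum>i<B. (2 * g + 1) * (2 * (A * (4 ^ i * N i))))"
      using card_near A N0 by (intro sum_mono mult_right_mono) auto
    also have "\<dots> = 2 * A * (2 * g + 1) * ?Q"
      unfolding sum_distrib_left by (intro sum.cong refl) (simp only: mult_ac)
    finally show ?thesis .
  qed
  have b0: "b \<ge> 0" if ne: "V \<noteq> {}"
  proof -
    obtain u where "u \<in> V" using ne by auto
    from row[OF this] show ?thesis by (meson abs_ge_zero order_trans sum_nonneg)
  qed
  have far_bound: "\<bar>\<Sum>i<B. \<Sum>j<i - g. F i j\<bar> \<le> b / 2 ^ g * ?Q"
  proof (cases "V = {}")
    case True thus ?thesis by (simp add: F_def bform_def N_def)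
  next
    case False
    have "\<bar>\<Sum>i<B. \<Sum>j<i - g. F i j\<bar> \<le> (\<Sum>i<B. \<bar>\<Sum>j<i - g. F i j\<bar>)" by (rule sum_abs)
    also have "\<dots> \<le> (\<Sum>i<B. b / 2 ^ g * (4 ^ i * N i))"
    proof (intro sum_mono)
      fix i
      show "\<bar>\<Sum>j<i - g. F i j\<bar> \<le> b / 2 ^ g * (4 ^ i * N i)"
      proof (cases "g \<le> i")
        case True
        have "(\<Sum>j<i - g. F i j) = 2 ^ i * bform V M (s i) (\<lambda>u. \<Sum>j<i - g. 2 ^ j * s j u)"
          unfolding bform_sum_right F_def sum_distrib_left ..
        hence "\<bar>\<Sum>j<i - g. F i j\<bar> = 2 ^ i * \<bar>bform V M (s i) (\<lambda>u. \<Sum>j<i - g. 2 ^ j * s j u)\<bar>"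
          by (simp add: abs_mult)
        also have "\<dots> \<le> 2 ^ i * (b * 2 ^ (i - g) * N i)"
          unfolding N_def s_def by (intro mult_left_mono bform_sup digit_partial_sum_abs) auto
        also have "\<dots> = b / 2 ^ g * ((2 ^ i * 2 ^ i) * N i)"
          using True by (simp add: power_diff)
        also have "2 ^ i * 2 ^ i = (4 :: real) ^ i" by (simp add: power_mult_distrib[symmetric])
        finally show ?thesis .
      next
        case False
        thus ?thesis using b0 \<open>V \<noteq> {}\<close> N0[of i] by simp
      qed
    qed
    also have "\<dots> = b / 2 ^ g * ?Q" by (simp add: sum_distrib_left)
    finally show ?thesis .
  qed
  have "\<bar>bform V M x x\<bar> \<le> 2 * A * (2 * g + 1) * ?Q + 2 * (b / 2 ^ g * ?Q)"
    unfolding decomp using near_bound far_bound by linarith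
  also have "\<dots> = (2 * A * (2 * g + 1) + 2 * b / 2 ^ g) * ?Q" by (simp add: algebra_simps)
  also have "\<dots> \<le> (2 * A * (2 * g + 1) + 2 * b / 2 ^ g) * ?X"
  proof (cases "V = {}")
    case False
    thus ?thesis using q A b0 by (intro mult_left_mono) auto
  qed (simp add: N_def)
  finally show ?thesis unfolding x_def .
qed

text \<open>Both sides are continuous and homogeneous of degree 2, so approximations
  \<open>y k\<close> with a common denominator reduce the claim to integer vectors.\<close>

lemma bform_bound:
  fixes x :: "'a \<Rightarrow> real"
  shows "\<bar>bform V M x x\<bar> \<le> (2 * A * (2 * g + 1) + 2 * b / 2 ^ g) * (\<Sum>u\<in>V. (x u)\<^sup>2)"
proof -
  define y where "y k u = real_of_int \<lfloor>real (Suc k) * x u\<rfloor> / real (Suc k)" for k u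
  have lim: "(\<lambda>k. y k u) \<longlonglongrightarrow> x u" for u
  proof (rule real_tendsto_sandwich)
    show "\<forall>\<^sub>F k in sequentially. x u - 1 / real (Suc k) \<le> y k u"
    proof (intro always_eventually allI)
      fix k
      have "real (Suc k) * x u - 1 \<le> real_of_int \<lfloor>real (Suc k) * x u\<rfloor>" by linarith
      hence "(real (Suc k) * x u - 1) / real (Suc k) \<le> y k u" unfolding y_def by (intro divide_right_mono) auto
      thus "x u - 1 / real (Suc k) \<le> y k u" by (simp add: diff_divide_distrib del: of_nat_Suc)
    qed
    show "\<forall>\<^sub>F k in sequentially. y k u \<le> x u"
    proof (intro always_eventually allI)
      fix k
      have "y k u \<le> (real (Suc k) * x u) / real (Suc k)" unfolding y_def by (intro divide_right_mono) auto
      thus "y k u \<le> x u" by (simp del: of_nat_Suc)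
    qed
    have "(\<lambda>k. 1 / real (Suc k)) \<longlonglongrightarrow> 0" using LIMSEQ_inverse_real_of_nat by (simp add: inverse_eq_divide)
    from tendsto_diff[OF tendsto_const this, of "x u"]
    show "(\<lambda>k. x u - 1 / real (Suc k)) \<longlonglongrightarrow> x u" by simp
  qed simp
  have "\<bar>bform V M (y k) (y k)\<bar> \<le> (2 * A * (2 * g + 1) + 2 * b / 2 ^ g) * (\<Sum>u\<in>V. (y k u)\<^sup>2)" for k
  proof -
    let ?m = "\<lambda>u. real_of_int \<lfloor>real (Suc k) * x u\<rfloor>"
    let ?c = "inverse (real (Suc k))"
    have c: "?c > 0" by simp
    have ym: "y k u = ?c * ?m u" for u unfolding y_def by (simp only: divide_inverse mult.commute)
    have "bform V M (y k) (y k) = ?c\<^sup>2 * bform V M ?m ?m"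
      unfolding bform_def ym power2_eq_square by (simp only: sum_distrib_left mult_ac)
    hence "\<bar>bform V M (y k) (y k)\<bar> = ?c\<^sup>2 * \<bar>bform V M ?m ?m\<bar>" by (simp only: abs_mult abs_power2)
    also have "\<dots> \<le> ?c\<^sup>2 * ((2 * A * (2 * g + 1) + 2 * b / 2 ^ g) * (\<Sum>u\<in>V. (?m u)\<^sup>2))"
      by (intro mult_left_mono bform_int_bound) (rule zero_le_power2)
    also have "\<dots> = (2 * A * (2 * g + 1) + 2 * b / 2 ^ g) * (\<Sum>u\<in>V. (y k u)\<^sup>2)"
      by (simp only: ym power_mult_distrib sum_distrib_left[symmetric]) (simp only: mult_ac)
    finally show ?thesis .
  qed
  moreover have "(\<lambda>k. \<bar>bform V M (y k) (y k)\<bar>) \<longlonglongrightarrow> \<bar>bform V M x x\<bar>"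
    unfolding bform_def by (intro tendsto_intros lim)
  moreover have "(\<lambda>k. (2 * A * (2 * g + 1) + 2 * b / 2 ^ g) * (\<Sum>u\<in>V. (y k u)\<^sup>2)) \<longlonglongrightarrow>
      (2 * A * (2 * g + 1) + 2 * b / 2 ^ g) * (\<Sum>u\<in>V. (x u)\<^sup>2)"
    by (intro tendsto_intros lim)
  ultimately show ?thesis by (intro LIMSEQ_le) auto
qed

end

section \<open>Independent set slices\<close>

definition indep :: "nat \<Rightarrow> nat set set \<Rightarrow> nat set \<Rightarrow> bool" where
  "indep n E \<sigma> \<longleftrightarrow> \<sigma> \<subseteq> {..<n} \<and> (\<forall>u\<in>\<sigma>. \<forall>v\<in>\<sigma>. {u, v} \<notin> E)"

definition free_vertices :: "nat \<Rightarrow> nat set set \<Rightarrow> nat set \<Rightarrow> nat set" where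
  "free_vertices n E \<sigma> = {v. v < n \<and> v \<notin> \<sigma> \<and> (\<forall>u\<in>\<sigma>. {u, v} \<notin> E)}"

context
  fixes n \<Delta> k :: nat and E :: "nat set set" and \<Lambda> :: real
  assumes E: "E \<in> regular_graphs n \<Delta>" and k1: "k \<ge> 1" and n1: "n \<ge> 1"
    and spec: "\<And>x :: nat \<Rightarrow> real. - \<Lambda> * (\<Sum>u<n. (x u)\<^sup>2) \<le> (\<Sum>u<n. \<Sum>v<n. of_bool ({u, v} \<in> E) * x u * x v)"
    and free1: "\<And>\<sigma>. indep n E \<sigma> \<Longrightarrow> card \<sigma> + 2 \<le> k \<Longrightarrow> 2 * \<Delta> + 3 \<le> card (free_vertices n E \<sigma>)"
    and free2: "\<And>\<sigma>. indep n E \<sigma> \<Longrightarrow> card \<sigma> + 2 = k \<Longrightarrow>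
      \<Delta> + 1 + 2 * real k * (\<Lambda> - 1) \<le> card (free_vertices n E \<sigma>)"
begin

abbreviation (input) "facets \<equiv> indep_sets_of_size n E k"
abbreviation (input) "free \<equiv> free_vertices n E"

section \<open>Faces, links and connectivity of the slice\<close>

lemma facets_iff: "S \<in> facets \<longleftrightarrow> indep n E S \<and> card S = k"
  by (auto simp: indep_sets_of_size_def indep_def)

lemma facet_subset: "S \<in> facets \<Longrightarrow> S \<subseteq> {..<n}"
  and facet_card: "S \<in> facets \<Longrightarrow> card S = k"
  by (auto simp: indep_sets_of_size_def)

interpretation pure_complex facets "{..<n}" k
  by unfold_locales (auto simp: facet_subset facet_card)

lemma finite_facets: "finite facets"
  by (rule finite_subset[of _ "Pow {..<n}"]) (auto simp: indep_sets_of_size_def)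

lemma indep_mono: "indep n E \<sigma> \<Longrightarrow> \<tau> \<subseteq> \<sigma> \<Longrightarrow> indep n E \<tau>"
  by (auto simp: indep_def)

lemma indep_finite: "indep n E \<sigma> \<Longrightarrow> finite \<sigma>"
  using finite_subset by (auto simp: indep_def)

lemma no_loop: "{u} \<notin> E"
  using regular_edgeD(3)[OF E, of u u] by auto

lemma indep_insert:
  assumes "indep n E \<sigma>" "v \<notin> \<sigma>"
  shows "indep n E (insert v \<sigma>) \<longleftrightarrow> v \<in> free \<sigma>"
  using assms no_loop by (auto simp: indep_def free_vertices_def insert_commute)

lemma finite_free: "finite (free \<sigma>)"
  by (rule finite_subset[of _ "{..<n}"]) (auto simp: free_vertices_def)

text \<open>The assumptions speak only of codimension at least 2. For a nonempty set of size
  \<open>k - 1\<close>, removing a vertex \<open>w\<close> leaves at least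
  \<open>2 * \<Delta> + 3\<close> free vertices, and putting \<open>w\<close> back destroys at most
  \<open>\<Delta> + 1\<close> of them.\<close>

lemma free_nonempty:
  assumes \<sigma>: "indep n E \<sigma>" "card \<sigma> < k"
  shows "free \<sigma> \<noteq> {}"
proof (cases "card \<sigma> + 2 \<le> k")
  case True
  thus ?thesis using free1[OF \<sigma>(1)] by force
next
  case False
  hence c: "card \<sigma> + 1 = k" using \<sigma> by simp
  show ?thesis
  proof (cases "\<sigma> = {}")
    case True
    hence "0 \<in> free \<sigma>" using n1 by (simp add: free_vertices_def)
    thus ?thesis by auto
  next
    case False
    then obtain w where w: "w \<in> \<sigma>" by auto
    let ?\<sigma> = "\<sigma> - {w}"
    have "card ?\<sigma> + 2 = k" using w c indep_finite[OF \<sigma>(1)] card_gt_0_iff[of \<sigma>] by (auto simp: card_Diff_singleton)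
    hence "2 * \<Delta> + 3 \<le> card (free ?\<sigma>)" using free1[OF indep_mono[OF \<sigma>(1), of ?\<sigma>]] by auto
    moreover have "free ?\<sigma> \<subseteq> free \<sigma> \<union> (nbrs E w \<union> {w})"
      by (auto simp: free_vertices_def nbrs_def insert_commute)
    hence "card (free ?\<sigma>) \<le> card (free \<sigma> \<union> (nbrs E w \<union> {w}))"
      using finite_free finite_nbrs[OF E] by (intro card_mono) auto
    moreover have "\<dots> \<le> card (free \<sigma>) + (card (nbrs E w) + card {w})"
      by (meson card_Un_le add_le_mono le_trans order_refl)
    moreover have "card (nbrs E w) \<le> \<Delta>" by (rule card_nbrs_le[OF E])
    ultimately have "card (free \<sigma>) > 0" by simp
    thus ?thesis by auto
  qed
qed

text \<open>Greedy growth. It makes the faces exactly the independent sets of size at most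
  \<open>k\<close>, so links can be read off from free vertices.\<close>

lemma extend:
  assumes "indep n E \<sigma>" "card \<sigma> \<le> k"
  shows "\<exists>S\<in>facets. \<sigma> \<subseteq> S"
  using assms
proof (induction "k - card \<sigma>" arbitrary: \<sigma>)
  case 0
  thus ?case using facets_iff by auto
next
  case (Suc m)
  hence lt: "card \<sigma> < k" by simp
  then obtain v where v: "v \<in> free \<sigma>" using free_nonempty[OF Suc.prems(1)] by auto
  hence vs: "v \<notin> \<sigma>" by (simp add: free_vertices_def)
  have "indep n E (insert v \<sigma>)" using indep_insert[OF Suc.prems(1) vs] v by simp
  moreover have "card (insert v \<sigma>) = Suc (card \<sigma>)" using vs indep_finite[OF Suc.prems(1)] by simp
  ultimately have "\<exists>S\<in>facets. insert v \<sigma> \<subseteq> S" using Suc.hyps(1)[of "insert v \<sigma>"] Suc.hyps(2) lt by simp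
  thus ?case by auto
qed

lemma facets_nonempty: "facets \<noteq> {}"
  using extend[of "{}"] by (auto simp: indep_def)

lemma face_iff: "(\<exists>S\<in>facets. \<tau> \<subseteq> S) \<longleftrightarrow> indep n E \<tau> \<and> card \<tau> \<le> k"
proof
  assume "\<exists>S\<in>facets. \<tau> \<subseteq> S"
  then obtain S where S: "indep n E S" "card S = k" "\<tau> \<subseteq> S" using facets_iff by auto
  thus "indep n E \<tau> \<and> card \<tau> \<le> k" using indep_mono card_mono[OF indep_finite[OF S(1)] S(3)] by auto
qed (use extend in auto)

lemma Up_nonempty_iff: "Up \<tau> \<noteq> {} \<longleftrightarrow> indep n E \<tau> \<and> card \<tau> \<le> k"
  unfolding face_iff[symmetric] by (auto simp: Up_def)

lemma set_slice: "set_pmf (slice n E k) = facets"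
  unfolding slice_def using facets_nonempty finite_facets by (rule set_pmf_of_set)

lemma faces_slice: "\<tau> \<in> faces (slice n E k) \<longleftrightarrow> indep n E \<tau> \<and> card \<tau> \<le> k"
  unfolding faces_def set_slice using face_iff by simp

lemma link_vertices_slice:
  assumes "indep n E \<tau>" "card \<tau> + 1 \<le> k"
  shows "link_vertices (slice n E k) \<tau> = free \<tau>"
proof (rule Set.set_eqI)
  fix v
  show "v \<in> link_vertices (slice n E k) \<tau> \<longleftrightarrow> v \<in> free \<tau>"
  proof (cases "v \<in> \<tau>")
    case False
    thus ?thesis using assms indep_insert[OF assms(1) False] indep_finite[OF assms(1)]
      by (simp add: link_vertices_def faces_slice)
  qed (auto simp: link_vertices_def free_vertices_def)
qed

lemma indep_pair:
  assumes \<tau>: "indep n E \<tau>" and u: "u \<in> free \<tau>" and v: "v \<in> free \<tau>" "u \<noteq> v"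
  shows "indep n E (insert u (insert v \<tau>)) \<longleftrightarrow> {u, v} \<notin> E"
    and "card (insert u (insert v \<tau>)) = card \<tau> + 2"
proof -
  have nin: "u \<notin> \<tau>" "v \<notin> \<tau>" using u v by (auto simp: free_vertices_def)
  have i: "indep n E (insert v \<tau>)" using indep_insert[OF \<tau> nin(2)] v by simp
  show "indep n E (insert u (insert v \<tau>)) \<longleftrightarrow> {u, v} \<notin> E"
    using indep_insert[OF i, of u] nin u v by (auto simp: free_vertices_def insert_commute)
  show "card (insert u (insert v \<tau>)) = card \<tau> + 2" using nin v indep_finite[OF \<tau>] by simp
qed

lemma skeleton_edges_slice:
  assumes \<tau>: "indep n E \<tau>" "card \<tau> + 2 \<le> k"
  shows "(u, v) \<in> skeleton_edges (slice n E k) \<tau> \<longleftrightarrow>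
    u \<in> free \<tau> \<and> v \<in> free \<tau> \<and> u \<noteq> v \<and> {u, v} \<notin> E"
proof -
  have "link_vertices (slice n E k) \<tau> = free \<tau>" using \<tau> by (intro link_vertices_slice) auto
  moreover have "\<tau> \<union> {u, v} = insert u (insert v \<tau>)" by auto
  ultimately show ?thesis using indep_pair[OF \<tau>(1)] \<tau>(2)
    by (auto simp: skeleton_edges_def faces_slice)
qed

text \<open>Two vertices and their neighbours block at most \<open>2 * \<Delta> + 2\<close>
  vertices, one less than \<open>free1\<close> provides. Hence any two vertices of a link are joined
  by a path of length two.\<close>

lemma common_non_neighbour:
  assumes \<tau>: "indep n E \<tau>" "card \<tau> + 2 \<le> k"
  obtains w where "w \<in> free \<tau>" "w \<noteq> u" "w \<noteq> v" "{u, w} \<notin> E" "{w, v} \<notin> E"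
proof -
  let ?B = "nbrs E u \<union> nbrs E v \<union> {u, v}"
  have "card ?B \<le> card (nbrs E u) + card (nbrs E v) + card {u, v}"
    by (meson card_Un_le add_le_mono le_trans order_refl)
  also have "\<dots> \<le> \<Delta> + \<Delta> + 2" using card_nbrs_le[OF E] by (intro add_mono) (auto simp: card_insert_if)
  also have "\<dots> < card (free \<tau>)" using free1[OF \<tau>] by simp
  finally have "\<not> free \<tau> \<subseteq> ?B" using card_mono[of ?B "free \<tau>"] finite_nbrs[OF E] by auto
  then obtain w where "w \<in> free \<tau>" "w \<notin> ?B" by auto
  thus ?thesis using that[of w] by (auto simp: nbrs_def insert_commute)
qed

lemma connected_slice: "connected_complex k (slice n E k)"
  unfolding connected_complex_def
proof (intro ballI impI)
  fix \<tau> u v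
  assume "\<tau> \<in> faces (slice n E k)" and cod: "2 \<le> codim k \<tau>"
    and uv: "u \<in> link_vertices (slice n E k) \<tau>" "v \<in> link_vertices (slice n E k) \<tau>"
  hence \<tau>: "indep n E \<tau>" "card \<tau> + 2 \<le> k" by (auto simp: faces_slice codim_def)
  have uv': "u \<in> free \<tau>" "v \<in> free \<tau>" using uv \<tau> by (auto simp: link_vertices_slice)
  obtain w where w: "w \<in> free \<tau>" "w \<noteq> u" "w \<noteq> v" "{u, w} \<notin> E" "{w, v} \<notin> E"
    using common_non_neighbour[OF \<tau>] by blast
  have "(u, w) \<in> skeleton_edges (slice n E k) \<tau>" "(w, v) \<in> skeleton_edges (slice n E k) \<tau>"
    using w uv' by (auto simp: skeleton_edges_slice[OF \<tau>])
  thus "(u, v) \<in> (skeleton_edges (slice n E k) \<tau>)\<^sup>*" by (meson r_into_rtrancl rtrancl_trans)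
qed

lemma link_connected_slice:
  assumes \<tau>: "indep n E \<tau>" "card \<tau> + 2 \<le> k"
  shows "link_connected \<tau>"
  unfolding link_connected_def
proof (intro allI impI)
  fix u v assume uv: "u \<notin> \<tau>" "v \<notin> \<tau>" "Up (insert u \<tau>) \<noteq> {}" "Up (insert v \<tau>) \<noteq> {}"
  hence fr: "u \<in> free \<tau>" "v \<in> free \<tau>" using indep_insert[OF \<tau>(1)] by (auto simp: Up_nonempty_iff)
  obtain w where w: "w \<in> free \<tau>" "w \<noteq> u" "w \<noteq> v" "{u, w} \<notin> E" "{w, v} \<notin> E"
    using common_non_neighbour[OF \<tau>] by blast
  have edge: "(a, b) \<in> link_edges \<tau>" if "a \<in> free \<tau>" "b \<in> free \<tau>" "a \<noteq> b" "{a, b} \<notin> E" for a b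
  proof -
    have "\<exists>S\<in>facets. insert a (insert b \<tau>) \<subseteq> S"
      unfolding face_iff using indep_pair[OF \<tau>(1) that(1,2,3)] that(4) \<tau>(2) by simp
    thus ?thesis using that by (auto simp: link_edges_def free_vertices_def)
  qed
  have "(u, w) \<in> link_edges \<tau>" "(w, v) \<in> link_edges \<tau>" using w fr by (auto intro: edge)
  thus "(u, v) \<in> (link_edges \<tau>)\<^sup>*" by (meson r_into_rtrancl rtrancl_trans)
qed

section \<open>Codimension two: the complement of an induced subgraph\<close>

definition nonadj :: "nat \<Rightarrow> nat \<Rightarrow> real" where
  "nonadj u v = of_bool (u \<noteq> v \<and> {u, v} \<notin> E)"

lemma nonadj_commute: "nonadj u v = nonadj v u"
  by (auto simp: nonadj_def insert_commute)

context
  fixes \<tau> :: "nat set"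
  assumes \<tau>: "indep n E \<tau>" "card \<tau> + 2 = k"
begin

text \<open>In codimension 2, \<open>\<tau>\<close> with two further vertices already has
  \<open>k\<close> elements, so only that set itself can be a facet containing it.\<close>

lemma deg_pair:
  assumes "u < n" "v < n" "u \<notin> \<tau>" "v \<notin> insert u \<tau>"
  shows "deg (insert v (insert u \<tau>)) = of_bool (u \<in> free \<tau> \<and> v \<in> free \<tau>) * nonadj u v"
proof -
  let ?S = "insert v (insert u \<tau>)"
  have c: "card ?S = k" using assms \<tau> indep_finite[OF \<tau>(1)] by simp
  have "Up ?S = (if ?S \<in> facets then {?S} else {})"
  proof -
    have *: "S = ?S" if "S \<in> facets" "?S \<subseteq> S" for S
    proof -
      have "finite S" using finite_subset[OF facet_subset[OF that(1)]] by simp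
      thus ?thesis using card_subset_eq[of S ?S] that(2) c facet_card[OF that(1)] by simp
    qed
    have "Up ?S \<subseteq> {?S}"
    proof
      fix S assume "S \<in> Up ?S"
      hence "S \<in> facets" "?S \<subseteq> S" unfolding Up_def by blast+
      from *[OF this] show "S \<in> {?S}" by (simp only: singleton_iff)
    qed
    moreover have "?S \<in> Up ?S \<longleftrightarrow> ?S \<in> facets" unfolding Up_def by blast
    ultimately show ?thesis by (cases "?S \<in> facets") (simp_all only: if_True if_False, blast+)
  qed
  moreover have "?S \<in> facets \<longleftrightarrow> u \<in> free \<tau> \<and> v \<in> free \<tau> \<and> {u, v} \<notin> E"
  proof
    assume "?S \<in> facets"
    hence i: "indep n E ?S" by (simp add: facets_iff)
    hence "u \<in> free \<tau>" "v \<in> free \<tau>" using assms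
      by (auto simp: indep_def free_vertices_def)
    moreover have "{u, v} \<notin> E" using i by (auto simp: indep_def)
    ultimately show "u \<in> free \<tau> \<and> v \<in> free \<tau> \<and> {u, v} \<notin> E" by simp
  next
    assume "u \<in> free \<tau> \<and> v \<in> free \<tau> \<and> {u, v} \<notin> E"
    thus "?S \<in> facets" using indep_pair[OF \<tau>(1), of v u] assms c by (auto simp: facets_iff insert_commute)
  qed
  ultimately show ?thesis using assms by (auto simp: deg_def nonadj_def)
qed

lemma deg_vertex:
  assumes u: "u \<in> free \<tau>"
  shows "deg (insert u \<tau>) = (\<Sum>v\<in>free \<tau>. nonadj u v)"
proof -
  have un: "u < n" "u \<notin> \<tau>" using u by (auto simp: free_vertices_def)
  have "deg (insert u \<tau>) = (\<Sum>v\<in>{..<n} - insert u \<tau>. deg (insert v (insert u \<tau>)))"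
    using sum_deg[of "insert u \<tau>" 1] un \<tau> indep_finite[OF \<tau>(1)] by simp
  also have "\<dots> = (\<Sum>v\<in>{..<n} - insert u \<tau>. of_bool (v \<in> free \<tau>) * nonadj u v)"
    using un u by (intro sum.cong refl) (subst deg_pair, auto)
  also have "\<dots> = (\<Sum>v\<in>free \<tau>. of_bool (v \<in> free \<tau>) * nonadj u v)"
    using finite_free u by (intro sum.mono_neutral_cong) (auto simp: free_vertices_def nonadj_def)
  finally show ?thesis by simp
qed

lemma deg_not_free:
  assumes "u \<notin> \<tau>" "u \<notin> free \<tau>"
  shows "deg (insert u \<tau>) = 0"
proof -
  have "Up (insert u \<tau>) = {}"
    using Up_nonempty_iff[of "insert u \<tau>"] indep_insert[OF \<tau>(1) assms(1)] assms by auto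
  thus ?thesis by (simp add: deg_def)
qed

lemma deg_vertex_ge:
  assumes u: "u \<in> free \<tau>"
  shows "deg (insert u \<tau>) \<ge> real (card (free \<tau>)) - 1 - \<Delta>"
proof -
  have "free \<tau> \<subseteq> {v\<in>free \<tau>. u \<noteq> v \<and> {u, v} \<notin> E} \<union> (nbrs E u \<union> {u})"
    by (auto simp: nbrs_def insert_commute)
  hence "card (free \<tau>) \<le> card ({v\<in>free \<tau>. u \<noteq> v \<and> {u, v} \<notin> E} \<union> (nbrs E u \<union> {u}))"
    using finite_free finite_nbrs[OF E] by (intro card_mono) auto
  also have "\<dots> \<le> card {v\<in>free \<tau>. u \<noteq> v \<and> {u, v} \<notin> E} + (card (nbrs E u) + card {u})"
    by (meson card_Un_le add_le_mono le_trans order_refl)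
  finally have "card (free \<tau>) \<le> card {v\<in>free \<tau>. u \<noteq> v \<and> {u, v} \<notin> E} + \<Delta> + 1"
    using card_nbrs_le[OF E, of u] by simp
  moreover have "(\<Sum>v\<in>free \<tau>. nonadj u v) = card {v\<in>free \<tau>. u \<noteq> v \<and> {u, v} \<notin> E}"
    unfolding nonadj_def using finite_free by (simp add: of_bool_def sum.If_cases Int_def)
  ultimately show ?thesis unfolding deg_vertex[OF u] by linarith
qed

lemma Bf_slice: "Bf \<tau> h = (\<Sum>u\<in>free \<tau>. \<Sum>v\<in>free \<tau>. nonadj u v * h u * h v)"
proof -
  have "Bf \<tau> h = Bp \<tau> h h"
    unfolding Bf_def Bp_eq by (simp add: power2_eq_square)
  also have "\<dots> = (\<Sum>u\<in>{..<n} - \<tau>. \<Sum>v\<in>{..<n} - insert u \<tau>. deg (insert v (insert u \<tau>)) * h v * h u)"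
    unfolding Bp_def Mf_eq by (simp add: sum_distrib_right)
  also have "\<dots> = (\<Sum>u\<in>{..<n} - \<tau>. \<Sum>v\<in>{..<n} - insert u \<tau>. of_bool (u \<in> free \<tau> \<and> v \<in> free \<tau>) * nonadj u v * h u * h v)"
    by (intro sum.cong refl) (subst deg_pair, auto)
  also have "\<dots> = (\<Sum>u\<in>{..<n} - \<tau>. of_bool (u \<in> free \<tau>) *
      (\<Sum>v\<in>{..<n} - insert u \<tau>. of_bool (v \<in> free \<tau>) * nonadj u v * h u * h v))"
    unfolding sum_distrib_left by (intro sum.cong refl) simp
  also have "\<dots> = (\<Sum>u\<in>free \<tau>. \<Sum>v\<in>{..<n} - insert u \<tau>. of_bool (v \<in> free \<tau>) * nonadj u v * h u * h v)"
  proof -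
    have "free \<tau> \<subseteq> {..<n} - \<tau>" by (auto simp: free_vertices_def)
    thus ?thesis using finite_free by (intro sum.mono_neutral_cong) auto
  qed
  also have "\<dots> = (\<Sum>u\<in>free \<tau>. \<Sum>v\<in>free \<tau>. nonadj u v * h u * h v)"
    using finite_free by (intro sum.cong refl sum.mono_neutral_cong) (auto simp: free_vertices_def nonadj_def)
  finally show ?thesis .
qed

lemma Df_slice: "Df \<tau> h = (\<Sum>u\<in>free \<tau>. deg (insert u \<tau>) * (h u)\<^sup>2)"
  unfolding Df_eq
  using finite_free deg_not_free by (intro sum.mono_neutral_cong) (auto simp: free_vertices_def)

text \<open>The adjacency matrix of the complement is all-ones minus identity minus that of the
  graph. The first part is the square term, the rest is at most \<open>\<Lambda> - 1\<close>, and
  \<open>free2\<close> with \<open>deg_vertex_ge\<close> gives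
  \<open>\<Lambda> - 1 \<le> deg (insert u \<tau>) / (2 * k)\<close> at every free
  \<open>u\<close>.\<close>

lemma Bf_slice_le:
  "Bf \<tau> h \<le> (\<Sum>u\<in>free \<tau>. h u)\<^sup>2 + 1 / (2 * real k) * Df \<tau> h"
proof -
  let ?H = "free \<tau>"
  define x where "x u = of_bool (u \<in> ?H) * h u" for u
  have restrict: "(\<Sum>u<n. of_bool (u \<in> ?H) * f u) = (\<Sum>u\<in>?H. f u)" for f :: "nat \<Rightarrow> real"
    using finite_free by (intro sum.mono_neutral_cong) (auto simp: free_vertices_def)
  have xx: "(\<Sum>u<n. (x u)\<^sup>2) = (\<Sum>u\<in>?H. (h u)\<^sup>2)"
    unfolding restrict[symmetric] x_def by (intro sum.cong refl) auto
  have ax: "(\<Sum>u<n. \<Sum>v<n. of_bool ({u, v} \<in> E) * x u * x v) = (\<Sum>u\<in>?H. \<Sum>v\<in>?H. of_bool ({u, v} \<in> E) * h u * h v)"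
  proof -
    have "(\<Sum>u<n. \<Sum>v<n. of_bool ({u, v} \<in> E) * x u * x v) =
      (\<Sum>u<n. of_bool (u \<in> ?H) * (\<Sum>v<n. of_bool (v \<in> ?H) * (of_bool ({u, v} \<in> E) * h u * h v)))"
      unfolding x_def sum_distrib_left by (intro sum.cong refl) (simp add: mult_ac)
    thus ?thesis unfolding restrict .
  qed
  have "Bf \<tau> h = (\<Sum>u\<in>?H. \<Sum>v\<in>?H. h u * h v - (if u = v then h u * h v else 0) - of_bool ({u, v} \<in> E) * h u * h v)"
    unfolding Bf_slice nonadj_def using no_loop by (intro sum.cong refl) auto
  also have "\<dots> = (\<Sum>u\<in>?H. h u)\<^sup>2 - (\<Sum>u\<in>?H. (h u)\<^sup>2) - (\<Sum>u\<in>?H. \<Sum>v\<in>?H. of_bool ({u, v} \<in> E) * h u * h v)"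
    using finite_free by (simp add: sum_subtractf sum_product power2_eq_square)
  also have "\<dots> \<le> (\<Sum>u\<in>?H. h u)\<^sup>2 + (\<Lambda> - 1) * (\<Sum>u\<in>?H. (h u)\<^sup>2)"
    using spec[of x] unfolding xx ax by (simp add: algebra_simps)
  also have "(\<Lambda> - 1) * (\<Sum>u\<in>?H. (h u)\<^sup>2) = (\<Sum>u\<in>?H. (\<Lambda> - 1) * (h u)\<^sup>2)" by (rule sum_distrib_left)
  also have "\<dots> \<le> (\<Sum>u\<in>?H. (1 / (2 * real k) * deg (insert u \<tau>)) * (h u)\<^sup>2)"
  proof (intro sum_mono mult_right_mono)
    fix u assume u: "u \<in> ?H"
    have "2 * real k * (\<Lambda> - 1) \<le> deg (insert u \<tau>)" using free2[OF \<tau>] deg_vertex_ge[OF u] by linarith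
    thus "\<Lambda> - 1 \<le> 1 / (2 * real k) * deg (insert u \<tau>)" using k1 by (simp add: field_simps)
  qed auto
  also have "\<dots> = 1 / (2 * real k) * Df \<tau> h" unfolding Df_slice sum_distrib_left by (simp add: mult_ac)
  finally show ?thesis by simp
qed

text \<open>\<open>Mf \<tau> h = 0\<close> is a degree-weighted condition, whereas the square term
  in \<open>Bf_slice_le\<close> vanishes for unweighted sum zero. Shifting by the unweighted mean
  \<open>c\<close> adds the same \<open>2 * c^2 * deg \<tau>\<close> to \<open>Bf\<close> and to
  \<open>Df\<close>, which goes the right way because \<open>1 / (2 * k) \<le> 1\<close>.\<close>

lemma local_gap_slice: "local_gap \<tau> (1 / (2 * real k))"
  unfolding local_gap_def
proof (intro allI impI)
  fix h assume M: "Mf \<tau> h = 0"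
  define c where "c = (\<Sum>u\<in>free \<tau>. h u) / card (free \<tau>)"
  have "2 * \<Delta> + 3 \<le> card (free \<tau>)" using free1[OF \<tau>(1)] \<tau>(2) by simp
  hence s0: "(\<Sum>u\<in>free \<tau>. h u - c) = 0" by (simp add: sum_subtractf c_def)
  note sh = shift_forms[OF \<tau>(2), of h c, simplified M]
  have "Bf \<tau> h + 2 * c\<^sup>2 * deg \<tau> \<le> 1 / (2 * real k) * (Df \<tau> h + 2 * c\<^sup>2 * deg \<tau>)"
    using Bf_slice_le[of "\<lambda>u. h u - c"] unfolding s0 using sh(1,2) by simp
  moreover have "1 / (2 * real k) * (2 * c\<^sup>2 * deg \<tau>) \<le> 1 * (2 * c\<^sup>2 * deg \<tau>)"
    using k1 deg_nonneg[of \<tau>] by (intro mult_right_mono) (auto simp: field_simps)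
  ultimately show "Bf \<tau> h \<le> 1 / (2 * real k) * Df \<tau> h" by (simp only: distrib_left)
qed

lemma skeleton_weight_slice:
  "skeleton_weight (slice n E k) \<tau> u v = of_bool (u \<in> free \<tau> \<and> v \<in> free \<tau>) * nonadj u v / card (Up \<tau>)"
proof -
  have "Up \<tau> \<noteq> {}" using \<tau> by (simp add: Up_nonempty_iff)
  hence ne: "facets \<inter> {S. \<tau> \<subseteq> S} \<noteq> {}" by (auto simp: Up_def)
  have cond: "cond_pmf (slice n E k) {S. \<tau> \<subseteq> S} = pmf_of_set (Up \<tau>)"
  proof (rule pmf_eqI)
    fix S
    have ne': "set_pmf (slice n E k) \<inter> {S. \<tau> \<subseteq> S} \<noteq> {}" unfolding set_slice by (rule ne)
    have "finite (Up \<tau>)" "card facets > 0"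
      using finite_facets facets_nonempty by (simp_all add: Up_def card_gt_0_iff)
    moreover have "measure_pmf.prob (slice n E k) {S. \<tau> \<subseteq> S} = card (Up \<tau>) / card facets"
      unfolding slice_def using facets_nonempty finite_facets
      by (subst measure_pmf_of_set) (simp_all add: Up_def Int_def)
    ultimately show "pmf (cond_pmf (slice n E k) {S. \<tau> \<subseteq> S}) S = pmf (pmf_of_set (Up \<tau>)) S"
      using \<open>Up \<tau> \<noteq> {}\<close> facets_nonempty finite_facets unfolding pmf_cond[OF ne']
      by (auto simp: slice_def indicator_def Up_def)
  qed
  show ?thesis
  proof (cases "(u, v) \<in> skeleton_edges (slice n E k) \<tau>")
    case True
    hence uv: "u \<in> free \<tau>" "v \<in> free \<tau>" "u \<noteq> v" "{u, v} \<notin> E" using skeleton_edges_slice[OF \<tau>(1)] \<tau>(2) by auto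
    have "Up \<tau> \<inter> {S. u \<in> S \<and> v \<in> S} = Up (insert v (insert u \<tau>))" by (auto simp: Up_def)
    moreover have "real (card (Up (insert v (insert u \<tau>)))) = 1"
      using deg_pair[of u v] uv by (simp add: deg_def free_vertices_def nonadj_def)
    ultimately have "measure_pmf.prob (pmf_of_set (Up \<tau>)) {S. u \<in> S \<and> v \<in> S} = 1 / card (Up \<tau>)"
      using \<open>Up \<tau> \<noteq> {}\<close> finite_facets by (subst measure_pmf_of_set) (auto simp: Up_def)
    thus ?thesis using True uv by (simp add: skeleton_weight_def cond nonadj_def)
  next
    case False
    hence "\<not> (u \<in> free \<tau> \<and> v \<in> free \<tau> \<and> u \<noteq> v \<and> {u, v} \<notin> E)" using skeleton_edges_slice[OF \<tau>(1)] \<tau>(2) by auto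
    thus ?thesis using False by (auto simp: skeleton_weight_def nonadj_def)
  qed
qed

lemma link_walk_slice:
  assumes u: "u \<in> free \<tau>" and v: "v \<in> free \<tau>"
  shows "link_walk (slice n E k) \<tau> u v = nonadj u v / deg (insert u \<tau>)"
proof -
  have "Up \<tau> \<noteq> {}" using \<tau> by (simp add: Up_nonempty_iff)
  hence N: "real (card (Up \<tau>)) > 0" using finite_facets by (auto simp: card_gt_0_iff Up_def)
  have "(\<Sum>w\<in>link_vertices (slice n E k) \<tau>. skeleton_weight (slice n E k) \<tau> u w) =
      (\<Sum>w\<in>free \<tau>. nonadj u w / card (Up \<tau>))"
    using u \<tau> by (subst link_vertices_slice) (auto simp: skeleton_weight_slice)
  also have "\<dots> = deg (insert u \<tau>) / card (Up \<tau>)"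
    unfolding deg_vertex[OF u] sum_divide_distrib ..
  finally show ?thesis unfolding link_walk_def using u v N \<open>Up \<tau> \<noteq> {}\<close> by (simp add: skeleton_weight_slice)
qed

lemma second_eigenvalue_slice: "second_eigenvalue (link_walk_mat (slice n E k) \<tau>) \<le> 1 / (2 * real k)"
proof -
  define vs where "vs = sorted_list_of_set (free \<tau>)"
  define m where "m = length vs"
  have vs: "distinct vs" "set vs = free \<tau>" using finite_free by (simp_all add: vs_def)
  have m: "m = card (free \<tau>)" using vs distinct_card by (fastforce simp: m_def)
  have m3: "2 * \<Delta> + 3 \<le> m" using free1[OF \<tau>(1)] \<tau>(2) m by simp
  have bij: "bij_betw ((!) vs) {..<m} (free \<tau>)" using bij_betw_nth[OF vs(1), of "{..<m}" "free \<tau>"] vs(2) by (simp add: m_def)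
  have "link_vertices (slice n E k) \<tau> = free \<tau>" using \<tau> by (intro link_vertices_slice) auto
  hence mat: "link_walk_mat (slice n E k) \<tau> = mat m m (\<lambda>(i, j). link_walk (slice n E k) \<tau> (vs ! i) (vs ! j))"
    by (simp add: link_walk_mat_def vs_def m_def Let_def)
  have mem: "vs ! i \<in> free \<tau>" if "i < m" for i using that vs(2) nth_mem[of i vs] by (simp add: m_def)
  \<comment> \<open>The stationary weights of the walk; multiplying by them turns the walk matrix
    into the symmetric matrix \<open>nonadj\<close>.\<close>
  define \<pi> where "\<pi> i = deg (insert (vs ! i) \<tau>)" for i
  have pos: "\<pi> i > 0" if "i < m" for i
    using deg_vertex_ge[OF mem[OF that]] m3 m unfolding \<pi>_def by linarith
  have entry: "\<pi> i * link_walk_mat (slice n E k) \<tau> $$ (i, j) = nonadj (vs ! i) (vs ! j)" if "i < m" "j < m" for i j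
    using pos[OF that(1)] that unfolding mat by (simp add: link_walk_slice mem \<pi>_def)
  show ?thesis
  proof (rule second_eigenvalue_le[where m = m and \<pi> = \<pi>])
    show "link_walk_mat (slice n E k) \<tau> \<in> carrier_mat m m" by (simp add: mat)
    show "2 \<le> m" using m3 by simp
    show "0 < \<pi> i" if "i < m" for i using pos that .
    show "\<pi> i * link_walk_mat (slice n E k) \<tau> $$ (i, j) = \<pi> j * link_walk_mat (slice n E k) \<tau> $$ (j, i)"
      if "i < m" "j < m" for i j using that by (simp add: entry nonadj_commute)
    fix w :: "nat \<Rightarrow> real" assume w: "(\<Sum>i<m. w i) = 0"
    define h where "h v = w (the_inv_into {..<m} ((!) vs) v)" for v
    have hw: "h (vs ! i) = w i" if "i < m" for i
      unfolding h_def using that bij by (simp add: the_inv_into_f_f bij_betw_def)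
    have re: "(\<Sum>v\<in>free \<tau>. f v) = (\<Sum>i<m. f (vs ! i))" for f :: "nat \<Rightarrow> real"
      using sum.reindex_bij_betw[OF bij, of f] by simp
    have "(\<Sum>i<m. \<Sum>j<m. \<pi> i * link_walk_mat (slice n E k) \<tau> $$ (i, j) * w i * w j) = Bf \<tau> h"
      unfolding Bf_slice re by (intro sum.cong refl) (simp add: entry hw)
    also have "\<dots> \<le> (\<Sum>u\<in>free \<tau>. h u)\<^sup>2 + 1 / (2 * real k) * Df \<tau> h" by (rule Bf_slice_le)
    also have "(\<Sum>u\<in>free \<tau>. h u) = 0" unfolding re using w by (simp add: hw)
    also have "Df \<tau> h = (\<Sum>i<m. \<pi> i * (w i)\<^sup>2)" unfolding Df_slice re by (simp add: hw \<pi>_def)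
    finally show "(\<Sum>i<m. \<Sum>j<m. \<pi> i * link_walk_mat (slice n E k) \<tau> $$ (i, j) * w i * w j) \<le>
      1 / (2 * real k) * (\<Sum>i<m. \<pi> i * (w i)\<^sup>2)" by simp
  qed
qed

end

lemma slice_expander: "top_link_expander k (slice n E k) (1 / (2 * real k))"
  unfolding top_link_expander_def
proof (intro ballI impI)
  fix \<tau> assume "\<tau> \<in> faces (slice n E k)" "codim k \<tau> = 2"
  hence "indep n E \<tau>" "card \<tau> + 2 = k" by (auto simp: faces_slice codim_def)
  thus "second_eigenvalue (link_walk_mat (slice n E k) \<tau>) \<le> 1 / (2 * real k)" by (rule second_eigenvalue_slice)
qed

lemma slice_mixes: "mixes_within 3 2 n (slice n E k)"
  unfolding slice_def
proof (rule mixes_within_of_gap)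
  show "link_connected \<tau>" if "Up \<tau> \<noteq> {}" "card \<tau> + 2 \<le> k" for \<tau>
    using that link_connected_slice by (simp add: Up_nonempty_iff)
  show "local_gap \<tau> (1 / (2 * real k))" if "Up \<tau> \<noteq> {}" "card \<tau> + 2 = k" for \<tau>
    using that local_gap_slice by (simp add: Up_nonempty_iff)
qed (use k1 facets_nonempty in auto)

end

section \<open>Union bounds\<close>

text \<open>The logarithm of \<open>(e * n / x)^x\<close>, the usual upper bound for the binomial
  coefficient.\<close>

definition ent :: "real \<Rightarrow> real \<Rightarrow> real" where
  "ent n x = x * ln (n / x) + x"

text \<open>Rests on \<open>ln (y / x) \<le> y / x - 1\<close>. In the exponents below it lets the
  larger of two sets pay for both.\<close>

lemma ent_mono:
  assumes "0 < x" "x \<le> y" "y \<le> n"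
  shows "ent n x \<le> ent n y"
proof -
  have "x * ln (n / x) = x * ln (n / y) + x * ln (y / x)"
    using assms by (simp add: ln_div algebra_simps)
  also have "x * ln (y / x) \<le> x * (y / x - 1)" using assms by (intro mult_left_mono ln_le_minus_one) auto
  also have "x * (y / x - 1) = y - x" using assms by (simp add: field_simps)
  also have "x * ln (n / y) \<le> y * ln (n / y)" using assms by (intro mult_right_mono) auto
  finally show ?thesis by (simp add: ent_def)
qed

lemma ent_le:
  assumes "0 < x" "x \<le> n"
  shows "ent n x \<le> n"
  using ent_mono[of x n n] assms by (simp add: ent_def)

text \<open>A single term of the expansion of \<open>(1 + x)^n\<close> at \<open>x = s / n\<close>,
  where the whole sum is at most \<open>exp s\<close>.\<close>

lemma binomial_le_exp_ent:
  assumes "1 \<le> s" "s \<le> n"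
  shows "real (n choose s) \<le> exp (ent n s)"
proof -
  define x where "x = real s / real n"
  have x: "x > 0" using assms by (simp add: x_def)
  have "real (n choose s) * x ^ s \<le> (\<Sum>i\<le>n. real (n choose i) * x ^ i)"
    using assms x by (intro member_le_sum) auto
  also have "\<dots> = (x + 1) ^ n" by (simp add: binomial_ring)
  also have "\<dots> \<le> exp x ^ n" using exp_ge_add_one_self[of x] x by (intro power_mono) (simp_all add: add.commute[of x 1])
  also have "\<dots> = exp s" using assms by (simp add: exp_of_nat_mult[symmetric] x_def)
  finally have "real (n choose s) \<le> exp s / x ^ s" using x by (simp add: pos_le_divide_eq)
  also have "\<dots> = exp s * (real n / s) ^ s" by (simp add: x_def power_divide)
  also have "(real n / s) ^ s = exp (s * ln (n / s))"
    using assms by (simp add: exp_of_nat_mult)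
  also have "exp s * exp (s * ln (n / s)) = exp (ent n s)" by (simp add: ent_def exp_add[symmetric] add.commute)
  finally show ?thesis .
qed

lemma sum_nonempty_subsets:
  fixes g :: "nat \<Rightarrow> real"
  shows "(\<Sum>S\<in>Pow {..<n} - {{}}. g (card S)) = (\<Sum>s=1..n. real (n choose s) * g s)"
proof -
  have "(\<Sum>s=1..n. \<Sum>S\<in>{S\<in>Pow {..<n} - {{}}. card S = s}. g (card S)) = (\<Sum>S\<in>Pow {..<n} - {{}}. g (card S))"
  proof (rule sum.group)
    show "card ` (Pow {..<n} - {{}}) \<subseteq> {1..n}"
    proof
      fix s assume "s \<in> card ` (Pow {..<n} - {{}})"
      then obtain S where S: "S \<subseteq> {..<n}" "S \<noteq> {}" "s = card S" by auto
      thus "s \<in> {1..n}" using card_mono[OF _ S(1)] finite_subset[OF S(1)] by (auto simp: Suc_le_eq card_gt_0_iff)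
    qed
  qed auto
  moreover have "(\<Sum>S\<in>{S\<in>Pow {..<n} - {{}}. card S = s}. g (card S)) = real (n choose s) * g s" if "s \<in> {1..n}" for s
  proof -
    have "{S\<in>Pow {..<n} - {{}}. card S = s} = {S. S \<subseteq> {..<n} \<and> card S = s}" using that by auto
    hence "card {S\<in>Pow {..<n} - {{}}. card S = s} = n choose s" using n_subsets[of "{..<n}" s] by simp
    thus ?thesis by simp
  qed
  hence "(\<Sum>s=1..n. \<Sum>S\<in>{S\<in>Pow {..<n} - {{}}. card S = s}. g (card S)) = (\<Sum>s=1..n. real (n choose s) * g s)"
    by (intro sum.cong refl)
  ultimately show ?thesis by (simp only:)
qed

text \<open>Each of the \<open>n\<close> possible sizes contributes at most 1, so a failure bound of
  \<open>exp (- ent n (card S))\<close> per set leaves only a factor \<open>n\<close> after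
  summation.\<close>

lemma sum_exp_neg_ent:
  fixes n :: nat
  shows "(\<Sum>S\<in>Pow {..<n} - {{}}. exp (- ent n (card S))) \<le> n"
proof -
  have "(\<Sum>S\<in>Pow {..<n} - {{}}. exp (- ent n (card S))) = (\<Sum>s=1..n. real (n choose s) * exp (- ent n s))"
    by (rule sum_nonempty_subsets)
  also have "\<dots> \<le> (\<Sum>s=1..n. 1)"
  proof (intro sum_mono)
    fix s assume "s \<in> {1..n}"
    hence "real (n choose s) * exp (- ent n s) \<le> exp (ent n s) * exp (- ent n s)"
      by (intro mult_right_mono binomial_le_exp_ent) auto
    thus "real (n choose s) * exp (- ent n s) \<le> 1" by (simp add: exp_add[symmetric])
  qed
  finally show ?thesis by simp
qed

lemma card_union_bound:
  fixes P :: "'b \<Rightarrow> 'a \<Rightarrow> bool"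
  assumes "finite R" "finite I"
  shows "real (card {E\<in>R. \<exists>i\<in>I. P i E}) \<le> (\<Sum>i\<in>I. real (card {E\<in>R. P i E}))"
proof -
  have "{E\<in>R. \<exists>i\<in>I. P i E} = (\<Union>i\<in>I. {E\<in>R. P i E})" by auto
  hence "card {E\<in>R. \<exists>i\<in>I. P i E} \<le> (\<Sum>i\<in>I. card {E\<in>R. P i E})" using assms by (simp add: card_UN_le)
  hence "real (card {E\<in>R. \<exists>i\<in>I. P i E}) \<le> real (\<Sum>i\<in>I. card {E\<in>R. P i E})" by (rule of_nat_mono)
  thus ?thesis by simp
qed

text \<open>The reciprocal of the quadratic Taylor bound for \<open>exp x\<close>, since
  \<open>(1 - x + x^2 / 2) * (1 + x + x^2 / 2) = 1 + x^4 / 4\<close>.\<close>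

lemma exp_neg_upper:
  fixes x :: real
  assumes "x \<ge> 0"
  shows "exp (- x) \<le> 1 - x + x\<^sup>2 / 2"
proof -
  have pos: "1 + x + x\<^sup>2 / 2 > 0" using assms by (simp add: add_pos_nonneg)
  have "1 \<le> (1 - x + x\<^sup>2 / 2) * (1 + x + x\<^sup>2 / 2)"
  proof -
    have "(1 - x + x\<^sup>2 / 2) * (1 + x + x\<^sup>2 / 2) = 1 + (x\<^sup>2)\<^sup>2 / 4" by (simp add: power2_eq_square algebra_simps)
    thus ?thesis by simp
  qed
  hence "1 / (1 + x + x\<^sup>2 / 2) \<le> 1 - x + x\<^sup>2 / 2" using pos by (simp add: pos_divide_le_eq)
  moreover have "exp (- x) \<le> 1 / (1 + x + x\<^sup>2 / 2)"
    using exp_lower_Taylor_quadratic[OF assms] pos by (simp add: exp_minus inverse_eq_divide frac_le)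
  ultimately show ?thesis by simp
qed

text \<open>
  The deviation \<open>a = A \<surd>(s t)\<close> either exceeds the trivial bound \<open>\<Delta> s\<close>, or is large enough for one of
  three choices of \<open>\<theta>\<close> to beat the entropy of the pair of sets: \<open>\<theta> \<sim> a / \<mu>\<close> while \<open>a = O(\<mu>)\<close>,
  a constant for sets of size at least \<open>n / \<Delta>\<^sup>2\<close>, and \<open>\<theta> \<sim> ln (n / t)\<close> for smaller sets.
\<close>

lemma upper_exponent:
  fixes s t n \<Delta> L :: real
  assumes s: "1 \<le> s" and st: "s \<le> t" and tn: "t \<le> n" and D: "\<Delta> \<ge> 3" and L: "L = ln \<Delta>"
    and n1: "n \<ge> 12 * \<Delta>" and n2: "3 * \<Delta>\<^sup>2 + 4 * ln n \<le> 4 * n" and n3: "4 * ln n \<le> n / \<Delta>\<^sup>2"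
  defines "A \<equiv> 16 * sqrt \<Delta> * L"
  defines "a \<equiv> A * sqrt (s * t)"
  defines "\<mu> \<equiv> \<Delta> * s * t / n" and "\<mu>' \<equiv> s * t * \<Delta> / (n - 6 * \<Delta>)"
  shows "a \<ge> \<Delta> * s \<or> (\<exists>\<theta>\<ge>0. \<mu>' * (exp (4 * \<theta>) - 1) / 4 - \<theta> * (\<mu> + a) \<le> - (ent n s + ent n t) - 4 * ln n)"
proof (cases "a \<ge> \<Delta> * s")
  case False
  have L1: "L \<ge> 1"
  proof -
    have "exp 1 \<le> (3 :: real)" by (rule exp_le)
    also have "\<dots> \<le> \<Delta>" by (rule D)
    finally show ?thesis unfolding L using D by (simp add: ln_ge_iff)
  qed
  have pos: "s > 0" "t > 0" "n > 0" "\<Delta> > 0" using s st tn D by auto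
  have sq: "sqrt \<Delta> \<ge> 1" using D by simp
  have A16: "A \<ge> 16" proof -
    have "1 * 1 \<le> sqrt \<Delta> * L" using sq L1 by (intro mult_mono) auto
    thus ?thesis unfolding A_def by simp
  qed
  have A2: "A\<^sup>2 = 256 * \<Delta> * L\<^sup>2" unfolding A_def using D by (simp add: power_mult_distrib)
  have apos: "a > 0" unfolding a_def using A16 pos by simp
  have a2: "a\<^sup>2 = A\<^sup>2 * (s * t)" unfolding a_def using pos by (simp add: power_mult_distrib)
  \<comment> \<open>In the nontrivial case \<open>a < \<Delta> * s\<close>; dividing
    \<open>a^2 = 256 * \<Delta> * L^2 * s * t\<close> by \<open>\<Delta> * s\<close> compares the
    deviation with the size of the larger set.\<close>
  have a_big: "a \<ge> 256 * L\<^sup>2 * t"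
  proof -
    have "(256 * L\<^sup>2 * t) * (\<Delta> * s) = a\<^sup>2" unfolding a2 A2 by simp
    also have "\<dots> \<le> a * (\<Delta> * s)" unfolding power2_eq_square using False apos by (intro mult_left_mono) auto
    finally show ?thesis using pos by (simp add: mult_le_cancel_right)
  qed
  have L2: "L \<le> L\<^sup>2" "1 \<le> L\<^sup>2" using L1 by (simp_all add: self_le_power one_le_power)
  have \<mu>pos: "\<mu> > 0" using pos by (simp add: \<mu>_def)
  have n6: "n - 6 * \<Delta> \<ge> n / 2" "n - 6 * \<Delta> > 0" using n1 pos by auto
  \<comment> \<open>\<open>\<mu>'\<close> is the mean with the switching error. Its excess is
    bounded in two ways: a factor 2 is enough where \<open>a\<close> dominates \<open>\<mu>\<close>,
    while for small deviations the additive bound \<open>12 * \<Delta>^2\<close> is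
    required.\<close>
  have diff: "\<mu>' - \<mu> = 6 * \<Delta> / (n - 6 * \<Delta>) * \<mu>"
    unfolding \<mu>_def \<mu>'_def using n6 pos by (simp add: field_simps)
  have \<mu>'1: "\<mu>' \<le> 2 * \<mu>"
  proof -
    have "6 * \<Delta> / (n - 6 * \<Delta>) \<le> 1" using n1 n6 by (simp add: pos_divide_le_eq)
    hence "6 * \<Delta> / (n - 6 * \<Delta>) * \<mu> \<le> 1 * \<mu>" using \<mu>pos by (intro mult_right_mono) auto
    thus ?thesis using diff by simp
  qed
  have \<mu>'2: "\<mu>' - \<mu> \<le> 12 * \<Delta>\<^sup>2"
  proof -
    have "\<mu> \<le> \<Delta> * n"
    proof -
      have "s * t \<le> n * n" using st tn pos by (intro mult_mono) auto
      hence "\<Delta> * (s * t) / n \<le> \<Delta> * (n * n) / n" using pos by (intro divide_right_mono mult_left_mono) auto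
      thus ?thesis using pos by (simp add: \<mu>_def mult.assoc)
    qed
    moreover have "6 * \<Delta> / (n - 6 * \<Delta>) \<le> 6 * \<Delta> / (n / 2)" using n6 pos by (intro divide_left_mono) auto
    ultimately have "6 * \<Delta> / (n - 6 * \<Delta>) * \<mu> \<le> 6 * \<Delta> / (n / 2) * (\<Delta> * n)"
      using pos \<mu>pos by (intro mult_mono) auto
    also have "\<dots> = 12 * \<Delta>\<^sup>2" using pos by (simp add: power2_eq_square)
    finally show ?thesis using diff by simp
  qed
  have \<mu>'pos: "\<mu>' > 0" using pos n6 by (simp add: \<mu>'_def)
  have ent_s: "ent n s \<le> ent n t" using st tn pos by (intro ent_mono) auto
  show ?thesis
  proof (cases "a \<le> 8 * \<mu>")
    case True
    \<comment> \<open>Here \<open>4 * \<theta> \<le> 1\<close>, so the quadratic bound for the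
      exponential applies, and \<open>\<theta> * a = 8 * L^2 * n\<close> whatever \<open>s\<close>
      and \<open>t\<close> are, against an entropy of at most \<open>2 * n\<close>.\<close>
    define \<theta> where "\<theta> = a / (32 * \<mu>)"
    have \<theta>: "0 \<le> \<theta>" "\<theta> \<le> 1 / 4" using True \<mu>pos apos by (simp_all add: \<theta>_def pos_divide_le_eq)
    have \<theta>\<mu>: "\<mu> * \<theta> = a / 32" using \<mu>pos by (simp add: \<theta>_def)
    have "exp (4 * \<theta>) \<le> 1 + 4 * \<theta> + (4 * \<theta>)\<^sup>2" using \<theta> by (intro exp_bound) auto
    hence "\<mu>' * (exp (4 * \<theta>) - 1) / 4 \<le> \<mu>' * (4 * \<theta> + (4 * \<theta>)\<^sup>2) / 4"
      using \<mu>'pos by (intro divide_right_mono mult_left_mono) auto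
    also have "\<dots> = \<mu> * \<theta> + (\<mu>' - \<mu>) * \<theta> + 4 * (\<mu>' * \<theta>) * \<theta>" by (simp add: power2_eq_square algebra_simps)
    also have "\<dots> \<le> \<mu> * \<theta> + 12 * \<Delta>\<^sup>2 * \<theta> + 4 * (2 * \<mu> * \<theta>) * \<theta>"
      using \<mu>'1 \<mu>'2 \<theta> by (intro add_mono mult_right_mono mult_left_mono) auto
    also have "12 * \<Delta>\<^sup>2 * \<theta> \<le> 12 * \<Delta>\<^sup>2 * (1 / 4)" using \<theta> by (intro mult_left_mono) auto
    also have "4 * (2 * \<mu> * \<theta>) * \<theta> = \<theta> * a / 4" using \<theta>\<mu> by (simp add: mult.assoc)
    finally have "\<mu>' * (exp (4 * \<theta>) - 1) / 4 - \<theta> * (\<mu> + a) \<le> 3 * \<Delta>\<^sup>2 - 3 / 4 * (\<theta> * a)"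
      by (simp add: algebra_simps)
    also have "\<theta> * a = 8 * L\<^sup>2 * n"
    proof -
      have "\<theta> * a = a\<^sup>2 / (32 * \<mu>)" by (simp add: \<theta>_def power2_eq_square)
      also have "\<dots> = 8 * L\<^sup>2 * n" unfolding a2 A2 \<mu>_def using pos by (simp add: field_simps)
      finally show ?thesis .
    qed
    also have "3 * \<Delta>\<^sup>2 - 3 / 4 * (8 * L\<^sup>2 * n) \<le> 3 * \<Delta>\<^sup>2 - 6 * n"
      using L2 pos by simp
    also have "\<dots> \<le> - (ent n s + ent n t) - 4 * ln n"
      using n2 ent_le[of s n] ent_le[of t n] st tn pos by simp
    finally show ?thesis using \<theta> by blast
  next
    case big: False
    show ?thesis
    proof (cases "t \<ge> n / \<Delta>\<^sup>2")
      case True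
      \<comment> \<open>The choice \<open>\<theta> = 1 / 4\<close>: the moment term is at most
        \<open>\<mu>\<close>, below \<open>a / 8\<close>, and a gain linear in \<open>a\<close>
        remains, while the entropy has a logarithm of at most \<open>2 * L\<close>.\<close>
      define X where "X = \<mu>' * (exp (4 * (1 / 4)) - 1) / 4"
      have "X \<le> 2 * \<mu> * (3 - 1) / 4"
        unfolding X_def using \<mu>'1 \<mu>pos exp_le by (intro divide_right_mono mult_mono) auto
      hence "X \<le> \<mu>" by simp
      moreover have "8 * \<mu> < a" using big by (simp only: not_le)
      ultimately have "8 * X - 2 * (\<mu> + a) \<le> - a" using \<mu>pos apos by argo
      hence "X - 1 / 4 * (\<mu> + a) \<le> - (a / 8)" by (simp add: field_simps)
      also have "\<dots> \<le> - (32 * L\<^sup>2 * t)" using a_big by simp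
      also have "\<dots> \<le> - (ent n s + ent n t) - 4 * ln n"
      proof -
        have "n \<le> t * \<Delta>\<^sup>2" using True pos by (simp add: pos_divide_le_eq)
        hence "n / t \<le> \<Delta>\<^sup>2" using pos by (simp add: pos_divide_le_eq mult.commute)
        hence "ln (n / t) \<le> ln (\<Delta>\<^sup>2)" using pos by (subst ln_le_cancel_iff) auto
        also have "\<dots> = 2 * L" using pos by (simp add: L ln_realpow)
        finally have "t * ln (n / t) \<le> t * (2 * L)" using pos by (intro mult_left_mono) auto
        moreover have "t * 1 \<le> t * L\<^sup>2" "t * L \<le> t * L\<^sup>2" using L2 pos by (intro mult_left_mono; simp)+
        moreover have "4 * ln n \<le> t" using n3 True by simp
        moreover have "t * (2 * L) = 2 * (t * L)" "32 * L\<^sup>2 * t = 32 * (t * L\<^sup>2)" by simp_all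
        ultimately show ?thesis using ent_s pos unfolding ent_def mult_1_right by argo
      qed
      finally show ?thesis unfolding X_def by (intro disjI2 exI[of _ "1 / 4"]) auto
    next
      case small: False
      define l where "l = ln (n / t)"
      have nt: "n / t > \<Delta>\<^sup>2" using small pos by (simp add: field_simps)
      have l2: "l \<ge> 2"
      proof -
        have "2 * 1 \<le> 2 * L" using L1 by simp
        also have "\<dots> = ln (\<Delta>\<^sup>2)" using pos by (simp add: L ln_realpow)
        also have "\<dots> \<le> l" unfolding l_def using nt pos by (subst ln_le_cancel_iff) auto
        finally show ?thesis by simp
      qed
      \<comment> \<open>Chosen to make \<open>exp (4 * \<theta>)\<close> equal to
        \<open>sqrt (n / t)\<close>. Since \<open>n / t > \<Delta>^2\<close>, the mean inflated by
        this factor stays below \<open>a / 16\<close>, while the gain \<open>\<theta> * a\<close>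
        carries the logarithm \<open>l\<close> that the entropy requires.\<close>
      define \<theta> where "\<theta> = l / 8"
      have \<theta>: "\<theta> \<ge> 0" using l2 by (simp add: \<theta>_def)
      have e: "exp (4 * \<theta>) = sqrt (n / t)"
      proof -
        have "(exp (4 * \<theta>))\<^sup>2 = exp l" by (simp add: \<theta>_def power2_eq_square exp_add[symmetric])
        also have "\<dots> = n / t" using pos by (simp add: l_def)
        finally show ?thesis by (metis real_sqrt_unique exp_ge_zero)
      qed
      have key: "\<mu> * sqrt (n / t) \<le> a / 16"
      proof -
        have r: "sqrt (s * t) \<le> t"
        proof (rule real_le_lsqrt)
          show "s * t \<le> t\<^sup>2" unfolding power2_eq_square using st pos by (intro mult_right_mono) auto
        qed (use pos in auto)
        have tn': "sqrt (n / t) * (t / n) \<le> 1 / \<Delta>"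
        proof -
          have "sqrt (n / t) * (t / n) = 1 / sqrt (n / t)"
            using pos real_sqrt_mult_self[of "n / t"] by (simp add: field_simps)
          also have "\<dots> \<le> 1 / \<Delta>"
          proof (intro divide_left_mono)
            have "sqrt (\<Delta>\<^sup>2) \<le> sqrt (n / t)" using nt by (intro real_sqrt_le_mono) auto
            thus "\<Delta> \<le> sqrt (n / t)" using pos by simp
          qed (use pos in auto)
          finally show ?thesis .
        qed
        have "\<mu> = \<Delta> * (sqrt (s * t) * sqrt (s * t)) / n" unfolding \<mu>_def using pos by simp
        also have "\<dots> \<le> \<Delta> * (sqrt (s * t) * t) / n"
          using r pos by (intro divide_right_mono mult_left_mono) auto
        finally have "\<mu> * sqrt (n / t) \<le> \<Delta> * (sqrt (s * t) * t) / n * sqrt (n / t)"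
          using pos by (intro mult_right_mono) auto
        also have "\<dots> = \<Delta> * sqrt (s * t) * (sqrt (n / t) * (t / n))" by simp
        also have "\<dots> \<le> \<Delta> * sqrt (s * t) * (1 / \<Delta>)" using tn' pos by (intro mult_left_mono) auto
        also have "\<dots> = sqrt (s * t)" using pos by simp
        also have "\<dots> \<le> a / 16" unfolding a_def using A16 pos by (simp add: mult_right_mono)
        finally show ?thesis .
      qed
      have "\<mu>' * (exp (4 * \<theta>) - 1) / 4 \<le> 2 * \<mu> * sqrt (n / t) / 4"
        unfolding e using \<mu>'1 \<mu>pos \<mu>'pos pos tn by (intro divide_right_mono mult_mono) auto
      hence "\<mu>' * (exp (4 * \<theta>) - 1) / 4 - \<theta> * (\<mu> + a) \<le> a / 32 - \<theta> * a"
      proof -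
        have "2 * \<mu> * sqrt (n / t) / 4 = (\<mu> * sqrt (n / t)) / 2" by simp
        moreover have "\<theta> * (\<mu> + a) = \<theta> * \<mu> + \<theta> * a" by (rule distrib_left)
        moreover have "0 \<le> \<theta> * \<mu>" using \<theta> \<mu>pos by simp
        ultimately show "?thesis"
          if "\<mu>' * (exp (4 * \<theta>) - 1) / 4 \<le> 2 * \<mu> * sqrt (n / t) / 4"
          using key that by argo
      qed
      also have "a / 32 - \<theta> * a \<le> a * l / 64 - \<theta> * a" using l2 apos by simp
      also have "a * l / 64 - \<theta> * a = - (7 / 64) * (a * l)" by (simp add: \<theta>_def)
      also have "\<dots> \<le> - (7 / 64) * (256 * t * l)"
      proof -
        have "256 * (1 * t) \<le> 256 * (L\<^sup>2 * t)" using L2 pos by (intro mult_left_mono mult_right_mono) auto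
        hence "256 * t \<le> a" using a_big by simp
        hence "256 * t * l \<le> a * l" using l2 by (intro mult_right_mono) auto
        thus ?thesis by (rule mult_left_mono_neg) simp
      qed
      also have "\<dots> = - 28 * (t * l)" by simp
      also have "\<dots> \<le> - (ent n s + ent n t) - 4 * ln n"
      proof -
        have 1: "t * 2 \<le> t * l" using l2 pos by (intro mult_left_mono) auto
        have t1: "t \<ge> 1" using s st by simp
        \<comment> \<open>For the term \<open>4 * ln n\<close>: either \<open>t\<close> is at least
          \<open>sqrt n\<close>, or \<open>n / t\<close> is and then \<open>l\<close> alone is large
          enough.\<close>
        have 2: "ln n / 2 \<le> t * l"
        proof (cases "t \<ge> sqrt n")
          case True
          have "ln n / 2 = ln (sqrt n)" using pos by (simp add: ln_sqrt)
          also have "\<dots> \<le> sqrt n" using ln_le_minus_one[of "sqrt n"] pos by simp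
          finally show ?thesis using True 1 t1 by linarith
        next
          case False
          have "ln n / 2 = ln (sqrt n)" using pos by (simp add: ln_sqrt)
          also have "\<dots> \<le> l"
          proof -
            have "sqrt n * t \<le> sqrt n * sqrt n" using False pos by (intro mult_left_mono) auto
            hence "sqrt n \<le> n / t" using pos by (simp add: pos_le_divide_eq)
            thus ?thesis unfolding l_def using pos by (subst ln_le_cancel_iff) auto
          qed
          also have "1 * l \<le> t * l" using t1 l2 by (intro mult_right_mono) auto
          finally show ?thesis by simp
        qed
        show ?thesis using 1 2 ent_s pos unfolding ent_def l_def[symmetric] by argo
      qed
      finally show ?thesis by - (rule disjI2, rule exI[of _ \<theta>], rule conjI[OF \<theta>], assumption)
    qed
  qed
qed simp

text \<open>A count cannot be negative, so only \<open>a < \<mu>\<close> matters. There the single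
  choice \<open>\<theta> = a / (4 * \<mu>)\<close> works for all sizes:
  \<open>\<theta> * a = 64 * L^2 * n\<close>, and the half that survives the quadratic error exceeds
  the entropy of at most \<open>2 * n\<close>.\<close>

lemma lower_exponent:
  fixes s t n \<Delta> L :: real
  assumes s: "1 \<le> s" "s \<le> n" and t: "1 \<le> t" "t \<le> n" and D: "\<Delta> \<ge> 3" and L: "L = ln \<Delta>"
    and n2: "3 * \<Delta>\<^sup>2 + 4 * ln n \<le> 4 * n"
  defines "A \<equiv> 16 * sqrt \<Delta> * L"
  defines "a \<equiv> A * sqrt (s * t)"
  defines "\<mu> \<equiv> \<Delta> * s * t / n"
  shows "a \<ge> \<mu> \<or> (\<exists>\<theta>\<ge>0. \<theta> * (\<mu> - a) - (\<mu> - 4 * \<Delta>\<^sup>2) * (1 - exp (- (4 * \<theta>))) / 4 \<le> - (ent n s + ent n t) - 4 * ln n)"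
proof (cases "a \<ge> \<mu>")
  case False
  have L1: "L \<ge> 1"
  proof -
    have "exp 1 \<le> (3 :: real)" by (rule exp_le)
    also have "\<dots> \<le> \<Delta>" by (rule D)
    finally show ?thesis unfolding L using D by (simp add: ln_ge_iff)
  qed
  have pos: "s > 0" "t > 0" "n > 0" "\<Delta> > 0" using s t D by auto
  have A2: "A\<^sup>2 = 256 * \<Delta> * L\<^sup>2" unfolding A_def using D by (simp add: power_mult_distrib)
  have a0: "a \<ge> 0" unfolding a_def A_def using L1 pos by simp
  have a2: "a\<^sup>2 = A\<^sup>2 * (s * t)" unfolding a_def using pos by (simp add: power_mult_distrib)
  have \<mu>pos: "\<mu> > 0" using pos by (simp add: \<mu>_def)
  define \<theta> where "\<theta> = a / (4 * \<mu>)"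
  have \<theta>: "0 \<le> \<theta>" using \<mu>pos a0 by (simp add: \<theta>_def)
  have \<theta>\<mu>: "\<mu> * \<theta> = a / 4" using \<mu>pos by (simp add: \<theta>_def)
  define e where "e = 1 - exp (- (4 * \<theta>))"
  have e1: "e \<le> 1" by (simp add: e_def)
  have "e \<ge> 4 * \<theta> - (4 * \<theta>)\<^sup>2 / 2" using exp_neg_upper[of "4 * \<theta>"] \<theta> by (simp add: e_def)
  hence "\<mu> * e / 4 \<ge> \<mu> * (4 * \<theta> - (4 * \<theta>)\<^sup>2 / 2) / 4" using \<mu>pos by (intro divide_right_mono mult_left_mono) auto
  also have "\<mu> * (4 * \<theta> - (4 * \<theta>)\<^sup>2 / 2) / 4 = \<mu> * \<theta> - 2 * (\<mu> * \<theta>) * \<theta>" by (simp add: power2_eq_square field_simps)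
  finally have "\<mu> * \<theta> - a * \<theta> / 2 \<le> \<mu> * e / 4" unfolding \<theta>\<mu> by simp
  moreover have "\<Delta>\<^sup>2 * e \<le> \<Delta>\<^sup>2 * 1" using e1 by (intro mult_left_mono) auto
  moreover have "(\<mu> - 4 * \<Delta>\<^sup>2) * e / 4 = \<mu> * e / 4 - \<Delta>\<^sup>2 * e" by (simp add: field_simps)
  moreover have "\<theta> * (\<mu> - a) = \<mu> * \<theta> - a * \<theta>" "\<theta> * a = a * \<theta>" by (simp_all add: algebra_simps)
  ultimately have "\<theta> * (\<mu> - a) - (\<mu> - 4 * \<Delta>\<^sup>2) * e / 4 \<le> \<Delta>\<^sup>2 - \<theta> * a / 2" by linarith
  also have "\<theta> * a = 64 * L\<^sup>2 * n"
  proof -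
    have "\<theta> * a = a\<^sup>2 / (4 * \<mu>)" by (simp add: \<theta>_def power2_eq_square)
    also have "\<dots> = 64 * L\<^sup>2 * n" unfolding a2 A2 \<mu>_def using pos by (simp add: field_simps)
    finally show ?thesis .
  qed
  also have "\<Delta>\<^sup>2 - 64 * L\<^sup>2 * n / 2 \<le> 3 * \<Delta>\<^sup>2 - 6 * n"
  proof -
    have "1 * n \<le> L\<^sup>2 * n" using L1 pos by (intro mult_right_mono) (auto simp: one_le_power)
    thus ?thesis using zero_le_power2[of \<Delta>] pos by linarith
  qed
  also have "\<dots> \<le> - (ent n s + ent n t) - 4 * ln n"
    using n2 ent_le[of s n] ent_le[of t n] s t pos by simp
  finally show ?thesis using \<theta> unfolding e_def by blast
qed simp

lemma arcs_between_commute: "arcs_between E S T = arcs_between E T S"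
proof -
  have "{(u, v). u \<in> T \<and> v \<in> S \<and> {u, v} \<in> E} = prod.swap ` {(u, v). u \<in> S \<and> v \<in> T \<and> {u, v} \<in> E}"
    by (auto simp: insert_commute image_iff)
  thus ?thesis unfolding arcs_between_def by (simp add: card_image)
qed

lemma arcs_between_le:
  assumes E: "E \<in> regular_graphs n \<Delta>" and S: "S \<subseteq> {..<n}"
  shows "arcs_between E S T \<le> \<Delta> * card S"
proof -
  have fS: "finite S" using S finite_subset by blast
  have "{(u, v). u \<in> S \<and> v \<in> T \<and> {u, v} \<in> E} \<subseteq> Sigma S (nbrs E)" by (auto simp: nbrs_def insert_commute)
  hence "arcs_between E S T \<le> card (Sigma S (nbrs E))"
    unfolding arcs_between_def using fS finite_nbrs[OF E] by (intro card_mono) auto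
  thus ?thesis using card_arcs[OF E S] by (simp add: mult.commute)
qed

section \<open>Discrepancy of edge counts for all pairs of vertex sets\<close>

definition disc_const :: "nat \<Rightarrow> real" where
  "disc_const \<Delta> = 16 * sqrt \<Delta> * ln \<Delta>"

definition discrepant :: "nat \<Rightarrow> nat \<Rightarrow> nat set set \<Rightarrow> nat set \<Rightarrow> nat set \<Rightarrow> bool" where
  "discrepant n \<Delta> E S T \<longleftrightarrow> disc_const \<Delta> * sqrt (real (card S) * card T) <
     \<bar>real (arcs_between E S T) - \<Delta> * real (card S) * card T / n\<bar>"

context
  fixes n \<Delta> :: nat
  assumes D: "\<Delta> \<ge> 3" and n1: "real n \<ge> 12 * real \<Delta>" and n2: "3 * (real \<Delta>)\<^sup>2 + 4 * ln n \<le> 4 * real n"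
    and n3: "4 * ln n \<le> n / (real \<Delta>)\<^sup>2"
begin

text \<open>The smaller set comes first because the trivial bound on the arcs is
  \<open>\<Delta>\<close> times its size; symmetry is restored in
  \<open>discrepant_pair\<close>.\<close>

lemma arcs_upper_pair:
  assumes S: "S \<subseteq> {..<n}" "S \<noteq> {}" and T: "T \<subseteq> {..<n}" "T \<noteq> {}" and le: "card S \<le> card T"
  shows "real (card {E\<in>regular_graphs n \<Delta>. \<Delta> * real (card S) * card T / n + disc_const \<Delta> * sqrt (real (card S) * card T)
      < arcs_between E S T}) \<le> card (regular_graphs n \<Delta>) * exp (- (ent n (card S) + ent n (card T)) - 4 * ln n)"
proof -
  let ?s = "real (card S)" and ?t = "real (card T)"
  define a where "a = disc_const \<Delta> * sqrt (?s * ?t)"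
  define \<mu> where "\<mu> = \<Delta> * ?s * ?t / n"
  have fin: "finite S" "finite T" using S T finite_subset by auto
  have s1: "1 \<le> ?s" using S fin by (simp add: Suc_le_eq card_gt_0_iff)
  have tn: "?t \<le> n" using card_mono[OF _ T(1)] by simp
  have "a \<ge> \<Delta> * ?s \<or> (\<exists>\<theta>\<ge>0. ?s * ?t * \<Delta> / (real n - 6 * \<Delta>) * (exp (4 * \<theta>) - 1) / 4 - \<theta> * (\<mu> + a) \<le> - (ent n ?s + ent n ?t) - 4 * ln n)"
    unfolding a_def \<mu>_def disc_const_def
    using upper_exponent[OF s1 _ tn _ refl n1 n2 n3] le D by simp
  thus ?thesis
  proof
    assume "a \<ge> \<Delta> * ?s"
    moreover have "\<mu> \<ge> 0" by (simp add: \<mu>_def)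
    moreover have "real (arcs_between E S T) \<le> \<Delta> * ?s" if "E \<in> regular_graphs n \<Delta>" for E
    proof -
      have "real (arcs_between E S T) \<le> real (\<Delta> * card S)"
        using arcs_between_le[OF that S(1)] by (rule of_nat_mono)
      thus ?thesis by simp
    qed
    ultimately have "real (arcs_between E S T) \<le> \<mu> + a" if "E \<in> regular_graphs n \<Delta>" for E
      using that by fastforce
    hence e: "{E\<in>regular_graphs n \<Delta>. \<mu> + a < arcs_between E S T} = {}" by (auto simp: not_less)
    show ?thesis unfolding e[unfolded \<mu>_def a_def] card.empty by simp
  next
    assume "\<exists>\<theta>\<ge>0. ?s * ?t * \<Delta> / (real n - 6 * \<Delta>) * (exp (4 * \<theta>) - 1) / 4 - \<theta> * (\<mu> + a) \<le> - (ent n ?s + ent n ?t) - 4 * ln n"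
    then obtain \<theta> where \<theta>: "\<theta> \<ge> 0"
      "?s * ?t * \<Delta> / (real n - 6 * \<Delta>) * (exp (4 * \<theta>) - 1) / 4 - \<theta> * (\<mu> + a) \<le> - (ent n ?s + ent n ?t) - 4 * ln n"
      by blast
    have "real (card {E\<in>regular_graphs n \<Delta>. \<mu> + a < arcs_between E S T}) \<le>
        real (card {E\<in>regular_graphs n \<Delta>. \<mu> + a \<le> arcs_between E S T})"
      using finite_regular_graphs by (intro of_nat_mono card_mono) auto
    also have "\<dots> \<le> card (regular_graphs n \<Delta>) *
        exp (?s * ?t * \<Delta> / (real n - 6 * \<Delta>) * (exp (4 * \<theta>) - 1) / 4 - \<theta> * (\<mu> + a))"
      using arcs_upper_tail[OF S(1) T(1) _ \<theta>(1), of \<Delta> "\<mu> + a"] D n1 by simp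
    also have "\<dots> \<le> card (regular_graphs n \<Delta>) * exp (- (ent n ?s + ent n ?t) - 4 * ln n)"
      using \<theta>(2) by (intro mult_left_mono) auto
    finally show ?thesis unfolding \<mu>_def a_def .
  qed
qed

lemma arcs_lower_pair:
  assumes S: "S \<subseteq> {..<n}" "S \<noteq> {}" and T: "T \<subseteq> {..<n}" "T \<noteq> {}"
  shows "real (card {E\<in>regular_graphs n \<Delta>. arcs_between E S T <
      \<Delta> * real (card S) * card T / n - disc_const \<Delta> * sqrt (real (card S) * card T)})
      \<le> card (regular_graphs n \<Delta>) * exp (- (ent n (card S) + ent n (card T)) - 4 * ln n)"
proof -
  let ?s = "real (card S)" and ?t = "real (card T)"
  define a where "a = disc_const \<Delta> * sqrt (?s * ?t)"
  define \<mu> where "\<mu> = \<Delta> * ?s * ?t / n"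
  have fin: "finite S" "finite T" using S T finite_subset by auto
  have s1: "1 \<le> ?s" "1 \<le> ?t" using S T fin by (simp_all add: Suc_le_eq card_gt_0_iff)
  have sn: "?s \<le> n" "?t \<le> n" using card_mono[OF _ S(1)] card_mono[OF _ T(1)] by simp_all
  have "a \<ge> \<mu> \<or> (\<exists>\<theta>\<ge>0. \<theta> * (\<mu> - a) - (\<mu> - 4 * (real \<Delta>)\<^sup>2) * (1 - exp (- (4 * \<theta>))) / 4 \<le> - (ent n ?s + ent n ?t) - 4 * ln n)"
    unfolding a_def \<mu>_def disc_const_def
    using lower_exponent[OF s1(1) sn(1) s1(2) sn(2) _ refl n2] D by simp
  thus ?thesis
  proof
    assume "a \<ge> \<mu>"
    hence e: "{E\<in>regular_graphs n \<Delta>. arcs_between E S T < \<mu> - a} = {}"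
      by (auto simp: not_less intro: order_trans[of _ 0])
    show ?thesis unfolding e[unfolded \<mu>_def a_def] card.empty by simp
  next
    assume "\<exists>\<theta>\<ge>0. \<theta> * (\<mu> - a) - (\<mu> - 4 * (real \<Delta>)\<^sup>2) * (1 - exp (- (4 * \<theta>))) / 4 \<le> - (ent n ?s + ent n ?t) - 4 * ln n"
    then obtain \<theta> where \<theta>: "\<theta> \<ge> 0"
      "\<theta> * (\<mu> - a) - (\<mu> - 4 * (real \<Delta>)\<^sup>2) * (1 - exp (- (4 * \<theta>))) / 4 \<le> - (ent n ?s + ent n ?t) - 4 * ln n"
      by blast
    have n0: "n > 0" "\<Delta> \<ge> 1" using n1 D by auto
    have "real (card {E\<in>regular_graphs n \<Delta>. arcs_between E S T < \<mu> - a}) \<le>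
        real (card {E\<in>regular_graphs n \<Delta>. arcs_between E S T \<le> \<mu> - a})"
      using finite_regular_graphs by (intro of_nat_mono card_mono) auto
    also have "\<dots> \<le> card (regular_graphs n \<Delta>) *
        exp (\<theta> * (\<mu> - a) - (\<mu> - 4 * (real \<Delta>)\<^sup>2) * (1 - exp (- (4 * \<theta>))) / 4)"
      using arcs_lower_tail[OF S(1) T(1) n0(2) \<theta>(1) n0(1), of "\<mu> - a"] unfolding \<mu>_def
      by (simp add: mult_ac)
    also have "\<dots> \<le> card (regular_graphs n \<Delta>) * exp (- (ent n ?s + ent n ?t) - 4 * ln n)"
      using \<theta>(2) by (intro mult_left_mono) auto
    finally show ?thesis unfolding \<mu>_def a_def .
  qed
qed

lemma discrepant_pair:
  assumes S: "S \<subseteq> {..<n}" "S \<noteq> {}" and T: "T \<subseteq> {..<n}" "T \<noteq> {}"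
  shows "real (card {E\<in>regular_graphs n \<Delta>. discrepant n \<Delta> E S T}) \<le>
    2 * card (regular_graphs n \<Delta>) * exp (- (ent n (card S) + ent n (card T)) - 4 * ln n)"
proof -
  let ?a = "disc_const \<Delta> * sqrt (real (card S) * card T)" and ?\<mu> = "\<Delta> * real (card S) * card T / n"
  let ?U = "{E\<in>regular_graphs n \<Delta>. ?\<mu> + ?a < arcs_between E S T}"
  let ?L = "{E\<in>regular_graphs n \<Delta>. arcs_between E S T < ?\<mu> - ?a}"
  have "{E\<in>regular_graphs n \<Delta>. discrepant n \<Delta> E S T} = ?U \<union> ?L"
    unfolding discrepant_def by auto
  hence "card {E\<in>regular_graphs n \<Delta>. discrepant n \<Delta> E S T} \<le> card ?U + card ?L" by (simp add: card_Un_le)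
  hence "real (card {E\<in>regular_graphs n \<Delta>. discrepant n \<Delta> E S T}) \<le> real (card ?U + card ?L)"
    by (rule of_nat_mono)
  hence "real (card {E\<in>regular_graphs n \<Delta>. discrepant n \<Delta> E S T}) \<le> real (card ?U) + real (card ?L)"
    by (simp only: of_nat_add)
  moreover have "real (card ?U) \<le> card (regular_graphs n \<Delta>) * exp (- (ent n (card S) + ent n (card T)) - 4 * ln n)"
  proof (cases "card S \<le> card T")
    case True thus ?thesis using arcs_upper_pair[OF S T] by simp
  next
    case False
    hence "card T \<le> card S" by simp
    from arcs_upper_pair[OF T S this] show ?thesis
      by (simp add: arcs_between_commute[of _ T S] mult_ac add.commute)
  qed
  ultimately show ?thesis using arcs_lower_pair[OF S T] by simp
qed

text \<open>The entropies cancel the number of pairs up to a factor \<open>n * n\<close>, and the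
  reserve \<open>4 * ln n\<close> turns this into a failure probability of order
  \<open>1 / n^2\<close>.\<close>

lemma discrepancy_count:
  "real (card {E\<in>regular_graphs n \<Delta>. \<exists>S T. S \<subseteq> {..<n} \<and> T \<subseteq> {..<n} \<and> discrepant n \<Delta> E S T}) \<le>
    2 / (real n)\<^sup>2 * card (regular_graphs n \<Delta>)"
proof -
  let ?G = "regular_graphs n \<Delta>" and ?P = "Pow {..<n} - {{}}"
  have n0: "real n > 0" using n1 D by auto
  have ne: "S \<noteq> {}" "T \<noteq> {}" if "discrepant n \<Delta> E S T" for E S T
    using that by (auto simp: discrepant_def arcs_between_def)
  have "{E\<in>?G. \<exists>S T. S \<subseteq> {..<n} \<and> T \<subseteq> {..<n} \<and> discrepant n \<Delta> E S T} =
      {E\<in>?G. \<exists>p\<in>?P \<times> ?P. discrepant n \<Delta> E (fst p) (snd p)}"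
    using ne by fastforce
  hence "real (card {E\<in>?G. \<exists>S T. S \<subseteq> {..<n} \<and> T \<subseteq> {..<n} \<and> discrepant n \<Delta> E S T}) \<le>
      (\<Sum>p\<in>?P \<times> ?P. real (card {E\<in>?G. discrepant n \<Delta> E (fst p) (snd p)}))"
    using card_union_bound[OF finite_regular_graphs, of "?P \<times> ?P" n \<Delta> "\<lambda>p E. discrepant n \<Delta> E (fst p) (snd p)"] by simp
  also have "\<dots> \<le> (\<Sum>p\<in>?P \<times> ?P. 2 * card ?G * exp (- (ent n (card (fst p)) + ent n (card (snd p))) - 4 * ln n))"
    by (intro sum_mono discrepant_pair) auto
  also have "\<dots> = 2 * card ?G * exp (- (4 * ln n)) * ((\<Sum>S\<in>?P. exp (- ent n (card S))) * (\<Sum>T\<in>?P. exp (- ent n (card T))))"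
  proof -
    have "(\<Sum>p\<in>?P \<times> ?P. 2 * card ?G * exp (- (ent n (card (fst p)) + ent n (card (snd p))) - 4 * ln n)) =
      (\<Sum>p\<in>?P \<times> ?P. (2 * card ?G * exp (- (4 * ln n))) * (exp (- ent n (card (fst p))) * exp (- ent n (card (snd p)))))"
      by (intro sum.cong refl) (simp add: exp_add[symmetric])
    moreover have "(\<Sum>S\<in>?P. exp (- ent n (card S))) * (\<Sum>T\<in>?P. exp (- ent n (card T))) =
      (\<Sum>p\<in>?P \<times> ?P. exp (- ent n (card (fst p))) * exp (- ent n (card (snd p))))"
      by (simp only: sum_product sum.cartesian_product split_def)
    ultimately show ?thesis by (simp only: sum_distrib_left)
  qed
  also have "\<dots> \<le> 2 * card ?G * exp (- (4 * ln n)) * (real n * real n)"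
    by (intro mult_left_mono mult_mono sum_exp_neg_ent) (auto intro: sum_nonneg)
  also have "exp (- (4 * ln n)) = 1 / (real n) ^ 4"
  proof -
    have "exp (4 * ln n) = (real n) ^ 4" using n0 exp_of_nat_mult[of 4 "ln (real n)"] by simp
    thus ?thesis by (simp add: exp_minus inverse_eq_divide)
  qed
  also have "2 * card ?G * (1 / (real n) ^ 4) * (real n * real n) = 2 / (real n)\<^sup>2 * card ?G"
    using n0 by (simp add: power2_eq_square power4_eq_xxxx)
  finally show ?thesis .
qed

end

text \<open>For every admissible \<open>\<tau>\<close> the rate in \<open>uncovered_tail\<close> is
  at least \<open>p * n\<close>. Asking for only half of it leaves the exponent
  \<open>\<theta> * p * n / 2\<close> to spend on the number of sets \<open>\<tau>\<close>.\<close>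

lemma uncovered_count:
  fixes n \<Delta> :: nat and \<alpha> \<theta> p :: real
  assumes D: "\<Delta> \<ge> 1" and \<theta>: "\<theta> > 0" and \<alpha>: "0 < \<alpha>" "\<alpha> < 1 / 2" and n: "6 * real \<Delta> < \<alpha> * n"
  defines "p \<equiv> exp (- (exp (4 * \<theta>) * \<alpha> / (1 - 2 * \<alpha>) * \<Delta>))"
  shows "real (card {E\<in>regular_graphs n \<Delta>. \<exists>\<tau>. \<tau> \<subseteq> {..<n} \<and> card \<tau> \<le> \<alpha> * n \<and> uncovered n E \<tau> \<le> p * n / 2}) \<le>
    (real n + 1) * exp ((\<alpha> * (ln (1 / \<alpha>) + 1) - \<theta> * p / 2) * n) * card (regular_graphs n \<Delta>)"
proof -
  let ?G = "regular_graphs n \<Delta>"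
  have "n \<noteq> 0"
  proof
    assume "n = 0"
    with n have "6 * real \<Delta> < 0" by simp
    thus False by simp
  qed
  hence n0: "real n > 0" by simp
  have \<alpha>n: "\<alpha> * n \<le> n" using \<alpha> n0 by simp
  define b where "b = exp (\<theta> * (p * n / 2) - \<theta> * (n * p))"
  have tail: "real (card {E\<in>?G. uncovered n E \<tau> \<le> p * n / 2}) \<le> card ?G * b"
    if \<tau>: "\<tau> \<subseteq> {..<n}" "card \<tau> \<le> \<alpha> * n" for \<tau>
  proof -
    define q where "q = exp (4 * \<theta>) * card \<tau> / (real n - card \<tau> - 6 * \<Delta>)"
    have den: "real n - card \<tau> - 6 * \<Delta> \<ge> (1 - 2 * \<alpha>) * n" using \<tau>(2) n by (simp add: algebra_simps)
    have den0: "(1 - 2 * \<alpha>) * n > 0" using \<alpha> n0 by simp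
    have "q \<le> exp (4 * \<theta>) * (\<alpha> * n) / ((1 - 2 * \<alpha>) * n)"
      unfolding q_def using den den0 \<tau>(2) by (intro frac_le mult_left_mono) auto
    also have "\<dots> = exp (4 * \<theta>) * \<alpha> / (1 - 2 * \<alpha>)" using n0 by simp
    finally have "q * \<Delta> \<le> exp (4 * \<theta>) * \<alpha> / (1 - 2 * \<alpha>) * \<Delta>" by (intro mult_right_mono) auto
    hence p_le: "p \<le> exp (- q * \<Delta>)" by (simp add: p_def)
    have "real n > card \<tau> + 6 * \<Delta>" using den den0 by simp
    from uncovered_tail[OF \<tau>(1) D _ this, of \<theta> "p * n / 2"] \<theta>
    have "real (card {E\<in>?G. uncovered n E \<tau> \<le> p * n / 2}) \<le> card ?G * exp (\<theta> * (p * n / 2) - \<theta> * (n * exp (- q * \<Delta>)))"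
      unfolding q_def by simp
    also have "\<dots> \<le> card ?G * b"
      unfolding b_def using p_le \<theta> n0 by (intro mult_left_mono) auto
    finally show ?thesis .
  qed
  define I where "I = {\<tau>. \<tau> \<subseteq> {..<n} \<and> card \<tau> \<le> \<alpha> * n}"
  have fI: "finite I" by (rule finite_subset[of _ "Pow {..<n}"]) (auto simp: I_def)
  define \<beta> where "\<beta> = \<alpha> * (ln (1 / \<alpha>) + 1)"
  have cI: "real (card I) \<le> (real n + 1) * exp (\<beta> * n)"
  proof -
    have ent_eq: "ent n (\<alpha> * n) = \<beta> * n" using n0 \<alpha> by (simp add: ent_def \<beta>_def algebra_simps)
    have \<beta>0: "\<beta> \<ge> 0" unfolding \<beta>_def using \<alpha> by (intro mult_nonneg_nonneg add_nonneg_nonneg) auto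
    have "card I \<le> Suc (card (I - {{}}))" by (cases "{} \<in> I") (simp_all add: card_Diff_singleton)
    hence "real (card I) \<le> 1 + (\<Sum>\<tau>\<in>I - {{}}. 1)" by simp
    \<comment> \<open>Each \<open>\<tau>\<close> in \<open>I\<close> has entropy at most
      \<open>\<beta> * n\<close>, so its weight on the right is at least 1; counting reduces to
      \<open>sum_exp_neg_ent\<close>.\<close>
    also have "(\<Sum>\<tau>\<in>I - {{}}. 1) \<le> (\<Sum>\<tau>\<in>Pow {..<n} - {{}}. exp (\<beta> * n) * exp (- ent n (card \<tau>)))"
    proof (rule sum_le_included[where i = id])
      show "\<forall>\<tau>\<in>I - {{}}. \<exists>\<sigma>\<in>Pow {..<n} - {{}}. id \<sigma> = \<tau> \<and> 1 \<le> exp (\<beta> * n) * exp (- ent n (card \<sigma>))"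
      proof
        fix \<tau> assume t: "\<tau> \<in> I - {{}}"
        hence "finite \<tau>" "\<tau> \<noteq> {}" "card \<tau> \<le> \<alpha> * n" using finite_subset by (auto simp: I_def)
        hence "ent n (card \<tau>) \<le> ent n (\<alpha> * n)" using \<alpha>n by (intro ent_mono) (auto simp: card_gt_0_iff)
        hence "1 \<le> exp (\<beta> * n) * exp (- ent n (card \<tau>))" unfolding ent_eq by (simp add: exp_add[symmetric])
        thus "\<exists>\<sigma>\<in>Pow {..<n} - {{}}. id \<sigma> = \<tau> \<and> 1 \<le> exp (\<beta> * n) * exp (- ent n (card \<sigma>))"
          using t by (auto simp: I_def)
      qed
    qed (use fI in auto)
    also have "\<dots> = exp (\<beta> * n) * (\<Sum>\<tau>\<in>Pow {..<n} - {{}}. exp (- ent n (card \<tau>)))" by (simp add: sum_distrib_left)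
    also have "\<dots> \<le> exp (\<beta> * n) * n" by (intro mult_left_mono sum_exp_neg_ent) auto
    finally have "real (card I) \<le> 1 + exp (\<beta> * n) * n" by simp
    also have "1 \<le> exp (\<beta> * n)" using \<beta>0 by simp
    finally show ?thesis by (simp add: algebra_simps)
  qed
  have "{E\<in>?G. \<exists>\<tau>. \<tau> \<subseteq> {..<n} \<and> card \<tau> \<le> \<alpha> * n \<and> uncovered n E \<tau> \<le> p * n / 2} =
      {E\<in>?G. \<exists>\<tau>\<in>I. uncovered n E \<tau> \<le> p * n / 2}" by (auto simp: I_def)
  hence "real (card {E\<in>?G. \<exists>\<tau>. \<tau> \<subseteq> {..<n} \<and> card \<tau> \<le> \<alpha> * n \<and> uncovered n E \<tau> \<le> p * n / 2}) \<le>
      (\<Sum>\<tau>\<in>I. real (card {E\<in>?G. uncovered n E \<tau> \<le> p * n / 2}))"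
    using card_union_bound[OF finite_regular_graphs fI] by simp
  also have "\<dots> \<le> (\<Sum>\<tau>\<in>I. card ?G * b)" by (intro sum_mono tail) (auto simp: I_def)
  also have "\<dots> = real (card I) * (card ?G * b)" by simp
  also have "\<dots> \<le> ((real n + 1) * exp (\<beta> * n)) * (card ?G * b)"
    using cI by (intro mult_right_mono) (auto simp: b_def)
  also have "\<dots> = (real n + 1) * (exp (\<beta> * n) * b) * card ?G" by simp
  also have "exp (\<beta> * n) * b = exp ((\<beta> - \<theta> * p / 2) * n)"
    unfolding b_def exp_add[symmetric] by (simp add: algebra_simps)
  finally show ?thesis by (simp add: \<beta>_def)
qed

section \<open>Slices of random regular graphs\<close>

text \<open>A bound on the number of bad graphs makes sense also when there are no graphs at all; it
  becomes a probability on the restricted filter, where the total is positive.\<close>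

lemma whp_regularI:
  fixes b :: "nat \<Rightarrow> real"
  assumes bad: "\<forall>\<^sub>F n in sequentially. real (card {E\<in>regular_graphs n \<Delta>. \<not> Q n E}) \<le> b n * card (regular_graphs n \<Delta>)"
    and b: "b \<longlonglongrightarrow> 0"
  shows "whp_regular \<Delta> Q"
  unfolding whp_regular_def
proof (rule tendsto_sandwich)
  let ?F = "inf sequentially (principal {n. regular_graphs n \<Delta> \<noteq> {}})"
  have "((\<lambda>n. 1 - b n) \<longlongrightarrow> 1 - 0) sequentially" by (intro tendsto_diff tendsto_const b)
  thus "((\<lambda>n. 1 - b n) \<longlongrightarrow> 1) ?F" by (intro tendsto_mono[OF inf_le1]) simp
  show "((\<lambda>n. 1) \<longlongrightarrow> (1 :: real)) ?F" by simp
  show "\<forall>\<^sub>F n in ?F. measure_pmf.prob (pmf_of_set (regular_graphs n \<Delta>)) {E. Q n E} \<le> 1"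
    by (intro always_eventually allI measure_pmf.prob_le_1)
  show "\<forall>\<^sub>F n in ?F. 1 - b n \<le> measure_pmf.prob (pmf_of_set (regular_graphs n \<Delta>)) {E. Q n E}"
    unfolding eventually_inf_principal
  proof (rule eventually_mono[OF bad], intro impI)
    fix n assume le: "real (card {E\<in>regular_graphs n \<Delta>. \<not> Q n E}) \<le> b n * card (regular_graphs n \<Delta>)"
      and "n \<in> {n. regular_graphs n \<Delta> \<noteq> {}}"
    let ?G = "regular_graphs n \<Delta>"
    have ne: "?G \<noteq> {}" and fin: "finite ?G" using \<open>n \<in> _\<close> finite_regular_graphs by auto
    hence cpos: "real (card ?G) > 0" by (simp add: card_gt_0_iff)
    have "card ?G = card (?G \<inter> {E. Q n E}) + card {E\<in>?G. \<not> Q n E}"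
    proof -
      have "?G = (?G \<inter> {E. Q n E}) \<union> {E\<in>?G. \<not> Q n E}" by auto
      hence "card ?G = card ((?G \<inter> {E. Q n E}) \<union> {E\<in>?G. \<not> Q n E})" by simp
      also have "\<dots> = card (?G \<inter> {E. Q n E}) + card {E\<in>?G. \<not> Q n E}"
        using fin by (intro card_Un_disjoint) auto
      finally show ?thesis .
    qed
    hence "real (card ?G) = card (?G \<inter> {E. Q n E}) + real (card {E\<in>?G. \<not> Q n E})" by linarith
    hence "(1 - b n) * card ?G \<le> card (?G \<inter> {E. Q n E})" using le by (simp add: left_diff_distrib)
    hence "1 - b n \<le> card (?G \<inter> {E. Q n E}) / card ?G" using cpos by (simp add: pos_le_divide_eq)
    thus "1 - b n \<le> measure_pmf.prob (pmf_of_set ?G) {E. Q n E}"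
      using ne fin by (simp add: measure_pmf_of_set)
  qed
qed

text \<open>The property asserted in the theorem, with the mixing constants fixed at 3 and
  2.\<close>

definition good_slices :: "real \<Rightarrow> nat \<Rightarrow> nat set set \<Rightarrow> bool" where
  "good_slices \<alpha> n E \<longleftrightarrow> (\<forall>k::nat. 1 \<le> k \<and> real k \<le> \<alpha> * real n \<longrightarrow>
     indep_sets_of_size n E k \<noteq> {} \<and>
     connected_complex k (slice n E k) \<and>
     top_link_expander k (slice n E k) (1 / (2 * real k)) \<and>
     mixes_within 3 2 n (slice n E k))"

lemma good_slicesI:
  fixes \<alpha> \<Lambda> :: real
  assumes E: "E \<in> regular_graphs n \<Delta>" and n: "n \<ge> 1"
    and spec: "\<And>x :: nat \<Rightarrow> real. - \<Lambda> * (\<Sum>u<n. (x u)\<^sup>2) \<le> (\<Sum>u<n. \<Sum>v<n. of_bool ({u, v} \<in> E) * x u * x v)"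
    and free: "\<And>\<sigma> k. indep n E \<sigma> \<Longrightarrow> card \<sigma> + 2 \<le> k \<Longrightarrow> real k \<le> \<alpha> * n \<Longrightarrow>
      2 * real \<Delta> + 3 \<le> real (card (free_vertices n E \<sigma>)) \<and>
      real \<Delta> + 1 + 2 * real k * (\<Lambda> - 1) \<le> card (free_vertices n E \<sigma>)"
  shows "good_slices \<alpha> n E"
  unfolding good_slices_def
proof (intro allI impI)
  fix k :: nat assume k: "1 \<le> k \<and> real k \<le> \<alpha> * real n"
  hence k1: "k \<ge> 1" by simp
  have f1: "2 * \<Delta> + 3 \<le> card (free_vertices n E \<sigma>)" if "indep n E \<sigma>" "card \<sigma> + 2 \<le> k" for \<sigma>
    using free[OF that] k by linarith
  have f2: "\<Delta> + 1 + 2 * real k * (\<Lambda> - 1) \<le> card (free_vertices n E \<sigma>)"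
    if "indep n E \<sigma>" "card \<sigma> + 2 = k" for \<sigma>
    using free[OF that(1), of k] that(2) k by simp
  note prems = E k1 n spec f1 f2
  show "indep_sets_of_size n E k \<noteq> {} \<and> connected_complex k (slice n E k) \<and>
     top_link_expander k (slice n E k) (1 / (2 * real k)) \<and> mixes_within 3 2 n (slice n E k)"
    using facets_nonempty[OF prems] connected_slice[OF prems] slice_expander[OF prems] slice_mixes[OF prems]
    by blast
qed

lemma sum_adjacency:
  assumes "E \<in> regular_graphs n \<Delta>" "u < n"
  shows "(\<Sum>v<n. of_bool ({u, v} \<in> E)) = real \<Delta>"
proof -
  have "{v\<in>{..<n}. {u, v} \<in> E} = nbrs E u"
    using nbrs_subset[OF assms(1), of u] by (auto simp: nbrs_def insert_commute)
  thus ?thesis using card_nbrs[OF assms] by (simp add: of_bool_def sum.If_cases Int_def)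
qed

text \<open>The inequality \<open>0 \<le> (x u + x v)^2\<close>, summed over all arcs.\<close>

lemma adjacency_lower_trivial:
  assumes E: "E \<in> regular_graphs n \<Delta>"
  shows "- real \<Delta> * (\<Sum>u<n. (x u)\<^sup>2) \<le> (\<Sum>u<n. \<Sum>v<n. of_bool ({u, v} \<in> E) * x u * x v)"
proof -
  have 1: "(\<Sum>u<n. \<Sum>v<n. of_bool ({u, v} \<in> E) * (x u)\<^sup>2) = real \<Delta> * (\<Sum>u<n. (x u)\<^sup>2)"
    unfolding sum_distrib_left sum_distrib_right[symmetric]
    using sum_adjacency[OF E] by (intro sum.cong refl) simp
  have 2: "(\<Sum>u<n. \<Sum>v<n. of_bool ({u, v} \<in> E) * (x v)\<^sup>2) = real \<Delta> * (\<Sum>u<n. (x u)\<^sup>2)"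
    unfolding 1[symmetric] by (subst sum.swap) (simp add: insert_commute)
  have "- real \<Delta> * (\<Sum>u<n. (x u)\<^sup>2) = (\<Sum>u<n. \<Sum>v<n. - (of_bool ({u, v} \<in> E) * (x u)\<^sup>2 + of_bool ({u, v} \<in> E) * (x v)\<^sup>2) / 2)"
    using 1 2 by (simp add: sum_negf sum_divide_distrib[symmetric] sum.distrib sum_subtractf)
  also have "\<dots> \<le> (\<Sum>u<n. \<Sum>v<n. of_bool ({u, v} \<in> E) * x u * x v)"
  proof (intro sum_mono)
    fix u v
    have "0 \<le> (x u + x v)\<^sup>2" by simp
    thus "- (of_bool ({u, v} \<in> E) * (x u)\<^sup>2 + of_bool ({u, v} \<in> E) * (x v)\<^sup>2) / 2 \<le> of_bool ({u, v} \<in> E) * x u * x v"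
      by (cases "{u, v} \<in> E") (simp_all add: power2_sum)
  qed
  finally show ?thesis .
qed

lemma ln_ge_1: "ln (real \<Delta>) \<ge> 1" if "\<Delta> \<ge> 3"
proof -
  have "exp 1 \<le> (3 :: real)" by (rule exp_le)
  also have "\<dots> \<le> real \<Delta>" using that by simp
  finally show ?thesis using that by (simp add: ln_ge_iff)
qed

text \<open>Discrepancy controls the adjacency matrix minus \<open>\<Delta> / n\<close> times the
  all-ones matrix. The subtracted matrix is positive semidefinite, so adding it back can only raise
  the form.\<close>

lemma adjacency_lower:
  assumes E: "E \<in> regular_graphs n \<Delta>" and D: "\<Delta> \<ge> 3" and n: "n > 0"
    and disc: "\<And>S T. S \<subseteq> {..<n} \<Longrightarrow> T \<subseteq> {..<n} \<Longrightarrow> \<not> discrepant n \<Delta> E S T"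
  shows "- (15 * disc_const \<Delta> * ln \<Delta>) * (\<Sum>u<n. (x u)\<^sup>2) \<le> (\<Sum>u<n. \<Sum>v<n. of_bool ({u, v} \<in> E) * x u * x v)"
proof -
  define L where "L = ln (real \<Delta>)"
  have L1: "L \<ge> 1" using ln_ge_1[OF D] by (simp add: L_def)
  define M where "M u v = of_bool ({u, v} \<in> E) - real \<Delta> / n" for u v
  \<comment> \<open>\<open>2 ^ g \<ge> \<Delta>\<close> because \<open>ln 2 \<ge> 1 / 2\<close>, so
    the row-sum term with \<open>b = 2 * \<Delta>\<close> is at most 4; moreover
    \<open>2 * g + 1 \<le> 7 * L\<close>. Together these give the constant 15.\<close>
  define g where "g = nat \<lceil>2 * L\<rceil>"
  have g: "2 * L \<le> real g" "real g \<le> 2 * L + 1" unfolding g_def using L1 by (linarith, simp add: of_nat_ceiling)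
  have A16: "disc_const \<Delta> \<ge> 16"
  proof -
    have "1 * 1 \<le> sqrt (real \<Delta>) * ln (real \<Delta>)" using ln_ge_1[OF D] D by (intro mult_mono) auto
    thus ?thesis by (simp add: disc_const_def)
  qed
  have bound: "\<bar>bform {..<n} M x x\<bar> \<le> (2 * disc_const \<Delta> * (2 * g + 1) + 2 * (2 * real \<Delta>) / 2 ^ g) * (\<Sum>u<n. (x u)\<^sup>2)"
  proof (rule bform_bound)
    show "M u v = M v u" for u v by (simp add: M_def insert_commute)
    show "(\<Sum>v<n. \<bar>M u v\<bar>) \<le> 2 * real \<Delta>" if "u \<in> {..<n}" for u
    proof -
      have "(\<Sum>v<n. \<bar>M u v\<bar>) \<le> (\<Sum>v<n. of_bool ({u, v} \<in> E) + real \<Delta> / n)"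
        unfolding M_def by (intro sum_mono) (auto simp: abs_le_iff)
      also have "\<dots> = 2 * real \<Delta>" using sum_adjacency[OF E, of u] that n by (simp add: sum.distrib)
      finally show ?thesis .
    qed
    show "\<bar>\<Sum>u\<in>S. \<Sum>v\<in>T. M u v\<bar> \<le> disc_const \<Delta> * sqrt (real (card S) * card T)"
      if "S \<subseteq> {..<n}" "T \<subseteq> {..<n}" for S T
    proof -
      have fin: "finite S" "finite T" using that finite_subset by auto
      have "(\<Sum>u\<in>S. \<Sum>v\<in>T. M u v) = real (arcs_between E S T) - \<Delta> * real (card S) * card T / n"
        unfolding M_def arcs_between_sum[OF fin] by (simp add: sum_subtractf)
      thus ?thesis using disc[OF that] by (simp add: discrepant_def)
    qed
  qed (use A16 in auto)
  have "2 * disc_const \<Delta> * (2 * g + 1) + 2 * (2 * real \<Delta>) / 2 ^ g \<le> 15 * disc_const \<Delta> * L"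
  proof -
    have "real \<Delta> \<le> 2 ^ g"
    proof -
      have "L \<le> real g * ln 2"
      proof -
        have "exp (1 / 2) \<le> 1 + 1 / 2 + (1 / 2 :: real)\<^sup>2" by (intro exp_bound) auto
        hence "exp (1 / 2) \<le> (2 :: real)" by (simp add: power2_eq_square)
        hence "1 / 2 \<le> ln (2 :: real)" by (subst ln_ge_iff) auto
        hence "real g * (1 / 2) \<le> real g * ln 2" by (intro mult_left_mono) auto
        thus ?thesis using g by simp
      qed
      hence "exp L \<le> exp (real g * ln 2)" by simp
      also have "\<dots> = 2 ^ g" by (simp add: exp_of_nat_mult)
      finally show ?thesis using D by (simp add: L_def)
    qed
    hence "2 * (2 * real \<Delta>) / 2 ^ g \<le> 4" by (simp add: pos_divide_le_eq)
    moreover have "2 * disc_const \<Delta> * (2 * g + 1) \<le> 2 * disc_const \<Delta> * (7 * L)"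
      using g L1 A16 by (intro mult_left_mono) auto
    moreover have "4 * 1 \<le> disc_const \<Delta> * L" using A16 L1 by (intro mult_mono) auto
    moreover have "2 * disc_const \<Delta> * (7 * L) = 14 * (disc_const \<Delta> * L)"
      "15 * disc_const \<Delta> * L = 15 * (disc_const \<Delta> * L)" by simp_all
    ultimately show ?thesis by argo
  qed
  hence "(2 * disc_const \<Delta> * (2 * g + 1) + 2 * (2 * real \<Delta>) / 2 ^ g) * (\<Sum>u<n. (x u)\<^sup>2) \<le> 15 * disc_const \<Delta> * L * (\<Sum>u<n. (x u)\<^sup>2)"
    by (rule mult_right_mono) (auto intro: sum_nonneg)
  from abs_le_D2[OF order_trans[OF bound this]]
  have "- (15 * disc_const \<Delta> * L * (\<Sum>u<n. (x u)\<^sup>2)) \<le> bform {..<n} M x x" by (subst minus_le_iff)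
  hence "- (15 * disc_const \<Delta> * L) * (\<Sum>u<n. (x u)\<^sup>2) \<le> bform {..<n} M x x" by (simp only: mult_minus_left)
  also have "bform {..<n} M x x = (\<Sum>u<n. \<Sum>v<n. of_bool ({u, v} \<in> E) * x u * x v) - real \<Delta> / n * ((\<Sum>u<n. x u) * (\<Sum>v<n. x v))"
  proof -
    have "bform {..<n} M x x = (\<Sum>u<n. \<Sum>v<n. of_bool ({u, v} \<in> E) * x u * x v - real \<Delta> / n * (x u * x v))"
      unfolding bform_def M_def by (intro sum.cong refl) (simp only: left_diff_distrib mult.assoc)
    thus ?thesis unfolding sum_product by (simp only: sum_subtractf sum_distrib_left)
  qed
  also have "\<dots> \<le> (\<Sum>u<n. \<Sum>v<n. of_bool ({u, v} \<in> E) * x u * x v)" by simp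
  finally show ?thesis by (simp add: L_def)
qed

lemma uncovered_le_free: "uncovered n E \<sigma> \<le> card (free_vertices n E \<sigma>) + card \<sigma>" if "finite \<sigma>"
proof -
  have fin: "finite (free_vertices n E \<sigma>)" by (rule finite_subset[of _ "{..<n}"]) (auto simp: free_vertices_def)
  have "{v. v < n \<and> nbrs E v \<inter> \<sigma> = {}} \<subseteq> free_vertices n E \<sigma> \<union> \<sigma>"
    by (auto simp: free_vertices_def nbrs_def)
  hence "uncovered n E \<sigma> \<le> card (free_vertices n E \<sigma> \<union> \<sigma>)"
    unfolding uncovered_def using that fin by (intro card_mono) auto
  thus ?thesis using card_Un_le order_trans by blast
qed

text \<open>\<open>ent\<close> makes the union bound over small sets decay exponentially. By
  \<open>big\<close> the uncovered vertices number at least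
  \<open>5 * \<alpha> * \<Lambda> * n\<close>: one fifth covers the vertices of
  \<open>\<sigma>\<close> itself, two fifths pay for \<open>2 * k * (\<Lambda> - 1)\<close> together
  with \<open>\<Delta> + 1\<close>, and the rest is slack.\<close>

lemma whp_good_slices_large:
  fixes \<alpha> \<theta> \<Lambda> p :: real
  assumes D: "\<Delta> \<ge> 3" and \<theta>: "\<theta> > 0" and \<alpha>: "0 < \<alpha>" "\<alpha> < 1 / 2"
  defines "\<Lambda> \<equiv> 15 * disc_const \<Delta> * ln \<Delta>"
    and "p \<equiv> exp (- (exp (4 * \<theta>) * \<alpha> / (1 - 2 * \<alpha>) * \<Delta>))"
  assumes ent: "\<alpha> * (ln (1 / \<alpha>) + 1) < \<theta> * p / 2" and big: "5 * \<alpha> * \<Lambda> \<le> p / 2"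
  shows "whp_regular \<Delta> (good_slices \<alpha>)"
proof -
  define c where "c = \<theta> * p / 2 - \<alpha> * (ln (1 / \<alpha>) + 1)"
  have c: "c > 0" using ent by (simp add: c_def)
  have D0: "real \<Delta> > 0" using D by simp
  have \<Lambda>1: "\<Lambda> \<ge> 1"
  proof -
    have "1 * 1 \<le> sqrt (real \<Delta>) * ln (real \<Delta>)" using ln_ge_1[OF D] D by (intro mult_mono) auto
    hence "1 \<le> disc_const \<Delta>" by (simp add: disc_const_def)
    hence "1 * 1 \<le> disc_const \<Delta> * ln \<Delta>" using ln_ge_1[OF D] by (intro mult_mono) auto
    thus ?thesis by (simp add: \<Lambda>_def)
  qed
  have lim: "(\<lambda>n. 2 / (real n)\<^sup>2 + (real n + 1) * exp (- c * real n)) \<longlonglongrightarrow> 0"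
    using c by real_asymp
  have e1: "\<forall>\<^sub>F n in sequentially. 12 * real \<Delta> \<le> real n" by real_asymp
  have e2: "\<forall>\<^sub>F n in sequentially. 3 * (real \<Delta>)\<^sup>2 + 4 * ln (real n) \<le> 4 * real n" by real_asymp
  have e3: "\<forall>\<^sub>F n in sequentially. 4 * ln (real n) \<le> real n / (real \<Delta>)\<^sup>2" using D0 by real_asymp
  have e4: "\<forall>\<^sub>F n in sequentially. 6 * real \<Delta> < \<alpha> * real n" using \<alpha> by real_asymp
  have e5: "\<forall>\<^sub>F n in sequentially. real \<Delta> + 1 \<le> 2 * \<alpha> * real n" using \<alpha> by real_asymp
  have e6: "\<forall>\<^sub>F n in sequentially. 2 * real \<Delta> + 3 \<le> 4 * \<alpha> * real n" using \<alpha> by real_asymp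
  have "\<forall>\<^sub>F n in sequentially. real (card {E\<in>regular_graphs n \<Delta>. \<not> good_slices \<alpha> n E}) \<le>
      (2 / (real n)\<^sup>2 + (real n + 1) * exp (- c * real n)) * card (regular_graphs n \<Delta>)"
    using e1 e2 e3 e4 e5 e6
  proof eventually_elim
    case (elim n)
    let ?G = "regular_graphs n \<Delta>"
    let ?B1 = "{E\<in>?G. \<exists>S T. S \<subseteq> {..<n} \<and> T \<subseteq> {..<n} \<and> discrepant n \<Delta> E S T}"
    let ?B2 = "{E\<in>?G. \<exists>\<tau>. \<tau> \<subseteq> {..<n} \<and> card \<tau> \<le> \<alpha> * n \<and> uncovered n E \<tau> \<le> p * n / 2}"
    have n0: "n \<ge> 1" using elim(1) D by (cases n) auto
    have "good_slices \<alpha> n E" if E: "E \<in> ?G" and nb: "E \<notin> ?B1" "E \<notin> ?B2" for E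
    proof (rule good_slicesI[OF E n0])
      show "- \<Lambda> * (\<Sum>u<n. (x u)\<^sup>2) \<le> (\<Sum>u<n. \<Sum>v<n. of_bool ({u, v} \<in> E) * x u * x v)" for x :: "nat \<Rightarrow> real"
        unfolding \<Lambda>_def using E nb(1) n0 D by (intro adjacency_lower) auto
      fix \<sigma> k assume \<sigma>: "indep n E \<sigma>" "card \<sigma> + 2 \<le> k" and k: "real k \<le> \<alpha> * n"
      have sub: "\<sigma> \<subseteq> {..<n}" using \<sigma> by (simp add: indep_def)
      have cs: "card \<sigma> \<le> \<alpha> * n" using \<sigma>(2) k by linarith
      have "\<not> real (uncovered n E \<sigma>) \<le> p * n / 2" using nb(2) E sub cs by blast
      hence "real (uncovered n E \<sigma>) > p * n / 2" by simp
      moreover have "real (uncovered n E \<sigma>) \<le> real (card (free_vertices n E \<sigma>)) + card \<sigma>"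
        using uncovered_le_free[of \<sigma> n E] finite_subset[OF sub] by simp
      moreover have "5 * \<alpha> * \<Lambda> * n \<le> p / 2 * n" using big by (intro mult_right_mono) auto
      moreover have an: "\<alpha> * n * 1 \<le> \<alpha> * n * \<Lambda>" using \<Lambda>1 \<alpha> by (intro mult_left_mono) auto
      ultimately have free: "4 * (\<alpha> * n * \<Lambda>) \<le> card (free_vertices n E \<sigma>)" using cs by (simp add: mult_ac)
      have "real k * (\<Lambda> - 1) \<le> \<alpha> * n * (\<Lambda> - 1)" using k \<Lambda>1 by (intro mult_right_mono) auto
      hence "2 * real k * (\<Lambda> - 1) \<le> 2 * (\<alpha> * n * \<Lambda>) - 2 * (\<alpha> * n)" by (simp add: right_diff_distrib)
      thus "2 * real \<Delta> + 3 \<le> real (card (free_vertices n E \<sigma>)) \<and>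
          real \<Delta> + 1 + 2 * real k * (\<Lambda> - 1) \<le> card (free_vertices n E \<sigma>)"
        using free an elim(5,6) by simp
    qed
    hence "{E\<in>?G. \<not> good_slices \<alpha> n E} \<subseteq> ?B1 \<union> ?B2" by blast
    hence "card {E\<in>?G. \<not> good_slices \<alpha> n E} \<le> card (?B1 \<union> ?B2)"
      using finite_regular_graphs by (intro card_mono) auto
    also have "\<dots> \<le> card ?B1 + card ?B2" by (rule card_Un_le)
    finally have "real (card {E\<in>?G. \<not> good_slices \<alpha> n E}) \<le> real (card ?B1 + card ?B2)"
      by (rule of_nat_mono)
    hence "real (card {E\<in>?G. \<not> good_slices \<alpha> n E}) \<le> real (card ?B1) + real (card ?B2)"
      by (simp only: of_nat_add)
    also have "\<dots> \<le> 2 / (real n)\<^sup>2 * card ?G + (real n + 1) * exp ((\<alpha> * (ln (1 / \<alpha>) + 1) - \<theta> * p / 2) * n) * card ?G"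
      unfolding p_def using D \<theta> \<alpha> elim
      by (intro add_mono discrepancy_count uncovered_count) auto
    also have "(\<alpha> * (ln (1 / \<alpha>) + 1) - \<theta> * p / 2) * n = - c * n" by (simp add: c_def)
    finally show ?case by (simp add: distrib_right)
  qed
  thus ?thesis using lim by (rule whp_regularI)
qed

text \<open>No randomness enters: \<open>\<sigma>\<close> and its neighbours occupy at most
  \<open>card \<sigma> * (\<Delta> + 1)\<close> vertices, at most \<open>n / 5\<close> here, so with
  \<open>\<Lambda> = \<Delta>\<close> every large regular graph qualifies.\<close>

lemma whp_good_slices_small:
  assumes D: "\<Delta> \<ge> 1" and \<alpha>: "\<alpha> \<le> 1 / (10 * real \<Delta>)"
  shows "whp_regular \<Delta> (good_slices \<alpha>)"
proof (rule whp_regularI[where b = "\<lambda>_. 0"])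
  show "(\<lambda>n. 0) \<longlonglongrightarrow> (0 :: real)" by simp
  have e1: "\<forall>\<^sub>F n in sequentially. 10 * real \<Delta> + 30 \<le> real n" by real_asymp
  show "\<forall>\<^sub>F n in sequentially. real (card {E\<in>regular_graphs n \<Delta>. \<not> good_slices \<alpha> n E}) \<le> (0 :: real) * card (regular_graphs n \<Delta>)"
    using e1
  proof eventually_elim
    case (elim n)
    have n1: "n \<ge> 1" using elim by (cases n) auto
    have "good_slices \<alpha> n E" if E: "E \<in> regular_graphs n \<Delta>" for E
    proof (rule good_slicesI[OF E n1, where \<Lambda> = "real \<Delta>"])
      show "- real \<Delta> * (\<Sum>u<n. (x u)\<^sup>2) \<le> (\<Sum>u<n. \<Sum>v<n. of_bool ({u, v} \<in> E) * x u * x v)" for x :: "nat \<Rightarrow> real"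
        by (rule adjacency_lower_trivial[OF E])
      fix \<sigma> k assume \<sigma>: "indep n E \<sigma>" "card \<sigma> + 2 \<le> k" and k: "real k \<le> \<alpha> * n"
      have fs: "finite \<sigma>" using \<sigma> finite_subset by (auto simp: indep_def)
      have fin: "finite (free_vertices n E \<sigma>)" by (rule finite_subset[of _ "{..<n}"]) (auto simp: free_vertices_def)
      have "{..<n} \<subseteq> free_vertices n E \<sigma> \<union> (\<sigma> \<union> (\<Union>u\<in>\<sigma>. nbrs E u))"
        by (auto simp: free_vertices_def nbrs_def insert_commute)
      hence "card {..<n} \<le> card (free_vertices n E \<sigma> \<union> (\<sigma> \<union> (\<Union>u\<in>\<sigma>. nbrs E u)))"
        using fs fin finite_nbrs[OF E] by (intro card_mono) auto
      also have "\<dots> \<le> card (free_vertices n E \<sigma>) + (card \<sigma> + card (\<Union>u\<in>\<sigma>. nbrs E u))"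
        by (meson card_Un_le add_le_mono le_trans order_refl)
      also have "card (\<Union>u\<in>\<sigma>. nbrs E u) \<le> (\<Sum>u\<in>\<sigma>. card (nbrs E u))" using fs by (rule card_UN_le)
      also have "(\<Sum>u\<in>\<sigma>. card (nbrs E u)) \<le> card \<sigma> * \<Delta>"
        using sum_bounded_above[of \<sigma> "\<lambda>u. card (nbrs E u)" \<Delta>] card_nbrs_le[OF E] by simp
      finally have "n \<le> card (free_vertices n E \<sigma>) + (card \<sigma> + card \<sigma> * \<Delta>)" by simp
      hence "real n \<le> real (card (free_vertices n E \<sigma>) + (card \<sigma> + card \<sigma> * \<Delta>))" by (rule of_nat_mono)
      hence le: "real n \<le> real (card (free_vertices n E \<sigma>)) + (card \<sigma> + real (card \<sigma>) * \<Delta>)"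
        by (simp only: of_nat_add of_nat_mult)
      have kD: "real k * \<Delta> \<le> n / 10"
      proof -
        have "\<alpha> * n \<le> 1 / (10 * real \<Delta>) * n" using \<alpha> by (intro mult_right_mono) auto
        hence "real k * \<Delta> \<le> 1 / (10 * real \<Delta>) * n * \<Delta>" using k by (intro mult_right_mono) auto
        thus ?thesis using D by simp
      qed
      have "real (card \<sigma>) * \<Delta> \<le> real k * \<Delta>" using \<sigma>(2) by (intro mult_right_mono) auto
      moreover have "real (card \<sigma>) * 1 \<le> real (card \<sigma>) * \<Delta>" using D by (intro mult_left_mono) auto
      ultimately have free: "4 / 5 * real n \<le> card (free_vertices n E \<sigma>)" using le kD by simp
      have "2 * real k * (real \<Delta> - 1) \<le> 2 * (real k * \<Delta>)" by (simp add: right_diff_distrib)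
      thus "2 * real \<Delta> + 3 \<le> real (card (free_vertices n E \<sigma>)) \<and>
          real \<Delta> + 1 + 2 * real k * (real \<Delta> - 1) \<le> card (free_vertices n E \<sigma>)"
        using free kD elim by simp
    qed
    hence e: "{E\<in>regular_graphs n \<Delta>. \<not> good_slices \<alpha> n E} = {}" by blast
    show ?case unfolding e card.empty by simp
  qed
qed

text \<open>Since \<open>\<alpha> * \<Delta>\<close> is of order \<open>L\<close>, the choice
  \<open>\<theta> = 1 / L\<close> makes \<open>exp (4 * \<theta>)\<close> cost only a bounded amount
  in the exponent of \<open>p\<close>, and elsewhere only a factor \<open>L\<close>. Thus
  \<open>p\<close> is at least \<open>L^10 / (exp 9 * sqrt \<Delta>)\<close>, to be compared with
  multiples of \<open>L^3 / sqrt \<Delta>\<close> in the spectral condition and of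
  \<open>L^3 / \<Delta>\<close> in the entropy condition.\<close>

lemma threshold_conditions:
  fixes \<Delta> :: real
  defines "L \<equiv> ln \<Delta>"
  defines "\<gamma> \<equiv> 60 * ln L / L"
  defines "\<alpha> \<equiv> L / ((2 + \<gamma>) * \<Delta>)"
  defines "p \<equiv> exp (- (exp (4 * (1 / L)) * \<alpha> / (1 - 2 * \<alpha>) * \<Delta>))"
  assumes L4: "L \<ge> 4" and \<gamma>1: "\<gamma> \<le> 1" and DL: "2 * L\<^sup>2 \<le> \<Delta>" and L7: "1200 * exp 9 \<le> L ^ 7"
  shows "\<gamma> \<ge> 0" "0 < \<alpha>" "\<alpha> < 1 / 2" "\<alpha> * (ln (1 / \<alpha>) + 1) < (1 / L) * p / 2"
    "5 * \<alpha> * (240 * sqrt \<Delta> * L\<^sup>2) \<le> p / 2"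
proof -
  have L0: "L > 0" using L4 by simp
  have "L\<^sup>2 \<ge> 4\<^sup>2" using L4 by (intro power_mono) auto
  hence D32: "\<Delta> \<ge> 32" using DL by simp
  hence D0: "\<Delta> > 0" by simp
  have lnL: "ln L \<ge> 0" using L4 by simp
  show \<gamma>0: "\<gamma> \<ge> 0" unfolding \<gamma>_def using lnL L0 by simp
  show \<alpha>0: "0 < \<alpha>" unfolding \<alpha>_def using L0 D0 \<gamma>0 by (intro divide_pos_pos mult_pos_pos) auto
  have \<alpha>_le: "\<alpha> \<le> L / (2 * \<Delta>)" unfolding \<alpha>_def using L0 D0 \<gamma>0 by (intro divide_left_mono mult_right_mono) auto
  have \<alpha>L: "\<alpha> \<le> 1 / (4 * L)"
  proof -
    have "L / (2 * \<Delta>) \<le> L / (2 * (2 * L\<^sup>2))" using DL L0 D0 by (intro divide_left_mono) auto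
    also have "\<dots> = 1 / (4 * L)" using L0 by (simp add: power2_eq_square)
    finally show ?thesis using \<alpha>_le by simp
  qed
  have "1 / (4 * L) \<le> 1 / (4 * 4)" using L4 by (intro divide_left_mono) auto
  hence \<alpha>16: "\<alpha> \<le> 1 / 16" using \<alpha>L by simp
  thus "\<alpha> < 1 / 2" by simp
  have \<alpha>\<Delta>: "\<alpha> * \<Delta> = L / (2 + \<gamma>)" unfolding \<alpha>_def using D0 by simp
  \<comment> \<open>The 9 rounds up \<open>17 / 2\<close>, the cost of the corrections
    \<open>exp (4 / L)\<close> and \<open>1 / (1 - 2 * \<alpha>)\<close>. The gain
    \<open>10 * ln L\<close> is \<open>L * \<gamma> / 6\<close>, which explains the 60 in
    \<open>\<gamma>\<close>; it comes from
    \<open>1 / (2 + \<gamma>) \<le> 1 / 2 - \<gamma> / 6\<close>, valid for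
    \<open>\<gamma> \<le> 1\<close>.\<close>
  have expo: "exp (4 * (1 / L)) * \<alpha> / (1 - 2 * \<alpha>) * \<Delta> \<le> L / 2 - 10 * ln L + 9"
  proof -
    have "exp (4 / L) \<le> 1 + 4 / L + (4 / L)\<^sup>2" using L4 by (intro exp_bound) auto
    also have "(4 / L)\<^sup>2 \<le> 4 / L"
    proof -
      have "4 / L * (4 / L) \<le> 4 / L * 1" using L4 by (intro mult_left_mono) auto
      thus ?thesis by (simp add: power2_eq_square)
    qed
    finally have 1: "exp (4 / L) \<le> 1 + 8 / L" by simp
    have 2: "1 / (1 - 2 * \<alpha>) \<le> 1 + 1 / L"
    proof -
      have "1 / (1 - 2 * \<alpha>) \<le> 1 + 4 * \<alpha>"
      proof -
        have "0 \<le> 2 * \<alpha> * (1 - 4 * \<alpha>)" using \<alpha>0 \<alpha>16 by (intro mult_nonneg_nonneg) auto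
        hence "1 \<le> (1 + 4 * \<alpha>) * (1 - 2 * \<alpha>)" by (simp add: algebra_simps)
        thus ?thesis using \<alpha>16 by (simp add: pos_divide_le_eq)
      qed
      also have "4 * \<alpha> \<le> 1 / L" using \<alpha>L by simp
      finally show ?thesis by simp
    qed
    have 3: "(1 + 8 / L) * (1 + 1 / L) \<le> 1 + 17 / L"
    proof -
      define i where "i = 1 / L"
      have "0 \<le> i" "i \<le> 1" using L4 by (simp_all add: i_def)
      hence "i * i \<le> 1 * i" by (intro mult_right_mono) auto
      moreover have "(1 + 8 * i) * (1 + i) = 1 + 9 * i + 8 * (i * i)" by (simp add: algebra_simps)
      ultimately have "(1 + 8 * i) * (1 + i) \<le> 1 + 17 * i" by argo
      thus ?thesis by (simp add: i_def)
    qed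
    have "exp (4 * (1 / L)) * \<alpha> / (1 - 2 * \<alpha>) * \<Delta> = (exp (4 / L) * (1 / (1 - 2 * \<alpha>))) * (L / (2 + \<gamma>))"
      unfolding \<alpha>\<Delta>[symmetric] by simp
    also have "\<dots> \<le> ((1 + 8 / L) * (1 + 1 / L)) * (L / (2 + \<gamma>))"
      using 1 2 \<alpha>16 L0 \<gamma>0 by (intro mult_right_mono mult_mono) auto
    also have "\<dots> \<le> (1 + 17 / L) * (L / (2 + \<gamma>))" using 3 L0 \<gamma>0 by (intro mult_right_mono) auto
    also have "\<dots> = L / (2 + \<gamma>) + 17 / (2 + \<gamma>)"
    proof -
      have "17 / L * (L / (2 + \<gamma>)) = 17 / (2 + \<gamma>)" using L0 by simp
      thus ?thesis by (simp only: distrib_right mult_1_left)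
    qed
    also have "17 / (2 + \<gamma>) \<le> 17 / 2" using \<gamma>0 by (intro divide_left_mono) auto
    also have "L / (2 + \<gamma>) \<le> L / 2 - 10 * ln L"
    proof -
      have "1 \<le> (1 / 2 - \<gamma> / 6) * (2 + \<gamma>)"
      proof -
        have "0 \<le> \<gamma> * (1 - \<gamma>) / 6" using \<gamma>0 \<gamma>1 by simp
        thus ?thesis by (simp add: algebra_simps)
      qed
      hence "1 / (2 + \<gamma>) \<le> 1 / 2 - \<gamma> / 6" using \<gamma>0 by (simp add: pos_divide_le_eq)
      hence "L * (1 / (2 + \<gamma>)) \<le> L * (1 / 2 - \<gamma> / 6)" using L0 by (intro mult_left_mono) auto
      also have "\<dots> = L / 2 - 10 * ln L" using L0 by (simp add: \<gamma>_def algebra_simps)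
      finally show ?thesis by simp
    qed
    finally show ?thesis by simp
  qed
  have p_ge: "L ^ 10 / (exp 9 * sqrt \<Delta>) \<le> p"
  proof -
    have "exp (L / 2) = sqrt \<Delta>"
    proof -
      have "(exp (L / 2))\<^sup>2 = \<Delta>" using D0 by (simp add: power2_eq_square exp_add[symmetric] L_def)
      thus ?thesis by (metis real_sqrt_unique exp_ge_zero)
    qed
    moreover have "exp (10 * ln L) = L ^ 10" using L0 exp_of_nat_mult[of 10 "ln L"] by simp
    moreover have "exp (- (L / 2 - 10 * ln L + 9)) = exp (10 * ln L) / (exp 9 * exp (L / 2))"
    proof -
      have "- (L / 2 - 10 * ln L + 9) = 10 * ln L - (9 + L / 2)" by simp
      thus ?thesis by (simp only: exp_diff exp_add)
    qed
    ultimately have "L ^ 10 / (exp 9 * sqrt \<Delta>) = exp (- (L / 2 - 10 * ln L + 9))"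
      by (simp only:)
    also have "\<dots> \<le> p" unfolding p_def using expo by simp
    finally show ?thesis .
  qed
  have sD: "sqrt \<Delta> \<ge> 1" using D32 by simp
  have sDD: "sqrt \<Delta> * sqrt \<Delta> = \<Delta>" using D0 by simp
  have "5 * \<alpha> * (240 * sqrt \<Delta> * L\<^sup>2) \<le> 5 * (L / (2 * \<Delta>)) * (240 * sqrt \<Delta> * L\<^sup>2)"
    using \<alpha>_le D0 by (intro mult_right_mono mult_left_mono) auto
  also have "\<dots> = 600 * L ^ 3 / sqrt \<Delta>"
  proof -
    have "5 * (L / (2 * (s * s))) * (240 * s * L\<^sup>2) = 600 * L ^ 3 / s" if "s > 0" for s
      using that by (simp add: power2_eq_square power3_eq_cube field_simps)
    from this[of "sqrt \<Delta>"] show ?thesis using sD unfolding sDD by simp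
  qed
  \<comment> \<open>\<open>L7\<close> is this comparison after division by \<open>L^3\<close>:
    \<open>600 * L^3\<close> against \<open>L^10 / (2 * exp 9)\<close>.\<close>
  also have "\<dots> \<le> (L ^ 10 / (exp 9 * sqrt \<Delta>)) / 2"
  proof -
    have "1200 * exp 9 * L ^ 3 \<le> L ^ 7 * L ^ 3" using L7 L0 by (intro mult_right_mono) auto
    also have "\<dots> = L ^ 10" by (simp add: power_add[symmetric])
    finally have "600 * L ^ 3 \<le> L ^ 10 / (2 * exp 9)" by (simp add: pos_le_divide_eq mult_ac)
    hence "600 * L ^ 3 / sqrt \<Delta> \<le> L ^ 10 / (2 * exp 9) / sqrt \<Delta>" using sD by (intro divide_right_mono) auto
    thus ?thesis by (simp add: mult_ac)
  qed
  also have "\<dots> \<le> p / 2" using p_ge by simp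
  finally show "5 * \<alpha> * (240 * sqrt \<Delta> * L\<^sup>2) \<le> p / 2" .
  have "\<alpha> * (ln (1 / \<alpha>) + 1) = ent 1 \<alpha>" by (simp add: ent_def distrib_left)
  also have "\<dots> \<le> ent 1 (L / (2 * \<Delta>))"
  proof (rule ent_mono)
    have "L \<le> L\<^sup>2" using L4 by (simp add: self_le_power)
    thus "L / (2 * \<Delta>) \<le> 1" using DL D0 by (simp add: pos_divide_le_eq)
  qed (use \<alpha>0 \<alpha>_le in auto)
  also have "\<dots> = L / (2 * \<Delta>) * (ln (2 * \<Delta> / L) + 1)" by (simp add: ent_def distrib_left)
  also have "\<dots> \<le> L / (2 * \<Delta>) * (L + 1)"
  proof -
    have "2 * \<Delta> / L \<le> \<Delta>" using L4 D0 by (simp add: pos_divide_le_eq)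
    hence "ln (2 * \<Delta> / L) \<le> L" unfolding L_def[symmetric] using L0 D0 by (subst L_def) (simp add: ln_le_cancel_iff)
    thus ?thesis using L0 D0 by (intro mult_left_mono) auto
  qed
  also have "\<dots> \<le> L / (2 * \<Delta>) * (2 * L)" using L4 D0 by (intro mult_left_mono) auto
  also have "\<dots> = L\<^sup>2 / (sqrt \<Delta> * sqrt \<Delta>)" unfolding sDD by (simp add: power2_eq_square)
  also have "\<dots> < L ^ 9 / (2 * exp 9 * sqrt \<Delta>)"
  proof -
    have "2 * exp 9 < 1200 * exp (9 :: real)" by simp
    also have "\<dots> \<le> L ^ 7" by (rule L7)
    also have "L ^ 7 * 1 \<le> L ^ 7 * sqrt \<Delta>" using sD L0 by (intro mult_left_mono) auto
    finally have "2 * exp 9 < L ^ 7 * sqrt \<Delta>" by simp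
    hence "L\<^sup>2 * (2 * exp 9) < L\<^sup>2 * (L ^ 7 * sqrt \<Delta>)" using L0 by (intro mult_strict_left_mono) auto
    also have "\<dots> = L ^ 9 * sqrt \<Delta>" by (simp add: power_add[symmetric])
    finally have "L\<^sup>2 / sqrt \<Delta> < L ^ 9 / (2 * exp 9)" using sD by (simp add: field_simps)
    hence "L\<^sup>2 / sqrt \<Delta> / sqrt \<Delta> < L ^ 9 / (2 * exp 9) / sqrt \<Delta>" using sD by (intro divide_strict_right_mono) auto
    thus ?thesis by simp
  qed
  also have "\<dots> = (1 / L) * (L ^ 10 / (exp 9 * sqrt \<Delta>)) / 2"
    using L0 by (simp add: eval_nat_numeral)
  also have "\<dots> \<le> (1 / L) * p / 2" using p_ge L0 by (intro divide_right_mono mult_left_mono) auto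
  finally show "\<alpha> * (ln (1 / \<alpha>) + 1) < (1 / L) * p / 2" .
qed

theorem theorem1p10:
  shows "\<exists>(\<gamma> :: nat \<Rightarrow> real) (C :: real) (c :: nat).
    (\<gamma> \<longlongrightarrow> 0) at_top \<and> (\<forall>\<Delta>\<ge>1. 2 + \<gamma> \<Delta> > 0) \<and>
    (\<forall>\<Delta>\<ge>1. let \<alpha> = ln (real \<Delta>) / ((2 + \<gamma> \<Delta>) * real \<Delta>) in
      whp_regular \<Delta> (\<lambda>n E. \<forall>k::nat. 1 \<le> k \<and> real k \<le> \<alpha> * real n \<longrightarrow>
        indep_sets_of_size n E k \<noteq> {} \<and>
        connected_complex k (slice n E k) \<and>
        top_link_expander k (slice n E k) (1 / (2 * real k)) \<and>
        mixes_within C c n (slice n E k)))"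
proof -
  have "\<forall>\<^sub>F d :: real in at_top. 4 \<le> ln d \<and> 60 * ln (ln d) / ln d \<le> 1 \<and> 2 * (ln d)\<^sup>2 \<le> d \<and> 1200 * exp 9 \<le> ln d ^ 7"
    by (intro eventually_conj; real_asymp)
  then obtain d0 :: real where d0: "\<And>d. d \<ge> d0 \<Longrightarrow>
      4 \<le> ln d \<and> 60 * ln (ln d) / ln d \<le> 1 \<and> 2 * (ln d)\<^sup>2 \<le> d \<and> 1200 * exp 9 \<le> ln d ^ 7"
    unfolding eventually_at_top_linorder by blast
  define N where "N = max 3 (nat \<lceil>d0\<rceil>)"
  have N: "real \<Delta> \<ge> d0" "\<Delta> \<ge> 3" if "\<Delta> \<ge> N" for \<Delta>
    using that unfolding N_def by linarith+
  \<comment> \<open>Below \<open>N\<close> this makes \<open>2 + \<gamma> \<Delta>\<close> equal to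
    \<open>10 * (1 + ln \<Delta>)\<close>, hence \<open>\<alpha> \<le> 1 / (10 * \<Delta>)\<close>;
    at \<open>\<Delta> = 1\<close> it gives \<open>\<alpha> = 0\<close> and no \<open>k\<close> is
    in range. Finitely many values leave the limit unchanged.\<close>
  define \<gamma> where "\<gamma> \<Delta> = (if \<Delta> \<ge> N then 60 * ln (ln (real \<Delta>)) / ln (real \<Delta>) else 10 * (1 + ln (real \<Delta>)) - 2)"
    for \<Delta> :: nat
  \<comment> \<open>Feeds the four conjuncts of \<open>d0\<close> into the four assumptions, one
    copy of \<open>d0\<close> for each.\<close>
  note cond = threshold_conditions[OF conjunct1 conjunct1[OF conjunct2] conjunct1[OF conjunct2[OF conjunct2]]
      conjunct2[OF conjunct2[OF conjunct2]], OF d0 d0 d0 d0]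
  have "(\<lambda>\<Delta>. 60 * ln (ln (real \<Delta>)) / ln (real \<Delta>)) \<longlonglongrightarrow> 0" by real_asymp
  moreover have "\<forall>\<^sub>F \<Delta> in sequentially. \<gamma> \<Delta> = 60 * ln (ln (real \<Delta>)) / ln (real \<Delta>)"
    using eventually_ge_at_top[of N] by eventually_elim (simp add: \<gamma>_def)
  ultimately have lim: "\<gamma> \<longlonglongrightarrow> 0" using tendsto_cong by force
  have pos: "2 + \<gamma> \<Delta> > 0" if "\<Delta> \<ge> 1" for \<Delta>
  proof (cases "\<Delta> \<ge> N")
    case True
    thus ?thesis using cond(1)[OF N(1) N(1) N(1) N(1), OF True True True True] by (simp add: \<gamma>_def)
  next
    case False
    have "ln (real \<Delta>) \<ge> 0" using that by simp
    thus ?thesis using False by (simp add: \<gamma>_def)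
  qed
  have "whp_regular \<Delta> (good_slices (ln (real \<Delta>) / ((2 + \<gamma> \<Delta>) * real \<Delta>)))" if D: "\<Delta> \<ge> 1" for \<Delta>
  proof (cases "\<Delta> \<ge> N")
    case True
    note N' = N(1)[OF True]
    note c = cond[OF N' N' N' N']
    have g: "\<gamma> \<Delta> = 60 * ln (ln (real \<Delta>)) / ln (real \<Delta>)" using True by (simp add: \<gamma>_def)
    have th: "1 / ln (real \<Delta>) > 0" using d0[OF N'] by simp
    \<comment> \<open>Identifies \<open>\<Lambda>\<close> with the expression in the threshold
      conditions: \<open>240 = 15 * 16\<close>, with 16 from \<open>disc_const\<close>.\<close>
    have big: "15 * disc_const \<Delta> * ln (real \<Delta>) = 240 * sqrt (real \<Delta>) * (ln (real \<Delta>))\<^sup>2"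
      by (simp add: disc_const_def power2_eq_square)
    show ?thesis unfolding g
      by (rule whp_good_slices_large[OF N(2)[OF True] th c(2,3,4), folded big]) (use c(5) in \<open>simp only: big\<close>)
  next
    case False
    have ln0: "ln (real \<Delta>) \<ge> 0" using D by simp
    have "ln (real \<Delta>) / ((2 + \<gamma> \<Delta>) * real \<Delta>) = ln (real \<Delta>) / (1 + ln (real \<Delta>)) * (1 / (10 * real \<Delta>))"
      using False by (simp add: \<gamma>_def)
    also have "\<dots> \<le> 1 * (1 / (10 * real \<Delta>))" using ln0 by (intro mult_right_mono) (auto simp: field_simps)
    finally show ?thesis using D by (intro whp_good_slices_small) auto
  qed
  thus ?thesis using lim pos unfolding good_slices_def[abs_def] Let_def
    by (intro exI[of _ \<gamma>] exI[of _ 3] exI[of _ 2]) auto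
qed

end
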